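(* Let $q$ be a prime power and $t=3$. In the André/Bruck-Bose setting described in the context, a point set $\mathcal{S}$ of the $3$-space $\Pi$ is the ABB-representation $\phi(\mathcal{T}\setminus\{P_\infty\})$ of (the affine point set of) a scattered $\mathbb{F}_q$-linear set $\mathcal{T}$ of rank $3$ in $\ell\cong\mathrm{PG}(1,q^3)$ containing $P_\infty$ if and only if $\mathcal{S}$ is the affine point set (the points not in $\pi_\infty$) of a hyperbolic quadric of $\Pi$ meeting the plane $\pi_\infty$ in a non-degenerate conic whose $\mathbb{F}_{q^3}$-extension contains the three conjugate points $R,R^\sigma,R^{\sigma^2}$ defining the spread element $\pi_\infty$.
   Context: Field reduction: viewing $\mathbb{F}_{q^3}^r$ as $\mathbb{F}_q^{3r}$, points of $\mathrm{PG}(r-1,q^3)$ correspond to planes of $\mathrm{PG}(3r-1,q)$; write $\mathcal{F}(X)$ for the image. The images of the points of $\mathrm{PG}(1,q^3)$ form the Desarguesian plane spread $\mathcal{D}$ of $\mathrm{PG}(5,q)$. For a subspace $\pi$ of $\mathrm{PG}(5,q)$, $\mathcal{B}(\pi)$ is the set of elements of $\mathcal{D}$ meeting $\pi$; an $\mathbb{F}_q$-linear set of rank $3$ is a set $\mathcal{T}\subseteq\mathrm{PG}(1,q^3)$ with $\mathcal{F}(\mathcal{T})=\mathcal{B}(\pi)$ for a plane $\pi$; it is scattered if it has $q^2+q+1$ points (every element of $\mathcal{B}(\pi)$ meets $\pi$ in one point). ABB setting: in $\mathrm{PG}(2,q^3)$ fix a line $\ell_\infty$; $H_\infty=\mathcal{F}(\ell_\infty)\cong\mathrm{PG}(5,q)$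 inside $\mathrm{PG}(8,q)$, carrying the Desarguesian plane spread $\mathcal{D}$. Fix a $6$-space $\mu\supset H_\infty$; for an affine point $P$ put $\phi(P)=\mathcal{F}(P)\cap\mu$. Let $\ell\neq\ell_\infty$ be a line, $P_\infty=\ell\cap\ell_\infty$, $\pi_\infty=\mathcal{F}(P_\infty)$ (a plane), $\Pi=\mathcal{F}(\ell)\cap\mu$, a $3$-space containing $\pi_\infty$ and all $\phi(P)$, $P\in\ell\setminus\{P_\infty\}$. Regard $H_\infty$ as the subgeometry of $\mathrm{PG}(5,q^3)$ fixed pointwise by a collineation $\sigma$ generating the group fixing it pointwise; $\mathcal{D}$ has a unique indicator line $\nu$ (skew to $H_\infty$) such that the spread elements are the spaces $\langle P,P^\sigma,P^{\sigma^2}\rangle\cap H_\infty$, $P\in\nu$. The three conjugate points defining $\pi_\infty$ are $R,R^\sigma,R^{\sigma^2}$, where $R=\nu\cap\pi_\infty^*$ and $\pi_\infty^*$ is the $\mathbb{F}_{q^3}$-extension of $\pi_\infty$. *)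

theory Defs
  imports "HOL-Analysis.Analysis"
begin

text \<open>
  A projective space is the lattice of subspaces of a vector space: a projective \<open>d\<close>-space
  is a vector subspace of dimension \<open>d + 1\<close>, a point is a subspace of dimension 1, and
  incidence is inclusion of subspaces.
\<close>

definition psubspaces :: "nat \<Rightarrow> ('a::field ^ 'n) set \<Rightarrow> ('a ^ 'n) set set" where
  "psubspaces d U = {X. vec.subspace X \<and> vec.dim X = d + 1 \<and> X \<subseteq> U}"

abbreviation ppoints :: "('a::field ^ 'n) set \<Rightarrow> ('a ^ 'n) set set" where
  "ppoints U \<equiv> psubspaces 0 U"

definition field_embedding :: "('a::field \<Rightarrow> 'b::field) \<Rightarrow> bool" where
  "field_embedding h \<longleftrightarrow>
     h 1 = 1 \<and> (\<forall>x y. h (x + y) = h x + h y) \<and> (\<forall>x y. h (x * y) = h x * h y)"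

text \<open>
  Collineations of the projective space of a subspace \<open>W\<close> are the maps on points induced by
  semilinear bijections (the elements of the group \<open>P\<Gamma>L\<close>); \<open>g\<close> is only relevant on the points
  of \<open>W\<close>.
\<close>

definition collineation :: "('a::field ^ 'n) set \<Rightarrow> (('a ^ 'n) set \<Rightarrow> ('a ^ 'n) set) \<Rightarrow> bool" where
  "collineation W g \<longleftrightarrow>
     (\<exists>f \<theta>. field_embedding (\<theta> :: 'a \<Rightarrow> 'a) \<and> bij \<theta> \<and> bij_betw f W W \<and>
        (\<forall>x\<in>W. \<forall>y\<in>W. f (x + y) = f x + f y) \<and>
        (\<forall>c. \<forall>x\<in>W. f (c *s x) = \<theta> c *s f x) \<and>
        (\<forall>X\<in>ppoints W. g X = f ` X))"

definition polar :: "('a::field ^ 'n \<Rightarrow> 'a) \<Rightarrow> 'a ^ 'n \<Rightarrow> 'a ^ 'n \<Rightarrow> 'a" where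
  "polar Q u v = Q (u + v) - Q u - Q v"

definition quadratic_form_on :: "('a::field ^ 'n) set \<Rightarrow> ('a ^ 'n \<Rightarrow> 'a) \<Rightarrow> bool" where
  "quadratic_form_on W Q \<longleftrightarrow>
     (\<forall>c. \<forall>v\<in>W. Q (c *s v) = c\<^sup>2 * Q v) \<and>
     (\<forall>u\<in>W. \<forall>v\<in>W. \<forall>w\<in>W. polar Q (u + v) w = polar Q u w + polar Q v w) \<and>
     (\<forall>c. \<forall>u\<in>W. \<forall>w\<in>W. polar Q (c *s u) w = c * polar Q u w)"

definition quadric :: "('a::field ^ 'n) set \<Rightarrow> ('a ^ 'n \<Rightarrow> 'a) \<Rightarrow> ('a ^ 'n) set set" where
  "quadric W Q = {X \<in> ppoints W. \<forall>x\<in>X. Q x = 0}"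

text \<open>
  No singular points. In characteristic 2 the polar form alone is not enough: for a conic it
  always has a nonzero radical (the nucleus).
\<close>

definition nondegenerate_on :: "('a::field ^ 'n) set \<Rightarrow> ('a ^ 'n \<Rightarrow> 'a) \<Rightarrow> bool" where
  "nondegenerate_on W Q \<longleftrightarrow>
     (\<forall>v\<in>W. Q v = 0 \<and> (\<forall>u\<in>W. polar Q u v = 0) \<longrightarrow> v = 0)"

text \<open>A hyperbolic quadric of a projective 3-space: \<open>X\<^sub>0X\<^sub>1 + X\<^sub>2X\<^sub>3 = 0\<close> in a suitable frame.\<close>

definition hyperbolic_on :: "('a::field ^ 'n) set \<Rightarrow> ('a ^ 'n \<Rightarrow> 'a) \<Rightarrow> bool" where
  "hyperbolic_on W Q \<longleftrightarrow> quadratic_form_on W Q \<and>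
     (\<exists>a b c d. card {a, b, c, d} = 4 \<and> vec.independent {a, b, c, d} \<and>
        vec.span {a, b, c, d} = W \<and>
        (\<forall>x y z w. Q (x *s a + y *s b + z *s c + w *s d) = x * y + z * w))"

text \<open>
  \<open>'f\<close> is the field with \<open>q\<close> elements, \<open>'k\<close> the field with \<open>q\<^sup>3\<close> elements, and \<open>\<beta>\<close> is an
  identification of \<open>'k ^ 3\<close> with \<open>'f ^ 9\<close> as vector spaces over \<open>'f\<close>. The image of a subspace
  \<open>X\<close> under field reduction is \<open>\<beta> ` X\<close>.
\<close>

definition field_reduction ::
  "('f::field \<Rightarrow> 'k::field) \<Rightarrow> ('k ^ 'm \<Rightarrow> 'f ^ 'n) \<Rightarrow> bool" where
  "field_reduction emb \<beta> \<longleftrightarrow>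
     field_embedding emb \<and>
     Vector_Spaces.linear (\<lambda>c v. emb c *s v) (\<lambda>c v. c *s v) \<beta> \<and> bij \<beta>"

definition spread :: "('k::field ^ 'm \<Rightarrow> 'f::field ^ 'n) \<Rightarrow> ('k ^ 'm) set \<Rightarrow> ('f ^ 'n) set set" where
  "spread \<beta> U = (\<lambda>P. \<beta> ` P) ` ppoints U"

definition meeting :: "('f::field ^ 'n) set set \<Rightarrow> ('f ^ 'n) set \<Rightarrow> ('f ^ 'n) set set" where
  "meeting D \<pi> = {X \<in> D. X \<inter> \<pi> \<noteq> {0}}"

definition linear_set_rank3 ::
  "('k::field ^ 'm \<Rightarrow> 'f::field ^ 'n) \<Rightarrow> ('k ^ 'm) set \<Rightarrow> ('k ^ 'm) set set \<Rightarrow> bool" where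
  "linear_set_rank3 \<beta> l T \<longleftrightarrow>
     T \<subseteq> ppoints l \<and>
     (\<exists>\<pi> \<in> psubspaces 2 (\<beta> ` l). (\<lambda>P. \<beta> ` P) ` T = meeting (spread \<beta> l) \<pi>)"

definition scattered_linear_set_rank3 ::
  "('k::field ^ 'm \<Rightarrow> 'f::field ^ 'n) \<Rightarrow> ('k ^ 'm) set \<Rightarrow> ('k ^ 'm) set set \<Rightarrow> bool" where
  "scattered_linear_set_rank3 \<beta> l T \<longleftrightarrow>
     linear_set_rank3 \<beta> l T \<and> card T = CARD('f)\<^sup>2 + CARD('f) + 1"

definition ABB ::
  "('k::field ^ 'm \<Rightarrow> 'f::field ^ 'n) \<Rightarrow> ('f ^ 'n) set \<Rightarrow> ('k ^ 'm) set \<Rightarrow> ('f ^ 'n) set" where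
  "ABB \<beta> \<mu> P = \<beta> ` P \<inter> \<mu>"

text \<open>
  \<open>'f ^ 'n\<close> sits in \<open>'k ^ 'n\<close> coordinatewise. A projective subspace \<open>U\<close> over \<open>'f\<close> thus becomes
  a subgeometry of the projective space of its extension \<open>ext emb U\<close>, which is a subspace
  over \<open>'k\<close> of the same dimension.
\<close>

definition ext_vec :: "('f \<Rightarrow> 'k) \<Rightarrow> 'f ^ 'n \<Rightarrow> 'k ^ 'n" where
  "ext_vec emb v = (\<chi> i. emb (v $ i))"

definition ext :: "('f::field \<Rightarrow> 'k::field) \<Rightarrow> ('f ^ 'n) set \<Rightarrow> ('k ^ 'n) set" where
  "ext emb U = vec.span (ext_vec emb ` U)"

definition fixes_subgeometry ::
  "('f::field \<Rightarrow> 'k::field) \<Rightarrow> ('f ^ 'n) set \<Rightarrow> (('k ^ 'n) set \<Rightarrow> ('k ^ 'n) set) \<Rightarrow> bool" where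
  "fixes_subgeometry emb H g \<longleftrightarrow>
     collineation (ext emb H) g \<and> (\<forall>X\<in>ppoints H. g (ext emb X) = ext emb X)"

text \<open>
  \<open>\<sigma>\<close> generates the group of all collineations fixing the subgeometry \<open>H\<close> pointwise. The
  group is finite, so nonnegative powers suffice.
\<close>

definition generates_stabiliser ::
  "('f::field \<Rightarrow> 'k::field) \<Rightarrow> ('f ^ 'n) set \<Rightarrow> (('k ^ 'n) set \<Rightarrow> ('k ^ 'n) set) \<Rightarrow> bool" where
  "generates_stabiliser emb H \<sigma> \<longleftrightarrow>
     fixes_subgeometry emb H \<sigma> \<and>
     (\<forall>\<tau>. fixes_subgeometry emb H \<tau> \<longrightarrow>
        (\<exists>n. \<forall>X\<in>ppoints (ext emb H). \<tau> X = (\<sigma> ^^ n) X))"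

definition indicator_line ::
  "('f::field \<Rightarrow> 'k::field) \<Rightarrow> ('f ^ 'n) set \<Rightarrow> ('f ^ 'n) set set \<Rightarrow>
   (('k ^ 'n) set \<Rightarrow> ('k ^ 'n) set) \<Rightarrow> ('k ^ 'n) set \<Rightarrow> bool" where
  "indicator_line emb H D \<sigma> \<nu> \<longleftrightarrow>
     \<nu> \<in> psubspaces 1 (ext emb H) \<and>
     (\<forall>X\<in>ppoints H. \<not> ext emb X \<subseteq> \<nu>) \<and>
     D = (\<lambda>P. {v \<in> H. ext_vec emb v \<in> vec.span (P \<union> \<sigma> P \<union> \<sigma> (\<sigma> P))}) ` ppoints \<nu>"

text \<open>
  The points over \<open>'k\<close> of the quadric of \<open>W\<close> with equation \<open>Q = 0\<close>. The form \<open>Q'\<close> below is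
  the extension of \<open>Q\<close> by scalars; it is determined on \<open>ext emb W\<close> by \<open>Q\<close> and exists whenever
  \<open>Q\<close> is a quadratic form on the subspace \<open>W\<close>.
\<close>

definition extended_quadric ::
  "('f::field \<Rightarrow> 'k::field) \<Rightarrow> ('f ^ 'n) set \<Rightarrow> ('f ^ 'n \<Rightarrow> 'f) \<Rightarrow> ('k ^ 'n) set set" where
  "extended_quadric emb W Q =
     {X. \<exists>Q'. quadratic_form_on (ext emb W) Q' \<and>
              (\<forall>v\<in>W. Q' (ext_vec emb v) = emb (Q v)) \<and>
              X \<in> quadric (ext emb W) Q'}"

end

theory Submission
  imports Defs
begin

text \<open>
  Let \<open>\<theta>\<close> be the automorphism of \<open>'k\<close> that belongs to \<open>\<sigma>\<close>, and write \<open>l = \<langle>p, e\<rangle>\<close> with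
  \<open>\<beta> e \<in> \<mu>\<close>, so that \<open>\<Pi>\<^sub>l = {\<beta> (x p + t e) | x \<in> 'k, t \<in> 'f}\<close>. Comparing coordinates over four
  spread elements shows that \<open>R\<close> is a common eigenvector of the multiplications by
  elements of \<open>'k\<close>.

  A linear set through \<open>P_inf\<close> comes from the span of \<open>p\<close>, \<open>b\<^sub>1 p + c\<^sub>1 e\<close> and \<open>b\<^sub>2 p + c\<^sub>2 e\<close> over \<open>'f\<close>,
  and its affine points are the zeros of the determinant of
  \<open>c\<^sub>j \<mapsto> x c\<^sub>j - t b\<^sub>j\<close>, a linear map between planes over \<open>'f\<close> with target \<open>'k / 'f\<close>. This
  determinant is a quadratic form in \<open>(x, t)\<close>, and it is hyperbolic exactly when the four entries of the
  matrix are independent, that is, when the linear set is scattered.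

  Conversely, a line of the quadric through a point of the conic at infinity gives a frame in
  which the conic is \<open>X\<^sub>1 X\<^sub>2 = X\<^sub>3\<^sup>2 / N\<close>. Since \<open>R\<close> lies on the conic, the
  inverse of the parametrised conic is a line spanned by \<open>1\<close> and a conjugate \<open>u\<close> of the parameter of
  \<open>R\<close>, and \<open>c\<^sub>1, c\<^sub>2, b\<^sub>1, b\<^sub>2\<close> can be written down from \<open>u\<close>.
\<close>

section \<open>Cubic extensions of finite fields\<close>

text \<open>Why the conjugate points appear: at infinity the determinant vanishes at
  \<open>x\<close> iff \<open>x\<close> is an \<open>'f\<close>-multiple of some
  \<open>1 / (m c1 + n c2)\<close>. Since \<open>1 / y\<close> is
  \<open>\<theta> y * \<theta> (\<theta> y)\<close> divided by the norm of \<open>y\<close>,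
  inversion is a quadratic map. Over \<open>'k\<close> the three conjugates of \<open>x\<close>
  become independent coordinates, and the equation of the conic contains only products of two
  different ones; so it vanishes wherever two of the three coordinates do, which is at
  \<open>R\<close> and its conjugates. Conversely, passing through \<open>R\<close> forces the conic
  to consist of inverses of elements \<open>m + n u\<close> up to a fixed factor. The affine points
  then only leave \<open>b1\<close> and \<open>b2\<close> to be chosen, and two lines of the quadric
  fix them. One obstacle is that neither \<open>\<theta>\<close> nor the place of \<open>R\<close>
  among its conjugates is prescribed: \<open>\<theta>\<close> is some nontrivial automorphism over
  \<open>'f\<close>, and \<open>R\<close> belongs to some index \<open>i\<close> modulo 3.
  Statements about \<open>R\<close> are therefore made for every index.\<close>

locale cubic_embedding =
  fixes emb :: "'f::{field,finite} \<Rightarrow> 'k::{field,finite}"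
  assumes field_embedding_emb: "field_embedding emb"
    and card_K: "CARD('k) = CARD('f) ^ 3"
begin

lemma emb_1 [simp]: "emb 1 = 1"
  and emb_add: "emb (x + y) = emb x + emb y"
  and emb_mult: "emb (x * y) = emb x * emb y"
  using field_embedding_emb by (auto simp: field_embedding_def)

lemma emb_0 [simp]: "emb 0 = 0"
  using emb_add[of 0 0] by (metis add.right_neutral add_left_cancel)

lemma emb_minus: "emb (- x) = - emb x"
  using emb_add[of x "- x"] by (simp add: eq_neg_iff_add_eq_0 add.commute)

lemma emb_diff: "emb (x - y) = emb x - emb y"
  using emb_add[of x "- y"] by (simp add: emb_minus)

lemma emb_eq_0_iff [simp]: "emb x = 0 \<longleftrightarrow> x = 0"
proof
  assume "emb x = 0"
  show "x = 0"
  proof (rule ccontr)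
    assume "x \<noteq> 0"
    then have "emb x * emb (inverse x) = 1"
      by (simp flip: emb_mult)
    with \<open>emb x = 0\<close> show False by simp
  qed
qed simp

lemma emb_eq_iff [simp]: "emb x = emb y \<longleftrightarrow> x = y"
  using emb_eq_0_iff[of "x - y"] by (simp add: emb_diff del: emb_eq_0_iff)

lemma inj_emb: "inj emb"
  by (rule injI) simp

lemma emb_divide: "emb (x / y) = emb x / emb y"
proof (cases "y = 0")
  case False
  then have "emb (x / y) * emb y = emb x"
    by (simp flip: emb_mult)
  with False show ?thesis by (simp add: field_simps)
qed simp

lemma emb_inverse: "emb (inverse x) = inverse (emb x)"
  using emb_divide[of 1 x] by (simp add: inverse_eq_divide)

lemma emb_power: "emb (x ^ n) = emb x ^ n"
  by (induction n) (simp_all add: emb_mult)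

lemma two_le_card_F: "2 \<le> CARD('f)"
proof -
  have "card {0, 1 :: 'f} \<le> CARD('f)"
    by (intro card_mono) auto
  then show ?thesis by simp
qed

lemma card_K_gt: "CARD('f) < CARD('k)" "CARD('f)\<^sup>2 < CARD('k)"
  unfolding card_K using two_le_card_F power_strict_increasing[of 1 3 "CARD('f)"]
  by (simp_all add: power_strict_increasing)

lemma not_surj_emb: "\<exists>u. u \<notin> range emb"
proof (rule ccontr)
  assume "\<not> ?thesis"
  then have "range emb = UNIV" by auto
  then have "CARD('k) = CARD('f)"
    using card_image[OF inj_emb] by simp
  then have "CARD('f) ^ 3 = CARD('f) ^ 1"
    using card_K by simp
  then show False
    using two_le_card_F by (subst (asm) power_inject_exp) auto
qed

text \<open>
  If \<open>u\<close> were quadratic over \<open>'f\<close>, then \<open>'f + 'f u\<close> would be a subfield with \<open>q\<^sup>2\<close> elements,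
  and a vector space over it cannot have \<open>q\<^sup>3\<close> elements.
\<close>

lemma quadratic_independent:
  assumes u: "u \<notin> range emb"
    and eq: "emb a + emb b * u + emb c * u\<^sup>2 = 0"
  shows "a = 0" "b = 0" "c = 0"
proof -
  have lin: "x = 0 \<and> y = 0" if "emb x + emb y * u = 0" for x y
  proof (cases "y = 0")
    case False
    with that have "u = emb (- x / y)"
      by (simp add: emb_divide emb_minus field_simps eq_neg_iff_add_eq_0)
    with u show ?thesis by blast
  qed (use that in simp)
  have "c = 0"
  proof (rule ccontr)
    assume c: "c \<noteq> 0"
    define L where "L = (\<lambda>(x, y). emb x + emb y * u) ` UNIV"
    have L: "emb x + emb y * u \<in> L" for x y
      unfolding L_def by force
    have L_E: "\<exists>a b. x = emb a + emb b * u" if "x \<in> L" for x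
      using that unfolding L_def by auto
    have inj: "inj (\<lambda>(x, y). emb x + emb y * u)"
    proof (rule injI, clarify)
      fix x y x' y'
      assume "emb x + emb y * u = emb x' + emb y' * u"
      then have "emb (x - x') + emb (y - y') * u = 0"
        by (simp add: emb_diff algebra_simps)
      from lin[OF this] show "x = x' \<and> y = y'" by simp
    qed
    have card_L: "card L = CARD('f) ^ 2"
      unfolding L_def using card_image[OF inj] by (simp add: power2_eq_square)
    define s t where "s = - b / c" and "t = - a / c"
    have u2: "u\<^sup>2 = emb t + emb s * u"
    proof -
      have "emb c * u\<^sup>2 = - emb a - emb b * u"
        using eq by (simp add: algebra_simps eq_neg_iff_add_eq_0)
      then have "u\<^sup>2 = (- emb a - emb b * u) / emb c"
        using c by (simp add: field_simps)
      then show ?thesis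
        by (simp add: s_def t_def emb_divide emb_minus diff_divide_distrib)
    qed
    have L_mult: "x * y \<in> L" if mem: "x \<in> L" "y \<in> L" for x y
    proof -
      obtain a1 a2 where "x = emb a1 + emb a2 * u" using L_E[OF mem(1)] by blast
      moreover obtain b1 b2 where "y = emb b1 + emb b2 * u" using L_E[OF mem(2)] by blast
      ultimately have "x * y = emb a1 * emb b1 + (emb a1 * emb b2 + emb a2 * emb b1) * u
          + emb a2 * emb b2 * u\<^sup>2"
        by (simp add: algebra_simps power2_eq_square)
      also have "\<dots> = emb (a1 * b1 + a2 * b2 * t) + emb (a1 * b2 + a2 * b1 + a2 * b2 * s) * u"
        unfolding u2 by (simp add: emb_add emb_mult algebra_simps)
      finally show ?thesis using L by simp
    qed
    have L_inverse: "\<exists>y\<in>L. x * y = 1" if "x \<in> L" "x \<noteq> 0" for x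
    proof -
      have "(*) x ` L = L"
        using that L_mult by (intro endo_inj_surj) (auto simp: inj_on_def)
      moreover have "1 \<in> L" using L[of 1 0] by simp
      ultimately have "1 \<in> (*) x ` L" by simp
      then show ?thesis by auto
    qed
    have L_diff: "x - y \<in> L" if mem: "x \<in> L" "y \<in> L" for x y
    proof -
      obtain a1 a2 where "x = emb a1 + emb a2 * u" using L_E[OF mem(1)] by blast
      moreover obtain b1 b2 where "y = emb b1 + emb b2 * u" using L_E[OF mem(2)] by blast
      ultimately have "x - y = emb (a1 - b1) + emb (a2 - b2) * u"
        by (simp add: emb_diff algebra_simps)
      then show ?thesis using L by simp
    qed
    have "CARD('f) ^ 2 < CARD('k)"
      unfolding card_K using two_le_card_F by (intro power_strict_increasing) auto
    then obtain v where v: "v \<notin> L"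
      using card_L by (metis UNIV_eq_I less_irrefl)
    have "inj_on (\<lambda>(x, y). x + y * v) (L \<times> L)"
    proof (rule inj_onI, clarify)
      fix x y x' y'
      assume mem: "x \<in> L" "y \<in> L" "x' \<in> L" "y' \<in> L" and eq': "x + y * v = x' + y' * v"
      have "y = y'"
      proof (rule ccontr)
        assume "y \<noteq> y'"
        then obtain z where z: "z \<in> L" "(y - y') * z = 1"
          using L_inverse[of "y - y'"] L_diff mem by auto
        have "(y - y') * v = x' - x"
          using eq' by (simp add: algebra_simps)
        then have "(x' - x) * z = ((y - y') * z) * v"
          by (metis mult.assoc mult.commute)
        also have "\<dots> = v" using z by simp
        finally show False
          using v L_mult L_diff mem z by auto
      qed
      with eq' show "x = x' \<and> y = y'" by simp
    qed
    then have "card (L \<times> L) \<le> CARD('k)"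
      by (rule card_inj_on_le) simp_all
    also have "card (L \<times> L) = CARD('f) ^ 4"
      unfolding card_cartesian_product card_L by (simp add: power2_eq_square eval_nat_numeral)
    finally have "CARD('f) ^ 4 \<le> CARD('f) ^ 3"
      unfolding card_K .
    then show False
      using two_le_card_F by (subst (asm) power_increasing_iff) auto
  qed
  with eq lin[of a b] show "a = 0" "b = 0" "c = 0" by simp_all
qed

lemma quadratic_unique:
  assumes "u \<notin> range emb"
    and "emb a + emb b * u + emb c * u\<^sup>2 = emb a' + emb b' * u + emb c' * u\<^sup>2"
  shows "a = a'" "b = b'" "c = c'"
proof -
  have "emb (a - a') + emb (b - b') * u + emb (c - c') * u\<^sup>2 = 0"
    using assms(2) by (simp add: emb_diff algebra_simps)
  from quadratic_independent[OF assms(1) this] show "a = a'" "b = b'" "c = c'" by simp_all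
qed

text \<open>By \<open>quadratic_unique\<close> the \<open>q^3\<close> combinations are distinct, so
  they exhaust \<open>'k\<close>.\<close>

lemma quadratic_representation:
  assumes "u \<notin> range emb"
  obtains a b c where "x = emb a + emb b * u + emb c * u\<^sup>2"
proof -
  let ?h = "\<lambda>(a, b, c). emb a + emb b * u + emb c * u\<^sup>2"
  have "inj ?h"
    using quadratic_unique[OF assms] by (auto intro!: injI)
  then have "card (range ?h) = CARD('f) ^ 3"
    by (simp add: card_image eval_nat_numeral)
  then have "range ?h = UNIV"
    by (intro card_subset_eq) (auto simp: card_K)
  then have "x \<in> range ?h" by simp
  then show thesis using that by auto
qed

end

section \<open>The Galois group of the cubic extension\<close>

locale cubic_galois = cubic_embedding emb
  for emb :: "'f::{field,finite} \<Rightarrow> 'k::{field,finite}" +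
  fixes \<theta> :: "'k \<Rightarrow> 'k"
  assumes field_embedding_\<theta>: "field_embedding \<theta>"
    and \<theta>_emb [simp]: "\<theta> (emb c) = emb c"
    and \<theta>_nontrivial: "\<exists>x. \<theta> x \<noteq> x"
begin

lemma \<theta>_1 [simp]: "\<theta> 1 = 1"
  and \<theta>_add: "\<theta> (x + y) = \<theta> x + \<theta> y"
  and \<theta>_mult: "\<theta> (x * y) = \<theta> x * \<theta> y"
  using field_embedding_\<theta> by (auto simp: field_embedding_def)

lemma \<theta>_0 [simp]: "\<theta> 0 = 0"
  using \<theta>_add[of 0 0] by (metis add.right_neutral add_left_cancel)

lemma \<theta>_minus: "\<theta> (- x) = - \<theta> x"
  using \<theta>_add[of x "- x"] by (simp add: eq_neg_iff_add_eq_0 add.commute)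

lemma \<theta>_diff: "\<theta> (x - y) = \<theta> x - \<theta> y"
  using \<theta>_add[of x "- y"] by (simp add: \<theta>_minus)

lemma \<theta>_eq_0_iff [simp]: "\<theta> x = 0 \<longleftrightarrow> x = 0"
proof
  assume "\<theta> x = 0"
  show "x = 0"
  proof (rule ccontr)
    assume "x \<noteq> 0"
    then have "\<theta> x * \<theta> (inverse x) = 1"
      by (simp flip: \<theta>_mult)
    with \<open>\<theta> x = 0\<close> show False by simp
  qed
qed simp

lemma \<theta>_eq_iff [simp]: "\<theta> x = \<theta> y \<longleftrightarrow> x = y"
  using \<theta>_eq_0_iff[of "x - y"] by (simp add: \<theta>_diff del: \<theta>_eq_0_iff)

lemma \<theta>_divide: "\<theta> (x / y) = \<theta> x / \<theta> y"
proof (cases "y = 0")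
  case False
  then have "\<theta> (x / y) * \<theta> y = \<theta> x"
    by (simp flip: \<theta>_mult)
  with False show ?thesis by (simp add: field_simps)
qed simp

lemma \<theta>_power: "\<theta> (x ^ n) = \<theta> x ^ n"
  by (induction n) (simp_all add: \<theta>_mult)

lemma \<theta>_sum: "\<theta> (\<Sum>i\<in>I. h i) = (\<Sum>i\<in>I. \<theta> (h i))"
  by (induction I rule: infinite_finite_induct) (simp_all add: \<theta>_add)

text \<open>If \<open>\<theta>\<close> fixed some \<open>x\<close> outside \<open>'f\<close>, it
  would fix the basis \<open>1, x, x^2\<close> and hence all of \<open>'k\<close>.\<close>

lemma fixed_iff: "\<theta> x = x \<longleftrightarrow> x \<in> range emb"
proof
  assume x: "\<theta> x = x"
  show "x \<in> range emb"
  proof (rule ccontr)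
    assume nx: "x \<notin> range emb"
    have "\<theta> y = y" for y
    proof -
      obtain a b c where "y = emb a + emb b * x + emb c * x\<^sup>2"
        using quadratic_representation[OF nx] .
      then show ?thesis by (simp add: \<theta>_add \<theta>_mult \<theta>_power x)
    qed
    with \<theta>_nontrivial show False by blast
  qed
qed auto

text \<open>Otherwise \<open>u + \<theta> u\<close> and \<open>u * \<theta> u\<close> would be
  fixed, hence in \<open>'f\<close>, and \<open>u\<close> would be a root of a quadratic over
  \<open>'f\<close>.\<close>

lemma \<theta>_\<theta>_neq:
  assumes u: "u \<notin> range emb"
  shows "\<theta> (\<theta> u) \<noteq> u"
proof
  assume eq: "\<theta> (\<theta> u) = u"
  obtain s where s: "u + \<theta> u = emb s"
    using fixed_iff[of "u + \<theta> u"] by (auto simp: \<theta>_add eq add.commute)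
  obtain n where n: "u * \<theta> u = emb n"
    using fixed_iff[of "u * \<theta> u"] by (auto simp: \<theta>_mult eq mult.commute)
  have "emb n + emb (- s) * u + emb 1 * u\<^sup>2 = 0"
    by (simp add: emb_minus flip: s n) (simp add: algebra_simps power2_eq_square)
  from quadratic_independent[OF u this] show False by simp
qed

text \<open>The three conjugates of \<open>u\<close> are distinct, too many roots for degree
  two.\<close>

lemma conjugate_roots:
  assumes u: "u \<notin> range emb"
    and "a + b * u + c * u\<^sup>2 = 0"
    and "a + b * \<theta> u + c * (\<theta> u)\<^sup>2 = 0"
    and "a + b * \<theta> (\<theta> u) + c * (\<theta> (\<theta> u))\<^sup>2 = 0"
  shows "a = 0" "b = 0" "c = 0"
proof -
  let ?u1 = "\<theta> u" and ?u2 = "\<theta> (\<theta> u)"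
  have d: "?u1 \<noteq> u" "?u2 \<noteq> u" "?u1 \<noteq> ?u2"
    using u fixed_iff \<theta>_\<theta>_neq[OF u] by auto
  have div: "b + c * (x + y) = 0" if "x \<noteq> y" "a + b * x + c * x\<^sup>2 = 0" "a + b * y + c * y\<^sup>2 = 0" for x y
  proof -
    have "(x - y) * (b + c * (x + y)) = (a + b * x + c * x\<^sup>2) - (a + b * y + c * y\<^sup>2)"
      by (simp add: algebra_simps power2_eq_square)
    with that show ?thesis by simp
  qed
  have 1: "b + c * (?u1 + u) = 0" and 2: "b + c * (?u2 + u) = 0"
    using div assms(2-4) d by blast+
  have "c * (?u1 - ?u2) = (b + c * (?u1 + u)) - (b + c * (?u2 + u))"
    by (simp add: algebra_simps)
  with 1 2 d show c: "c = 0" by simp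
  with 1 show b: "b = 0" by simp
  with c assms(2) show "a = 0" by simp
qed

text \<open>The conjugates \<open>u\<close>, \<open>\<theta> u\<close>,
  \<open>\<theta> (\<theta> u)\<close> are all the roots of the cubic of \<open>u\<close> over
  \<open>'f\<close>. The next conjugate is a root as well, and by injectivity it can only be
  \<open>u\<close>.\<close>

lemma \<theta>_cubed [simp]: "\<theta> (\<theta> (\<theta> x)) = x"
proof -
  obtain u where u: "u \<notin> range emb" using not_surj_emb by blast
  let ?u1 = "\<theta> u" and ?u2 = "\<theta> (\<theta> u)" and ?u3 = "\<theta> (\<theta> (\<theta> u))"
  have d: "?u1 \<noteq> u" "?u2 \<noteq> u" "?u1 \<noteq> ?u2"
    using u fixed_iff \<theta>_\<theta>_neq[OF u] by auto
  obtain a b c where cubic: "u ^ 3 = emb a + emb b * u + emb c * u\<^sup>2"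
    using quadratic_representation[OF u] .
  have r1: "?u1 ^ 3 = emb a + emb b * ?u1 + emb c * ?u1\<^sup>2"
    using arg_cong[OF cubic, of \<theta>] by (simp add: \<theta>_add \<theta>_mult \<theta>_power)
  have r2: "?u2 ^ 3 = emb a + emb b * ?u2 + emb c * ?u2\<^sup>2"
    using arg_cong[OF r1, of \<theta>] by (simp add: \<theta>_add \<theta>_mult \<theta>_power)
  have r3: "?u3 ^ 3 = emb a + emb b * ?u3 + emb c * ?u3\<^sup>2"
    using arg_cong[OF r2, of \<theta>] by (simp add: \<theta>_add \<theta>_mult \<theta>_power)
  \<comment> \<open>The cubic of \<open>u\<close> minus the product of the three linear factors has
    degree at most two and three distinct zeros, so its coefficients vanish.\<close>
  have coeffs: "emb a = u * ?u1 * ?u2" "emb b = - (u * ?u1 + u * ?u2 + ?u1 * ?u2)"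
    "emb c = u + ?u1 + ?u2"
  proof -
    have vanish: "(emb a - u * ?u1 * ?u2) + (emb b + (u * ?u1 + u * ?u2 + ?u1 * ?u2)) * x
        + (emb c - (u + ?u1 + ?u2)) * x\<^sup>2 = 0"
      if "x ^ 3 = emb a + emb b * x + emb c * x\<^sup>2" "(x - u) * ((x - ?u1) * (x - ?u2)) = 0" for x
    proof -
      have "(emb a - u * ?u1 * ?u2) + (emb b + (u * ?u1 + u * ?u2 + ?u1 * ?u2)) * x
        + (emb c - (u + ?u1 + ?u2)) * x\<^sup>2
        = (x - u) * ((x - ?u1) * (x - ?u2)) - (x ^ 3 - (emb a + emb b * x + emb c * x\<^sup>2))"
        by (simp add: algebra_simps power2_eq_square power3_eq_cube)
      then show ?thesis using that by simp
    qed
    have "(u - u) * ((u - ?u1) * (u - ?u2)) = 0" "(?u1 - u) * ((?u1 - ?u1) * (?u1 - ?u2)) = 0"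
      "(?u2 - u) * ((?u2 - ?u1) * (?u2 - ?u2)) = 0" by simp_all
    note conjugate_roots[OF u vanish[OF cubic this(1)] vanish[OF r1 this(2)] vanish[OF r2 this(3)]]
    then
    show "emb a = u * ?u1 * ?u2" "emb b = - (u * ?u1 + u * ?u2 + ?u1 * ?u2)"
      "emb c = u + ?u1 + ?u2" by (simp_all only: eq_neg_iff_add_eq_0 right_minus_eq)
  qed
  have "(?u3 - u) * (?u3 - ?u1) * (?u3 - ?u2)
      = ?u3 ^ 3 - (u * ?u1 * ?u2 + - (u * ?u1 + u * ?u2 + ?u1 * ?u2) * ?u3 + (u + ?u1 + ?u2) * ?u3\<^sup>2)"
    by (simp add: algebra_simps power2_eq_square power3_eq_cube)
  then have "(?u3 - u) * (?u3 - ?u1) * (?u3 - ?u2) = 0"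
    using r3 unfolding coeffs by simp
  moreover have "?u3 \<noteq> ?u1" "?u3 \<noteq> ?u2"
    using d by simp_all
  ultimately have u3: "?u3 = u" by simp
  obtain a b c where "x = emb a + emb b * u + emb c * u\<^sup>2"
    using quadratic_representation[OF u] .
  then show ?thesis by (simp add: \<theta>_add \<theta>_mult \<theta>_power u3)
qed

end

section \<open>Subspaces, extension of scalars and collineations\<close>

lemma card_subspace:
  fixes X :: "('a::{field,finite} ^ 'n) set"
  assumes "vec.subspace X"
  shows "card X = CARD('a) ^ vec.dim X"
proof -
  obtain B where B: "B \<subseteq> X" "vec.independent B" "X \<subseteq> vec.span B" "card B = vec.dim X"
    using vec.basis_exists by blast
  have span: "vec.span B = X"
    using B assms by (metis subset_antisym vec.span_minimal)
  have fin: "finite B" by simp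
  let ?h = "\<lambda>c. \<Sum>b\<in>B. c b *s b"
  have "inj_on ?h (B \<rightarrow>\<^sub>E UNIV)"
  proof (rule inj_onI)
    fix c d assume mem: "c \<in> B \<rightarrow>\<^sub>E UNIV" "d \<in> B \<rightarrow>\<^sub>E UNIV" and "?h c = ?h d"
    then have "(\<Sum>b\<in>B. (c b - d b) *s b) = 0"
      by (simp add: vec.scale_left_diff_distrib sum_subtractf)
    then have "c b - d b = 0" if "b \<in> B" for b
      using vec.independentD[OF B(2) fin order_refl _ that, of "\<lambda>b. c b - d b"] by blast
    then show "c = d" by (intro PiE_ext[OF mem]) auto
  qed
  moreover have "?h ` (B \<rightarrow>\<^sub>E UNIV) = X"
  proof
    show "?h ` (B \<rightarrow>\<^sub>E UNIV) \<subseteq> X"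
      using B assms by (auto intro!: vec.subspace_sum vec.subspace_scale)
    show "X \<subseteq> ?h ` (B \<rightarrow>\<^sub>E UNIV)"
    proof
      fix x assume "x \<in> X"
      then obtain c where "x = ?h c"
        using span vec.span_finite[OF fin] by auto
      then have "x = ?h (restrict c B)"
        by (auto intro: sum.cong)
      then show "x \<in> ?h ` (B \<rightarrow>\<^sub>E UNIV)"
        by (rule image_eqI[where f = ?h and x = "restrict c B"]) simp
    qed
  qed
  ultimately have "card X = card (B \<rightarrow>\<^sub>E (UNIV :: 'a set))"
    using card_image[of ?h "B \<rightarrow>\<^sub>E UNIV"] by simp
  then show ?thesis
    by (simp only: card_funcsetE[OF fin] B(4))
qed

lemma ppoints_singleton:
  fixes U :: "('a::field ^ 'n) set"
  assumes "vec.subspace U" "v \<in> U" "v \<noteq> 0"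
  shows "vec.span {v} \<in> ppoints U"
  using assms vec.span_minimal[of "{v}" U] by (auto simp: psubspaces_def)

lemma ppoints_mono: "U \<subseteq> V \<Longrightarrow> X \<in> ppoints U \<Longrightarrow> X \<in> ppoints V"
  by (auto simp: psubspaces_def)

lemma ppoints_E:
  fixes U :: "('a::field ^ 'n) set"
  assumes "X \<in> ppoints U"
  obtains v where "v \<in> U" "v \<noteq> 0" "X = vec.span {v}"
proof -
  have X: "vec.subspace X" "vec.dim X = 1" "X \<subseteq> U"
    using assms by (auto simp: psubspaces_def)
  obtain B where B: "B \<subseteq> X" "vec.independent B" "X \<subseteq> vec.span B" "card B = vec.dim X"
    using vec.basis_exists by blast
  then obtain v where v: "B = {v}"
    using X by (metis card_1_singletonE)
  have "X = vec.span {v}"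
    using B X v by (metis subset_antisym vec.span_minimal)
  moreover have "v \<noteq> 0"
    using B(2) v vec.dependent_zero by auto
  ultimately show thesis
    using that B v X by auto
qed

lemma span_singleton_mem: "y \<in> vec.span {v} \<longleftrightarrow> (\<exists>c. y = c *s v)"
  by (auto simp: vec.span_singleton)

lemma span_singleton_eq_iff:
  assumes "v \<noteq> 0" "w \<noteq> 0"
  shows "vec.span {v} = vec.span {w} \<longleftrightarrow> (\<exists>c. v = c *s w)"
proof
  assume "vec.span {v} = vec.span {w}"
  then have "v \<in> vec.span {w}" by (metis insertI1 vec.span_base)
  then show "\<exists>c. v = c *s w" by (simp add: span_singleton_mem)
next
  assume "\<exists>c. v = c *s w"
  then obtain c where c: "v = c *s w" by blast
  with assms have "c \<noteq> 0" by auto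
  with c have "w = inverse c *s v" by simp
  then have "v \<in> vec.span {w}" "w \<in> vec.span {v}"
    using c span_singleton_mem by blast+
  then show "vec.span {v} = vec.span {w}"
    by (intro subset_antisym vec.span_minimal) auto
qed

lemma mem_span_two: "y \<in> vec.span {a, b} \<longleftrightarrow> (\<exists>s t. y = s *s a + t *s b)"
proof -
  have "y \<in> vec.span {a, b} \<longleftrightarrow> (\<exists>s t. y - s *s a = t *s b)"
    by (simp add: vec.span_breakdown_eq span_singleton_mem)
  then show ?thesis by (simp add: algebra_simps)
qed

lemma mem_span_three: "y \<in> vec.span {a, b, c} \<longleftrightarrow> (\<exists>r s t. y = r *s a + s *s b + t *s c)"
proof -
  have "y \<in> vec.span {a, b, c} \<longleftrightarrow> (\<exists>r. y - r *s a \<in> vec.span {b, c})"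
    by (rule vec.span_breakdown_eq)
  then show ?thesis by (simp add: mem_span_two algebra_simps)
qed

lemma span_three: "vec.span {a, b, c} = {r *s a + s *s b + t *s c | r s t. True}"
  by (simp add: set_eq_iff mem_span_three)

section \<open>Extension of scalars and collineations that fix the subgeometry\<close>

definition map_vec :: "('a \<Rightarrow> 'a) \<Rightarrow> 'a ^ 'n \<Rightarrow> 'a ^ 'n" where
  "map_vec \<theta> w = (\<chi> i. \<theta> (w $ i))"

context cubic_embedding
begin

lemma ext_vec_add: "ext_vec emb (v + w) = ext_vec emb v + ext_vec emb w"
  by (simp add: ext_vec_def vec_eq_iff emb_add)

lemma ext_vec_scale: "ext_vec emb (c *s v) = emb c *s ext_vec emb v"
  by (simp add: ext_vec_def vec_eq_iff emb_mult)

lemma ext_vec_0 [simp]: "ext_vec emb 0 = 0"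
  by (simp add: ext_vec_def vec_eq_iff)

lemma ext_vec_eq_0_iff [simp]: "ext_vec emb v = 0 \<longleftrightarrow> v = 0"
  by (simp add: ext_vec_def vec_eq_iff)

lemma subspace_ext: "vec.subspace (ext emb U)"
  by (simp add: ext_def)

lemma ext_vec_mem: "v \<in> U \<Longrightarrow> ext_vec emb v \<in> ext emb U"
  by (auto simp: ext_def intro: vec.span_base)

lemma ext_mono: "U \<subseteq> V \<Longrightarrow> ext emb U \<subseteq> ext emb V"
  unfolding ext_def by (intro vec.span_mono image_mono)

lemma ext_span_singleton: "ext emb (vec.span {v}) = vec.span {ext_vec emb v}"
proof
  show "ext emb (vec.span {v}) \<subseteq> vec.span {ext_vec emb v}"
    unfolding ext_def
    by (rule vec.span_minimal) (auto simp: span_singleton_mem ext_vec_scale)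
  show "vec.span {ext_vec emb v} \<subseteq> ext emb (vec.span {v})"
    unfolding ext_def by (intro vec.span_mono) (auto intro: vec.span_base)
qed

text \<open>A dependence over \<open>'k\<close> is already one over \<open>'f\<close>: the ratio of
  its coefficients equals, up to sign, a quotient of entries of \<open>h'\<close> and
  \<open>h\<close>.\<close>

lemma ext_vec_independent_pair:
  assumes "h \<noteq> 0" "\<And>c. h' \<noteq> c *s h" "a *s ext_vec emb h + b *s ext_vec emb h' = 0"
  shows "a = 0" "b = 0"
proof -
  have eq: "a * emb (h $ i) + b * emb (h' $ i) = 0" for i
    using assms(3) by (simp add: vec_eq_iff ext_vec_def)
  show b: "b = 0"
  proof (rule ccontr)
    assume b: "b \<noteq> 0"
    obtain j where j: "h $ j \<noteq> 0"
      using assms(1) by (auto simp: vec_eq_iff)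
    have *: "emb (h' $ i) = - (a / b) * emb (h $ i)" for i
      using eq[of i] b by (simp add: field_simps eq_neg_iff_add_eq_0)
    have ab: "- (a / b) = emb (h' $ j / h $ j)"
      using j *[of j] by (simp add: emb_divide)
    have "h' = (h' $ j / h $ j) *s h"
    proof (rule vec_eq_iff[THEN iffD2], rule allI)
      fix i
      have "emb (h' $ i) = emb (h' $ j / h $ j * h $ i)"
        unfolding *[of i] ab emb_mult ..
      then show "h' $ i = (h' $ j / h $ j *s h) $ i"
        by simp
    qed
    with assms(2) show False by blast
  qed
  obtain j where "h $ j \<noteq> 0"
    using assms(1) by (auto simp: vec_eq_iff)
  with eq[of j] b show "a = 0" by simp
qed

text \<open>A semilinear map that fixes every point of \<open>H\<close> scales each
  \<open>ext_vec emb h\<close>. Comparing \<open>h\<close>, \<open>h'\<close> and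
  \<open>h + h'\<close> shows that independent vectors have the same scalar; \<open>h0\<close> and
  \<open>h1\<close> provide the comparison. A constant scalar is invisible on points, so only the
  coordinatewise action of \<open>\<theta>\<close> remains.\<close>

lemma fixes_subgeometry_semilinear:
  assumes H: "vec.subspace H" "h0 \<in> H" "h1 \<in> H" "h0 \<noteq> 0" "\<And>c. (h1 :: 'f ^ 'n) \<noteq> c *s h0"
    and fix_H: "fixes_subgeometry emb H \<sigma>"
  obtains \<theta> where "field_embedding \<theta>" "\<And>c. \<theta> (emb c) = emb c"
    "\<And>X. X \<in> ppoints (ext emb H) \<Longrightarrow> \<sigma> X = map_vec \<theta> ` X"
proof -
  let ?W = "ext emb H"
  obtain f \<theta> where \<theta>: "field_embedding \<theta>" "bij \<theta>" and bij: "bij_betw f ?W ?W"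
    and f_add: "\<And>x y. x \<in> ?W \<Longrightarrow> y \<in> ?W \<Longrightarrow> f (x + y) = f x + f y"
    and f_scale: "\<And>c x. x \<in> ?W \<Longrightarrow> f (c *s x) = \<theta> c *s f x"
    and f_point: "\<And>X. X \<in> ppoints ?W \<Longrightarrow> \<sigma> X = f ` X"
    using fix_H unfolding fixes_subgeometry_def collineation_def by metis
  have \<sigma>_fix: "\<sigma> (ext emb X) = ext emb X" if "X \<in> ppoints H" for X
    using fix_H that by (auto simp: fixes_subgeometry_def)
  have W: "vec.subspace ?W" by (rule subspace_ext)
  have \<theta>_add: "\<theta> (x + y) = \<theta> x + \<theta> y" and \<theta>_mult: "\<theta> (x * y) = \<theta> x * \<theta> y" for x y
    using \<theta> by (auto simp: field_embedding_def)
  have \<theta>_0: "\<theta> 0 = 0"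
    using \<theta>_add[of 0 0] by (metis add.right_neutral add_left_cancel)
  have f_0: "f 0 = 0"
    using f_add[of 0 0] W by (metis add.right_neutral add_left_cancel vec.subspace_0)
  have f_eq_0: "x = 0" if "x \<in> ?W" "f x = 0" for x
    using bij_betw_imp_inj_on[OF bij] that f_0 W vec.subspace_0 by (metis inj_on_def)
  have "\<exists>c. f (ext_vec emb h) = c *s ext_vec emb h" if h: "h \<in> H" for h
  proof (cases "h = 0")
    case True
    then show ?thesis by (simp add: f_0)
  next
    case False
    have X: "vec.span {h} \<in> ppoints H"
      using ppoints_singleton H(1) h False by blast
    have X': "vec.span {ext_vec emb h} \<in> ppoints ?W"
      using ppoints_singleton[OF W ext_vec_mem[OF h]] False by simp
    have "f ` vec.span {ext_vec emb h} = vec.span {ext_vec emb h}"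
      using \<sigma>_fix[OF X] f_point[OF X'] by (simp add: ext_span_singleton)
    then have "f (ext_vec emb h) \<in> vec.span {ext_vec emb h}"
      by (metis imageI insertI1 vec.span_base)
    then show ?thesis by (simp add: span_singleton_mem)
  qed
  then obtain c where c: "\<And>h. h \<in> H \<Longrightarrow> f (ext_vec emb h) = c h *s ext_vec emb h"
    by metis
  have c_eq: "c h = c h'" if "h \<in> H" "h' \<in> H" "h \<noteq> 0" "\<And>a. h' \<noteq> a *s h" for h h'
  proof -
    have "h + h' \<in> H" using that H(1) vec.subspace_add by blast
    from c[OF this] have "c (h + h') *s (ext_vec emb h + ext_vec emb h')
        = c h *s ext_vec emb h + c h' *s ext_vec emb h'"
      using that by (simp add: ext_vec_add f_add ext_vec_mem c)
    then have "(c (h + h') - c h) *s ext_vec emb h + (c (h + h') - c h') *s ext_vec emb h' = 0"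
      by (simp add: vec.scale_left_diff_distrib vec.scale_right_distrib algebra_simps)
    from ext_vec_independent_pair[OF that(3,4) this] show ?thesis by simp
  qed
  have c_const: "c h = c h0" if h: "h \<in> H" "h \<noteq> 0" for h
  proof (cases "\<exists>a. h = a *s h0")
    case True
    then obtain a where a: "h = a *s h0" by blast
    \<comment> \<open>A multiple of \<open>h0\<close> cannot be compared with \<open>h0\<close>
      directly; both are compared with \<open>h1\<close>.\<close>
    have "h1 \<noteq> b *s h" for b
      using H(5)[of "b * a"] a by simp
    with c_eq[OF h(1) H(3) h(2)] c_eq[OF H(2,3,4,5)] show ?thesis by simp
  next
    case False
    with c_eq[OF H(2) h(1) H(4)] show ?thesis by auto
  qed
  define d where "d = c h0"
  have f_ext: "f (ext_vec emb h) = d *s ext_vec emb h" if "h \<in> H" for h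
    using c[OF that] c_const[OF that] unfolding d_def by (cases "h = 0") (auto simp: f_0)
  have d: "d \<noteq> 0"
    using f_ext[OF H(2)] f_eq_0[OF ext_vec_mem[OF H(2)]] H(4) by auto
  have \<theta>_emb: "\<theta> (emb a) = emb a" for a
  proof -
    have "f (ext_vec emb (a *s h0)) = \<theta> (emb a) *s (d *s ext_vec emb h0)"
      by (simp only: ext_vec_scale f_scale[OF ext_vec_mem[OF H(2)]] f_ext[OF H(2)])
    moreover have "a *s h0 \<in> H" using H vec.subspace_scale by blast
    from f_ext[OF this] have "f (ext_vec emb (a *s h0)) = d *s (emb a *s ext_vec emb h0)"
      by (simp only: ext_vec_scale)
    ultimately have "(\<theta> (emb a) * d - d * emb a) *s ext_vec emb h0 = 0"
      by (auto simp: vec.scale_left_diff_distrib)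
    then show ?thesis
      using d H(4) by (simp add: mult.commute vec.scale_eq_0_iff)
  qed
  have map_ext: "map_vec \<theta> (ext_vec emb h) = ext_vec emb h" for h :: "'f ^ 'n"
    by (simp add: map_vec_def ext_vec_def \<theta>_emb vec_eq_iff)
  have f_eq: "f w = d *s map_vec \<theta> w" if "w \<in> ?W" for w
  proof -
    have "w \<in> {w \<in> ?W. f w = d *s map_vec \<theta> w}"
    proof (rule vec.span_induct[of w "ext_vec emb ` H" "\<lambda>w. w \<in> {w \<in> ?W. f w = d *s map_vec \<theta> w}"])
      show "w \<in> vec.span (ext_vec emb ` H)" using that by (simp add: ext_def)
      show "vec.subspace {w. w \<in> {w \<in> ?W. f w = d *s map_vec \<theta> w}}"
      proof (rule vec.subspaceI)
        show "0 \<in> {w. w \<in> {w \<in> ?W. f w = d *s map_vec \<theta> w}}"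
          using W vec.subspace_0 by (auto simp: f_0 map_vec_def \<theta>_0 vec_eq_iff)
        show "x + y \<in> {w. w \<in> {w \<in> ?W. f w = d *s map_vec \<theta> w}}"
          if "x \<in> {w. w \<in> {w \<in> ?W. f w = d *s map_vec \<theta> w}}"
             "y \<in> {w. w \<in> {w \<in> ?W. f w = d *s map_vec \<theta> w}}" for x y
          using that W vec.subspace_add
          by (auto simp: f_add map_vec_def \<theta>_add vec_eq_iff algebra_simps)
        show "a *s x \<in> {w. w \<in> {w \<in> ?W. f w = d *s map_vec \<theta> w}}"
          if "x \<in> {w. w \<in> {w \<in> ?W. f w = d *s map_vec \<theta> w}}" for a x
          using that W vec.subspace_scale
          by (auto simp: f_scale map_vec_def \<theta>_mult vec_eq_iff algebra_simps)
      qed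
      show "x \<in> {w \<in> ?W. f w = d *s map_vec \<theta> w}" if "x \<in> ext_vec emb ` H" for x
        using that map_ext by (auto simp: f_ext ext_vec_mem)
    qed
    then show ?thesis by simp
  qed
  have "\<sigma> X = map_vec \<theta> ` X" if X: "X \<in> ppoints ?W" for X
  proof -
    have XW: "X \<subseteq> ?W" and sub: "vec.subspace X" using X by (auto simp: psubspaces_def)
    \<comment> \<open>By semilinearity the factor \<open>d\<close> becomes a scaling by
      \<open>b\<close> inside the subspace \<open>X\<close>, which absorbs it.\<close>
    obtain b where b: "\<theta> b = d" using \<theta>(2) by (metis bij_pointE)
    then have "b \<noteq> 0" using d \<theta>_0 by auto
    have *: "f w = map_vec \<theta> (b *s w)" if "w \<in> X" for w
      using f_eq that XW by (auto simp: map_vec_def vec_eq_iff \<theta>_mult b)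
    have "f ` X = map_vec \<theta> ` X"
    proof
      show "f ` X \<subseteq> map_vec \<theta> ` X"
        using * sub vec.subspace_scale by blast
      show "map_vec \<theta> ` X \<subseteq> f ` X"
      proof clarify
        fix w assume "w \<in> X"
        then have "inverse b *s w \<in> X" using sub vec.subspace_scale by blast
        moreover from *[OF this] have "f (inverse b *s w) = map_vec \<theta> w"
          using \<open>b \<noteq> 0\<close> by simp
        ultimately show "map_vec \<theta> w \<in> f ` X" by (metis imageI)
      qed
    qed
    with f_point[OF X] show ?thesis by simp
  qed
  with that \<theta>(1) \<theta>_emb show thesis by blast
qed

text \<open>The values lie in \<open>'k\<close>, not in \<open>'f\<close>: the conjugates of one
  \<open>'k\<close>-valued coordinate are all \<open>'f\<close>-linear, and they extend to different
  \<open>'k\<close>-linear functionals.\<close>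

definition extend :: "('f ^ 'n \<Rightarrow> 'k) \<Rightarrow> 'k ^ 'n \<Rightarrow> 'k" where
  "extend \<phi> w = (\<Sum>j\<in>UNIV. w $ j * \<phi> (axis j 1))"

lemma extend_add: "extend \<phi> (v + w) = extend \<phi> v + extend \<phi> w"
  by (simp add: extend_def algebra_simps sum.distrib)

lemma extend_scale: "extend \<phi> (c *s w) = c * extend \<phi> w"
  by (simp add: extend_def algebra_simps sum_distrib_left)

lemma extend_0 [simp]: "extend \<phi> 0 = 0"
  by (simp add: extend_def)

lemma extend_ext_vec:
  fixes \<phi> :: "'f ^ 'n \<Rightarrow> 'k"
  assumes "\<And>u v. \<phi> (u + v) = \<phi> u + \<phi> v" "\<And>c v. \<phi> (c *s v) = emb c * \<phi> v"
  shows "extend \<phi> (ext_vec emb v) = \<phi> v"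
proof -
  have \<phi>_0: "\<phi> 0 = 0" using assms(2)[of 0 0] by simp
  have \<phi>_sum: "\<phi> (\<Sum>i\<in>I. h i) = (\<Sum>i\<in>I. \<phi> (h i))" for I and h :: "'n \<Rightarrow> 'f ^ 'n"
    by (induction I rule: infinite_finite_induct) (simp_all add: assms(1) \<phi>_0)
  have "\<phi> v = \<phi> (\<Sum>j\<in>UNIV. v $ j *s axis j 1)"
    by (simp add: basis_expansion)
  also have "\<dots> = extend \<phi> (ext_vec emb v)"
    by (simp add: \<phi>_sum assms(2) extend_def ext_vec_def)
  finally show ?thesis by simp
qed

end

text \<open>The link between the two sides of the theorem: \<open>affine_part\<close> asks for a
  nonzero pair \<open>(m, n)\<close>, the quadric for a vanishing determinant.\<close>

lemma det2_eq_0_iff: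
  fixes a b c d :: "'a::field"
  shows "a * d - c * b = 0 \<longleftrightarrow> (\<exists>m n. (m \<noteq> 0 \<or> n \<noteq> 0) \<and> m * a + n * b = 0 \<and> m * c + n * d = 0)"
proof
  assume det: "a * d - c * b = 0"
  show "\<exists>m n. (m \<noteq> 0 \<or> n \<noteq> 0) \<and> m * a + n * b = 0 \<and> m * c + n * d = 0"
  proof (cases "a = 0 \<and> b = 0")
    case True
    show ?thesis
    proof (cases "c = 0 \<and> d = 0")
      case True
      with \<open>a = 0 \<and> b = 0\<close> show ?thesis by (intro exI[of _ 1]) simp
    next
      case False
      with True show ?thesis by (intro exI[of _ d] exI[of _ "- c"]) (auto simp: algebra_simps)
    qed
  next
    case False
    with det show ?thesis by (intro exI[of _ b] exI[of _ "- a"]) (auto simp: algebra_simps)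
  qed
next
  assume "\<exists>m n. (m \<noteq> 0 \<or> n \<noteq> 0) \<and> m * a + n * b = 0 \<and> m * c + n * d = 0"
  then obtain m n where mn: "m \<noteq> 0 \<or> n \<noteq> 0" "m * a + n * b = 0" "m * c + n * d = 0" by blast
  have "m * (a * d - c * b) = (m * a + n * b) * d - (m * c + n * d) * b"
    "n * (a * d - c * b) = (m * c + n * d) * a - (m * a + n * b) * c"
    by (simp_all add: algebra_simps)
  with mn show "a * d - c * b = 0" by auto
qed

text \<open>Four functionals without a common nonzero zero map a space of \<open>q^4\<close>
  elements bijectively onto the quadruples over \<open>'f\<close>; the preimages of the unit vectors
  form the frame.\<close>

lemma hyperbolic_onI:
  fixes W :: "('a::{field,finite} ^ 'n) set"
  assumes W: "vec.subspace W" and card_W: "card W = CARD('a) ^ 4"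
    and add: "\<And>v w. L1 (v + w) = L1 v + L1 w" "\<And>v w. L2 (v + w) = L2 v + L2 w"
      "\<And>v w. L3 (v + w) = L3 v + L3 w" "\<And>v w. L4 (v + w) = L4 v + L4 w"
    and scale: "\<And>c v. L1 (c *s v) = c * L1 v" "\<And>c v. L2 (c *s v) = c * L2 v"
      "\<And>c v. L3 (c *s v) = c * L3 v" "\<And>c v. L4 (c *s v) = c * L4 v"
    and inj: "\<And>v. v \<in> W \<Longrightarrow> L1 v = 0 \<Longrightarrow> L2 v = 0 \<Longrightarrow> L3 v = 0 \<Longrightarrow> L4 v = 0 \<Longrightarrow> v = 0"
  shows "hyperbolic_on W (\<lambda>v. L1 v * L2 v + L3 v * L4 v)" (is "hyperbolic_on W ?Q")
proof -
  note lin = add scale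
  let ?L = "\<lambda>v. (L1 v, L2 v, L3 v, L4 v)"
  have eq: "v = w" if "v \<in> W" "w \<in> W" "?L v = ?L w" for v w
  proof -
    have "v - w = 0"
      by (rule inj)
        (use that W add(1)[of "v - w" w] add(2)[of "v - w" w] add(3)[of "v - w" w] add(4)[of "v - w" w]
          in \<open>auto intro: vec.subspace_diff\<close>)
    then show ?thesis by simp
  qed
  have two: "2 \<le> CARD('a)"
  proof -
    have "card {0, 1 :: 'a} \<le> CARD('a)"
      by (intro card_mono) auto
    then show ?thesis by simp
  qed
  have "CARD('a) ^ vec.dim W = CARD('a) ^ 4"
    using card_subspace[OF W] card_W by simp
  then have dim: "vec.dim W = 4"
    using two by (subst (asm) power_inject_exp) auto
  have "inj_on ?L W" using eq by (intro inj_onI) blast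
  then have "card (?L ` W) = CARD('a) ^ 4" by (simp add: card_image card_W)
  then have surj: "?L ` W = UNIV"
    by (intro card_subset_eq) (auto simp: eval_nat_numeral)
  have "\<exists>v\<in>W. ?L v = t" for t
    using surj by (metis (no_types, lifting) UNIV_I imageE)
  then obtain a b c d where abcd: "a \<in> W" "b \<in> W" "c \<in> W" "d \<in> W"
    "?L a = (1, 0, 0, 0)" "?L b = (0, 1, 0, 0)" "?L c = (0, 0, 1, 0)" "?L d = (0, 0, 0, 1)"
    by metis
  have sub: "{a, b, c, d} \<subseteq> W" using abcd by blast
  have "distinct [a, b, c, d]" using abcd(5-8) by auto
  then have card: "card {a, b, c, d} = 4"
    using distinct_card[of "[a, b, c, d]"] by simp
  have expand: "v = L1 v *s a + L2 v *s b + L3 v *s c + L4 v *s d" if "v \<in> W" for v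
    using that W abcd
    by (intro eq) (auto simp: lin intro!: vec.subspace_add vec.subspace_scale)
  have "W \<subseteq> vec.span {a, b, c, d}"
  proof
    fix v assume "v \<in> W"
    have "L1 v *s a + L2 v *s b + L3 v *s c + L4 v *s d \<in> vec.span {a, b, c, d}"
      by (intro vec.span_add vec.span_scale vec.span_base) auto
    with expand[OF \<open>v \<in> W\<close>] show "v \<in> vec.span {a, b, c, d}" by simp
  qed
  then have span: "vec.span {a, b, c, d} = W"
    using vec.span_minimal[OF sub W] by blast
  have indep: "vec.independent {a, b, c, d}"
    using vec.card_eq_dim[OF sub] card dim span by simp
  have "quadratic_form_on W ?Q"
    unfolding quadratic_form_on_def polar_def
    by (simp add: lin algebra_simps power2_eq_square)
  moreover have "?Q (x *s a + y *s b + z *s c + w *s d) = x * y + z * w" for x y z w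
    using abcd(5-8) by (simp add: lin)
  ultimately show ?thesis
    unfolding hyperbolic_on_def using card indep span by blast
qed

lemma quadratic_form_on_expand:
  assumes Q: "quadratic_form_on W Q" and W: "vec.subspace W" and mem: "u \<in> W" "v \<in> W" "w \<in> W"
  shows "Q (a *s u + b *s v + c *s w) = a\<^sup>2 * Q u + b\<^sup>2 * Q v + c\<^sup>2 * Q w
    + a * b * polar Q u v + a * c * polar Q u w + b * c * polar Q v w"
proof -
  have scale: "Q (s *s x) = s\<^sup>2 * Q x" if "x \<in> W" for s x
    using Q that by (auto simp: quadratic_form_on_def)
  have add: "polar Q (x + y) z = polar Q x z + polar Q y z" if "x \<in> W" "y \<in> W" "z \<in> W" for x y z
    using Q that by (auto simp: quadratic_form_on_def)
  have polar_scale: "polar Q (s *s x) z = s * polar Q x z" if "x \<in> W" "z \<in> W" for s x z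
    using Q that by (auto simp: quadratic_form_on_def)
  have sym: "polar Q x y = polar Q y x" for x y
    by (simp add: polar_def add.commute)
  have polar_scale2: "polar Q (s *s x) (t *s y) = s * t * polar Q x y" if "x \<in> W" "y \<in> W" for s t x y
  proof -
    have "polar Q (s *s x) (t *s y) = s * polar Q (t *s y) x"
      unfolding sym[of "t *s y"] using that W by (intro polar_scale vec.subspace_scale)
    also have "\<dots> = s * (t * polar Q y x)"
      using that by (simp only: polar_scale)
    also have "\<dots> = s * t * polar Q x y"
      by (simp add: sym[of y])
    finally show ?thesis .
  qed
  have sum: "Q (x + y) = Q x + Q y + polar Q x y" for x y
    by (simp add: polar_def)
  have mem': "a *s u \<in> W" "b *s v \<in> W" "c *s w \<in> W"
    using mem W by (auto intro: vec.subspace_scale)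
  have "Q (a *s u + b *s v + c *s w)
      = Q (a *s u) + Q (b *s v) + polar Q (a *s u) (b *s v) + Q (c *s w)
        + (polar Q (a *s u) (c *s w) + polar Q (b *s v) (c *s w))"
    using mem' by (simp only: sum add)
  then show ?thesis
    using mem by (simp only: scale polar_scale2) (simp add: algebra_simps)
qed

lemma distinct_planes_meet:
  fixes l l' :: "('a::field ^ 3) set"
  assumes l: "l \<in> psubspaces 1 UNIV" "l' \<in> psubspaces 1 UNIV" "l \<noteq> l'"
  shows "l \<inter> l' \<in> ppoints UNIV" "\<And>w. \<exists>s\<in>l. \<exists>h\<in>l'. w = s + h"
proof -
  have sub: "vec.subspace l" "vec.dim l = 2" "vec.subspace l'" "vec.dim l' = 2"
    using l by (auto simp: psubspaces_def)
  let ?S = "{x + y |x y. x \<in> l \<and> y \<in> l'}"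
  have sum: "vec.dim ?S + vec.dim (l \<inter> l') = 4"
    using vec.dim_sums_Int[OF sub(1,3)] sub by simp
  have full: "vec.dim (UNIV :: ('a ^ 3) set) = 3"
    using vec_dim_card[where 'a = 'a and 'n = 3] by simp
  have le: "vec.dim ?S \<le> 3"
    using vec.dim_subset[of ?S UNIV] full by simp
  have int: "vec.subspace (l \<inter> l')" by (intro vec.subspace_inter sub)
  have "vec.dim (l \<inter> l') < 2"
  proof (rule ccontr)
    assume "\<not> ?thesis"
    then have "l \<inter> l' = l" "l \<inter> l' = l'"
      using sub int by (intro vec.subspace_dim_equal; simp)+
    with l(3) show False by simp
  qed
  with sum le have dims: "vec.dim ?S = 3" "vec.dim (l \<inter> l') = 1" by linarith+
  then show "l \<inter> l' \<in> ppoints UNIV"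
    using int by (simp add: psubspaces_def)
  have "vec.subspace ?S" by (rule vec.subspace_sums[OF sub(1,3)])
  then have "?S = UNIV"
    using dims(1) full by (intro vec.subspace_dim_equal) auto
  then show "\<exists>s\<in>l. \<exists>h\<in>l'. w = s + h" for w by blast
qed

section \<open>Field reduction\<close>

locale reduction = cubic_embedding emb
  for emb :: "'f::{field,finite} \<Rightarrow> 'k::{field,finite}" +
  fixes \<beta> :: "'k ^ 'm \<Rightarrow> 'f ^ 'n"
  assumes field_reduction: "field_reduction emb \<beta>"
begin

lemma bij_\<beta>: "bij \<beta>"
  using field_reduction by (simp add: field_reduction_def)

lemma \<beta>_eq_iff [simp]: "\<beta> v = \<beta> w \<longleftrightarrow> v = w"
  using bij_\<beta> by (metis bij_def injD)

lemma \<beta>_add: "\<beta> (v + w) = \<beta> v + \<beta> w"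
  and \<beta>_scale: "\<beta> (emb c *s v) = c *s \<beta> v"
  using field_reduction
  by (auto simp: field_reduction_def Vector_Spaces.linear_iff)

lemma \<beta>_0 [simp]: "\<beta> 0 = 0"
  using \<beta>_add[of 0 0] by (metis add.right_neutral add_left_cancel)

lemma \<beta>_eq_0_iff [simp]: "\<beta> v = 0 \<longleftrightarrow> v = 0"
  using \<beta>_eq_iff[of v 0] by (simp del: \<beta>_eq_iff)

lemma inv_\<beta> [simp]: "inv \<beta> (\<beta> v) = v"
  using bij_\<beta> by (simp add: bij_is_inj)

lemma \<beta>_inv [simp]: "\<beta> (inv \<beta> w) = w"
  using bij_\<beta> by (simp add: bij_is_surj surj_f_inv_f)

lemma inv_\<beta>_add: "inv \<beta> (v + w) = inv \<beta> v + inv \<beta> w"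
  by (metis \<beta>_add \<beta>_inv inv_\<beta>)

lemma inv_\<beta>_scale: "inv \<beta> (c *s v) = emb c *s inv \<beta> v"
  by (metis \<beta>_scale \<beta>_inv inv_\<beta>)

lemma subspace_image_\<beta>:
  assumes "vec.subspace U"
  shows "vec.subspace (\<beta> ` U)"
proof (rule vec.subspaceI)
  show "0 \<in> \<beta> ` U"
    using assms vec.subspace_0 by (force simp flip: \<beta>_0)
  show "x + y \<in> \<beta> ` U" if "x \<in> \<beta> ` U" "y \<in> \<beta> ` U" for x y
    using that by (auto intro!: imageI vec.subspace_add[OF assms] simp flip: \<beta>_add)
  show "c *s x \<in> \<beta> ` U" if "x \<in> \<beta> ` U" for c x
    using that by (auto intro!: imageI vec.subspace_scale[OF assms] simp flip: \<beta>_scale)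
qed

text \<open>With \<open>\<theta>\<close> trivial the conjugates of a point of \<open>\<nu>\<close>
  coincide, so a spread element would consist of the vectors over \<open>'f\<close> in a
  one-dimensional \<open>'k\<close>-space. Such vectors are proportional over \<open>'f\<close>, but
  \<open>\<beta> y\<close> and \<open>\<beta> (u *s y)\<close> are not.\<close>

lemma indicator_line_nontrivial:
  assumes \<sigma>: "\<And>X. X \<in> ppoints (ext emb H) \<Longrightarrow> \<sigma> X = map_vec \<theta> ` X"
    and ind: "indicator_line emb H (spread \<beta> U) \<sigma> \<nu>"
  shows "\<exists>x. \<theta> x \<noteq> x"
proof (rule ccontr)
  assume "\<not> ?thesis"
  then have \<theta>: "\<theta> x = x" for x by simp
  have id: "map_vec \<theta> ` X = X" for X :: "('k ^ 'n) set"
    by (simp add: map_vec_def \<theta>)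
  have \<nu>: "\<nu> \<in> psubspaces 1 (ext emb H)"
    and D: "spread \<beta> U
      = (\<lambda>P. {v \<in> H. ext_vec emb v \<in> vec.span (P \<union> \<sigma> P \<union> \<sigma> (\<sigma> P))}) ` ppoints \<nu>"
    using ind by (auto simp: indicator_line_def)
  have sub: "vec.subspace \<nu>" "vec.dim \<nu> = 2" "\<nu> \<subseteq> ext emb H"
    using \<nu> by (auto simp: psubspaces_def)
  then have "\<not> \<nu> \<subseteq> {0}"
    by (metis vec.dim_eq_0 zero_neq_numeral)
  then obtain r where r: "r \<in> \<nu>" "r \<noteq> 0" by blast
  let ?P = "vec.span {r}"
  have P: "?P \<in> ppoints \<nu>" "?P \<in> ppoints (ext emb H)"
    using r sub ppoints_singleton subspace_ext by blast+
  then have "\<sigma> ?P = ?P" using \<sigma> id by auto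
  then have "vec.span (?P \<union> \<sigma> ?P \<union> \<sigma> (\<sigma> ?P)) = ?P"
    by (simp add: vec.span_span)
  then have "{v \<in> H. ext_vec emb v \<in> ?P} \<in> spread \<beta> U"
    unfolding D using P(1) by (intro rev_image_eqI[of ?P]) simp_all
  then obtain y where y: "y \<noteq> 0" "{v \<in> H. ext_vec emb v \<in> ?P} = \<beta> ` vec.span {y}"
    by (auto simp: spread_def elim: ppoints_E)
  obtain u where u: "u \<notin> range emb" using not_surj_emb by blast
  have "\<beta> y \<in> \<beta> ` vec.span {y}" "\<beta> (u *s y) \<in> \<beta> ` vec.span {y}"
    by (auto intro!: imageI vec.span_scale intro: vec.span_base)
  then have "ext_vec emb (\<beta> y) \<in> ?P" "ext_vec emb (\<beta> (u *s y)) \<in> ?P"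
    unfolding y(2)[symmetric] by simp_all
  then obtain a b where ab: "ext_vec emb (\<beta> y) = a *s r" "ext_vec emb (\<beta> (u *s y)) = b *s r"
    by (auto simp: span_singleton_mem)
  then have dep: "b *s ext_vec emb (\<beta> y) + (- a) *s ext_vec emb (\<beta> (u *s y)) = 0"
    by (simp add: mult.commute)
  have "\<beta> (u *s y) \<noteq> c *s \<beta> y" for c
    using y(1) u by (auto simp flip: \<beta>_scale)
  from ext_vec_independent_pair(2)[OF _ this dep] have "- a = 0"
    using y(1) by simp
  then show False using ab y(1) by simp
qed

end

section \<open>Powers of \<open>\<theta>\<close> and their action on vectors\<close>

context cubic_galois
begin

lemma map_vec_add: "map_vec \<theta> (v + w) = map_vec \<theta> v + map_vec \<theta> w"
  by (simp add: map_vec_def vec_eq_iff \<theta>_add)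

lemma map_vec_scale: "map_vec \<theta> (c *s w) = \<theta> c *s map_vec \<theta> w"
  by (simp add: map_vec_def vec_eq_iff \<theta>_mult)

lemma map_vec_0 [simp]: "map_vec \<theta> 0 = 0"
  by (simp add: map_vec_def vec_eq_iff)

lemma map_vec_eq_0_iff [simp]: "map_vec \<theta> w = 0 \<longleftrightarrow> w = 0"
  by (simp add: map_vec_def vec_eq_iff)

lemma map_vec_ext_vec [simp]: "map_vec \<theta> (ext_vec emb v) = ext_vec emb v"
  by (simp add: map_vec_def ext_vec_def)

lemma map_vec_span_singleton: "map_vec \<theta> ` vec.span {r} = vec.span {map_vec \<theta> r}"
proof
  show "map_vec \<theta> ` vec.span {r} \<subseteq> vec.span {map_vec \<theta> r}"
    by (auto simp: span_singleton_mem map_vec_scale)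
  show "vec.span {map_vec \<theta> r} \<subseteq> map_vec \<theta> ` vec.span {r}"
  proof
    fix y assume "y \<in> vec.span {map_vec \<theta> r}"
    then obtain c where "y = c *s map_vec \<theta> r" by (auto simp: span_singleton_mem)
    \<comment> \<open>Since the cube of \<open>\<theta>\<close> is the identity,
      \<open>\<theta> (\<theta> c)\<close> is the preimage of \<open>c\<close>.\<close>
    then have "y = map_vec \<theta> (\<theta> (\<theta> c) *s r)" by (simp add: map_vec_scale)
    then show "y \<in> map_vec \<theta> ` vec.span {r}"
      by (auto simp: span_singleton_mem)
  qed
qed

lemma map_vec_ext:
  assumes "w \<in> ext emb U"
  shows "map_vec \<theta> w \<in> ext emb U"
proof (rule vec.span_induct[of w "ext_vec emb ` U" "\<lambda>w. map_vec \<theta> w \<in> ext emb U"])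
  show "w \<in> vec.span (ext_vec emb ` U)" using assms by (simp add: ext_def)
  show "vec.subspace {w. map_vec \<theta> w \<in> ext emb U}"
    by (rule vec.subspaceI)
      (auto simp: map_vec_add map_vec_scale vec.subspace_0 vec.subspace_add vec.subspace_scale subspace_ext)
qed (auto simp: ext_vec_mem)

lemma range_emb_divide: "x \<in> range emb \<Longrightarrow> x / emb t \<in> range emb"
  by (auto simp flip: emb_divide)

abbreviation gal :: "nat \<Rightarrow> 'k \<Rightarrow> 'k" where "gal i \<equiv> \<theta> ^^ i"

lemma gal_add: "gal i (x + y) = gal i x + gal i y"
  by (induction i) (simp_all add: \<theta>_add)

lemma gal_mult: "gal i (x * y) = gal i x * gal i y"
  by (induction i) (simp_all add: \<theta>_mult)

lemma gal_emb [simp]: "gal i (emb c) = emb c"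
  by (induction i) simp_all

lemma gal_0 [simp]: "gal i 0 = 0"
  by (induction i) simp_all

lemma gal_1 [simp]: "gal i 1 = 1"
  by (induction i) simp_all

lemma gal_eq_0_iff [simp]: "gal i x = 0 \<longleftrightarrow> x = 0"
  by (induction i) simp_all

lemma gal_eq_iff [simp]: "gal i x = gal i y \<longleftrightarrow> x = y"
  by (induction i) simp_all

lemma gal_divide: "gal i (x / y) = gal i x / gal i y"
  by (induction i) (simp_all add: \<theta>_divide)

lemma gal_gal: "gal i (gal j x) = gal (i + j) x"
  by (simp add: funpow_add)

lemma gal_2: "gal 2 x = \<theta> (\<theta> x)"
  by (simp add: numeral_2_eq_2)

lemma gal_add_3 [simp]: "gal (i + 3) x = gal i x"
  by (induction i) (simp_all add: eval_nat_numeral)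

lemma gal_mod_3: "gal (i mod 3) = gal i"
proof -
  have "gal (j + 3 * m) x = gal j x" for j m x
  proof (induction m)
    case (Suc m)
    then show ?case using gal_add_3[of "j + 3 * m" x] by (simp add: algebra_simps)
  qed simp
  from this[of "i mod 3" "i div 3"] show ?thesis by (intro ext) simp
qed

lemma gal_eq_gal_imp:
  assumes "gal i x = gal j x" "i < j" "j < 3"
  shows "x \<in> range emb"
proof (rule ccontr)
  assume x: "x \<notin> range emb"
  have "\<theta> x \<noteq> x" "\<theta> (\<theta> x) \<noteq> x"
    using x fixed_iff \<theta>_\<theta>_neq by auto
  moreover have "(i = 0 \<and> j = 1) \<or> (i = 0 \<and> j = 2) \<or> (i = 1 \<and> j = 2)"
    using assms(2,3) by auto
  ultimately show False
    using assms(1) by (auto simp: eval_nat_numeral)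
qed

lemma gal_eval_nonzero:
  assumes u: "u \<notin> range emb" and "a \<noteq> 0 \<or> b \<noteq> 0 \<or> c \<noteq> 0"
  shows "\<exists>i<3. a + b * gal i u + c * (gal i u)\<^sup>2 \<noteq> 0"
proof (rule ccontr)
  assume "\<not> ?thesis"
  then have "a + b * gal i u + c * (gal i u)\<^sup>2 = 0" if "i < 3" for i
    using that by blast
  from this[of 0] this[of 1] this[of 2]
  show False using conjugate_roots[OF u, of a b c] assms(2) by (simp add: eval_nat_numeral)
qed

end

section \<open>The indicator line\<close>

text \<open>Intended reading: \<open>p\<close> spans \<open>P_inf\<close>, \<open>e\<close> is a
  vector of \<open>l\<close> with \<open>\<beta> e\<close> in \<open>\<mu>\<close>, and
  \<open>g\<close> completes \<open>p\<close> to a basis of \<open>l_inf\<close>. The subspaces of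
  the setting then become coordinate conditions.\<close>

locale abb_frame = reduction emb \<beta> + cubic_galois emb \<theta>
  for emb :: "'f::{field,finite} \<Rightarrow> 'k::{field,finite}"
    and \<beta> :: "'k ^ 'm \<Rightarrow> 'f ^ 'n" and \<theta> :: "'k \<Rightarrow> 'k" +
  fixes p e g :: "'k ^ 'm"
  assumes frame_span: "\<exists>x y z. w = x *s p + y *s e + z *s g"
    and frame_independent: "x *s p + y *s e + z *s g = 0 \<Longrightarrow> x = 0 \<and> y = 0 \<and> z = 0"
begin

lemma frame_unique:
  assumes "x *s p + y *s e + z *s g = x' *s p + y' *s e + z' *s g"
  shows "x = x'" "y = y'" "z = z'"
proof -
  have "(x - x') *s p + (y - y') *s e + (z - z') *s g = 0"
    using assms by (simp add: vec.scale_left_diff_distrib algebra_simps)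
  from frame_independent[OF this] show "x = x'" "y = y'" "z = z'" by simp_all
qed

definition cX :: "'k ^ 'm \<Rightarrow> 'k" where "cX w = (THE x. \<exists>y z. w = x *s p + y *s e + z *s g)"
definition cY :: "'k ^ 'm \<Rightarrow> 'k" where "cY w = (THE y. \<exists>x z. w = x *s p + y *s e + z *s g)"
definition cZ :: "'k ^ 'm \<Rightarrow> 'k" where "cZ w = (THE z. \<exists>x y. w = x *s p + y *s e + z *s g)"

lemma coord_frame:
  "cX (x *s p + y *s e + z *s g) = x"
  "cY (x *s p + y *s e + z *s g) = y"
  "cZ (x *s p + y *s e + z *s g) = z"
  unfolding cX_def cY_def cZ_def
  by (rule the_equality; use frame_unique in blast)+

lemma coord_simps [simp]:
  "cX (x *s p + y *s e) = x" "cY (x *s p + y *s e) = y" "cZ (x *s p + y *s e) = 0"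
  "cX (x *s p + z *s g) = x" "cY (x *s p + z *s g) = 0" "cZ (x *s p + z *s g) = z"
  "cX (x *s p) = x" "cY (x *s p) = 0" "cZ (x *s p) = 0"
  using coord_frame[of x y 0] coord_frame[of x 0 z] coord_frame[of x 0 0] by simp_all

lemma frame_expansion: "w = cX w *s p + cY w *s e + cZ w *s g"
proof -
  obtain x y z where "w = x *s p + y *s e + z *s g" using frame_span by blast
  then show ?thesis by (simp add: coord_frame)
qed

lemma coord_add: "cX (v + w) = cX v + cX w" "cY (v + w) = cY v + cY w" "cZ (v + w) = cZ v + cZ w"
proof -
  have "v + w = (cX v + cX w) *s p + (cY v + cY w) *s e + (cZ v + cZ w) *s g"
    by (subst frame_expansion[of v], subst frame_expansion[of w]) (simp add: algebra_simps)
  then show "cX (v + w) = cX v + cX w" "cY (v + w) = cY v + cY w" "cZ (v + w) = cZ v + cZ w"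
    by (metis coord_frame)+
qed

lemma coord_scale: "cX (c *s w) = c * cX w" "cY (c *s w) = c * cY w" "cZ (c *s w) = c * cZ w"
proof -
  have "c *s w = (c * cX w) *s p + (c * cY w) *s e + (c * cZ w) *s g"
    by (subst frame_expansion[of w]) (simp add: algebra_simps)
  then show "cX (c *s w) = c * cX w" "cY (c *s w) = c * cY w" "cZ (c *s w) = c * cZ w"
    by (metis coord_frame)+
qed

lemma p_nonzero: "p \<noteq> 0"
  using frame_independent[of 1 0 0] by auto

text \<open>On \<open>ext emb \<pi>\<close> these functionals diagonalise the multiplications by
  elements of \<open>'k\<close>: multiplication by \<open>u\<close> acts on the \<open>i\<close>-th
  one as the scalar \<open>gal i u\<close>.\<close>

definition \<xi> :: "nat \<Rightarrow> 'k ^ 'n \<Rightarrow> 'k" where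
  "\<xi> i = extend (\<lambda>v. gal i (cX (inv \<beta> v)))"
definition \<zeta> :: "nat \<Rightarrow> 'k ^ 'n \<Rightarrow> 'k" where
  "\<zeta> i = extend (\<lambda>v. gal i (cZ (inv \<beta> v)))"

lemma \<xi>_add: "\<xi> i (v + w) = \<xi> i v + \<xi> i w" and \<xi>_scale: "\<xi> i (c *s w) = c * \<xi> i w"
  and \<xi>_0 [simp]: "\<xi> i 0 = 0"
  by (simp_all add: \<xi>_def extend_add extend_scale)

lemma \<zeta>_add: "\<zeta> i (v + w) = \<zeta> i v + \<zeta> i w" and \<zeta>_scale: "\<zeta> i (c *s w) = c * \<zeta> i w"
  and \<zeta>_0 [simp]: "\<zeta> i 0 = 0"
  by (simp_all add: \<zeta>_def extend_add extend_scale)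

lemma \<xi>_ext_vec [simp]: "\<xi> i (ext_vec emb v) = gal i (cX (inv \<beta> v))"
  unfolding \<xi>_def
  by (rule extend_ext_vec) (simp_all add: inv_\<beta>_add inv_\<beta>_scale coord_add coord_scale gal_add gal_mult)

lemma \<zeta>_ext_vec [simp]: "\<zeta> i (ext_vec emb v) = gal i (cZ (inv \<beta> v))"
  unfolding \<zeta>_def
  by (rule extend_ext_vec) (simp_all add: inv_\<beta>_add inv_\<beta>_scale coord_add coord_scale gal_add gal_mult)

lemma \<xi>_Suc_map_vec: "\<xi> (Suc i) (map_vec \<theta> w) = \<theta> (\<xi> i w)"
  by (simp add: \<xi>_def extend_def map_vec_def \<theta>_sum \<theta>_mult)

lemma \<xi>_mod_3: "\<xi> (i mod 3) = \<xi> i"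
  by (simp add: \<xi>_def gal_mod_3)

definition H :: "('f ^ 'n) set" where "H = \<beta> ` {x *s p + z *s g | x z. True}"
definition \<pi> :: "('f ^ 'n) set" where "\<pi> = \<beta> ` {x *s p | x. True}"

lemma ext_spread_element:
  assumes u: "u \<notin> range emb" and y: "y = x *s p + z *s g"
  shows "ext emb (\<beta> ` vec.span {y}) \<subseteq> {a *s ext_vec emb (\<beta> y) + b *s ext_vec emb (\<beta> (u *s y))
      + c *s ext_vec emb (\<beta> (u\<^sup>2 *s y)) | a b c. True}" (is "_ \<subseteq> ?V")
proof -
  have "?V = vec.span {ext_vec emb (\<beta> y), ext_vec emb (\<beta> (u *s y)), ext_vec emb (\<beta> (u\<^sup>2 *s y))}"
    by (simp only: span_three)
  moreover have "ext_vec emb (\<beta> (t *s y)) \<in> ?V" for t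
  proof -
    obtain a b c where t: "t = emb a + emb b * u + emb c * u\<^sup>2"
      using quadratic_representation[OF u] .
    then have "t *s y = emb a *s y + emb b *s (u *s y) + emb c *s (u\<^sup>2 *s y)"
      by (simp add: algebra_simps)
    then have "ext_vec emb (\<beta> (t *s y)) = emb a *s ext_vec emb (\<beta> y)
        + emb b *s ext_vec emb (\<beta> (u *s y)) + emb c *s ext_vec emb (\<beta> (u\<^sup>2 *s y))"
      by (simp only: \<beta>_add \<beta>_scale ext_vec_add ext_vec_scale)
    then show ?thesis by blast
  qed
  moreover have "ext_vec emb ` \<beta> ` vec.span {y} = range (\<lambda>t. ext_vec emb (\<beta> (t *s y)))"
    by (auto simp: vec.span_singleton)
  ultimately show ?thesis
    unfolding ext_def by (intro vec.span_minimal) auto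
qed

text \<open>Multiplying \<open>y\<close> by \<open>u\<close> multiplies its \<open>i\<close>-th
  coordinates by \<open>gal i u\<close>, so the combination becomes the value of one quadratic
  polynomial at \<open>gal i u\<close>, the same for \<open>\<xi>\<close> and
  \<open>\<zeta>\<close>.\<close>

lemma spread_coordinates:
  assumes u: "u \<notin> range emb" and y: "y = x *s p + z *s g"
    and r: "r = a *s ext_vec emb (\<beta> y) + b *s ext_vec emb (\<beta> (u *s y))
      + c *s ext_vec emb (\<beta> (u\<^sup>2 *s y))"
  shows "\<xi> i r = (a + b * gal i u + c * (gal i u)\<^sup>2) * gal i x"
    "\<zeta> i r = (a + b * gal i u + c * (gal i u)\<^sup>2) * gal i z"
  unfolding r y
  by (simp_all add: \<xi>_add \<xi>_scale \<zeta>_add \<zeta>_scale coord_scale gal_mult power2_eq_square algebra_simps)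

lemma spread_point_coordinates:
  assumes r: "r \<in> ext emb (\<beta> ` vec.span {x *s p + z *s g})" "r \<noteq> 0"
  obtains n where "\<And>i. \<xi> i r = n i * gal i x" "\<And>i. \<zeta> i r = n i * gal i z" "\<exists>i<3. n i \<noteq> 0"
proof -
  let ?y = "x *s p + z *s g"
  obtain u where u: "u \<notin> range emb" using not_surj_emb by blast
  obtain a b c where abc: "r = a *s ext_vec emb (\<beta> ?y) + b *s ext_vec emb (\<beta> (u *s ?y))
      + c *s ext_vec emb (\<beta> (u\<^sup>2 *s ?y))"
    using ext_spread_element[OF u refl] r(1) by blast
  then have "a \<noteq> 0 \<or> b \<noteq> 0 \<or> c \<noteq> 0" using r(2) by auto
  from gal_eval_nonzero[OF u this] show thesis
    using that[of "\<lambda>i. a + b * gal i u + c * (gal i u)\<^sup>2"] spread_coordinates[OF u refl abc]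
    by blast
qed

lemma card_ext_spread_element:
  assumes "x \<noteq> 0 \<or> z \<noteq> 0"
  shows "CARD('k) ^ 3 \<le> card (ext emb (\<beta> ` vec.span {x *s p + z *s g}))"
proof -
  let ?y = "x *s p + z *s g"
  obtain u where u: "u \<notin> range emb" using not_surj_emb by blast
  let ?h = "\<lambda>(a, b, c). a *s ext_vec emb (\<beta> ?y) + b *s ext_vec emb (\<beta> (u *s ?y))
      + c *s ext_vec emb (\<beta> (u\<^sup>2 *s ?y))"
  have mem: "ext_vec emb (\<beta> (t *s ?y)) \<in> ext emb (\<beta> ` vec.span {?y})" for t
    by (intro ext_vec_mem imageI) (auto simp: span_singleton_mem)
  have "range ?h \<subseteq> ext emb (\<beta> ` vec.span {?y})"
    using mem[of 1] mem[of u] mem[of "u\<^sup>2"] subspace_ext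
    by (auto intro!: vec.subspace_add vec.subspace_scale)
  moreover have "inj ?h"
  proof (rule injI, unfold split_paired_all split_conv prod.inject)
    fix a b c a' b' c'
    assume "a *s ext_vec emb (\<beta> ?y) + b *s ext_vec emb (\<beta> (u *s ?y))
        + c *s ext_vec emb (\<beta> (u\<^sup>2 *s ?y))
      = a' *s ext_vec emb (\<beta> ?y) + b' *s ext_vec emb (\<beta> (u *s ?y))
        + c' *s ext_vec emb (\<beta> (u\<^sup>2 *s ?y))"
    then have eq: "0 = (a - a') *s ext_vec emb (\<beta> ?y) + (b - b') *s ext_vec emb (\<beta> (u *s ?y))
        + (c - c') *s ext_vec emb (\<beta> (u\<^sup>2 *s ?y))"
      by (simp add: vec.scale_left_diff_distrib algebra_simps)
    have "(a - a') + (b - b') * gal i u + (c - c') * (gal i u)\<^sup>2 = 0" for i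
      using spread_coordinates[OF u refl eq, of i] assms by auto
    with gal_eval_nonzero[OF u, of "a - a'" "b - b'" "c - c'"]
    show "a = a' \<and> b = b' \<and> c = c'" by auto
  qed
  ultimately have "card (UNIV :: ('k \<times> 'k \<times> 'k) set) \<le> card (ext emb (\<beta> ` vec.span {?y}))"
    by (intro card_inj_on_le[of ?h]) auto
  then show ?thesis by (simp add: eval_nat_numeral)
qed

lemma card_range3_le: "card {a *s r + b *s s + c *s t | a b c. True} \<le> CARD('k) ^ 3" (is "card ?V \<le> _")
  for r s t :: "'k ^ 'n"
proof -
  have "?V = (\<lambda>(a, b, c). a *s r + b *s s + c *s t) ` UNIV"
    by (simp add: set_eq_iff image_iff split_paired_Ex)
  then have "card ?V \<le> card (UNIV :: ('k \<times> 'k \<times> 'k) set)"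
    by (simp only: card_image_le finite)
  then show ?thesis by (simp add: eval_nat_numeral)
qed

text \<open>The span of \<open>r\<close> and its conjugates has at most \<open>CARD('k) ^ 3\<close>
  elements and contains the extension of the spread element, which has at least as many. So the two
  coincide.\<close>

lemma indicator_point_in_ext:
  assumes \<sigma>: "\<And>X. X \<in> ppoints (ext emb H) \<Longrightarrow> \<sigma> X = map_vec \<theta> ` X"
    and r: "r \<in> ext emb H" "r \<noteq> 0"
    and xz: "x \<noteq> 0 \<or> z \<noteq> 0"
    and eq: "{v \<in> H. ext_vec emb v \<in> vec.span (vec.span {r} \<union> \<sigma> (vec.span {r}) \<union> \<sigma> (\<sigma> (vec.span {r})))}
      = \<beta> ` vec.span {x *s p + z *s g}"
  shows "r \<in> ext emb (\<beta> ` vec.span {x *s p + z *s g})"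
proof -
  let ?f = "map_vec \<theta>" and ?E = "ext emb (\<beta> ` vec.span {x *s p + z *s g})"
  have P: "vec.span {r} \<in> ppoints (ext emb H)" "vec.span {?f r} \<in> ppoints (ext emb H)"
    using r by (auto intro!: ppoints_singleton subspace_ext map_vec_ext)
  have \<sigma>r: "\<sigma> (vec.span {r}) = vec.span {?f r}" "\<sigma> (vec.span {?f r}) = vec.span {?f (?f r)}"
    using \<sigma>[OF P(1)] \<sigma>[OF P(2)] by (simp_all add: map_vec_span_singleton)
  let ?V = "vec.span {r, ?f r, ?f (?f r)}"
  have "vec.span (vec.span {r} \<union> \<sigma> (vec.span {r}) \<union> \<sigma> (\<sigma> (vec.span {r}))) \<subseteq> ?V"
    unfolding \<sigma>r by (intro vec.span_minimal Un_least) (auto intro: vec.span_base)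
  then have "ext_vec emb ` \<beta> ` vec.span {x *s p + z *s g} \<subseteq> ?V"
    unfolding eq[symmetric] by auto
  then have sub: "?E \<subseteq> ?V"
    unfolding ext_def by (rule vec.span_minimal) simp
  have "?V = {a *s r + b *s ?f r + c *s ?f (?f r) | a b c. True}"
    by (rule span_three)
  then have "card ?V \<le> CARD('k) ^ 3" using card_range3_le[of r "?f r" "?f (?f r)"] by simp
  with card_ext_spread_element[OF xz] have "?E = ?V"
    by (intro card_seteq sub) simp_all
  then show ?thesis by (simp add: vec.span_base)
qed

text \<open>The index is read modulo 3. Such a point is a common eigenvector of the multiplications:
  multiplication by \<open>u\<close> acts on it as \<open>gal i u\<close>.\<close>

definition eigenpoint :: "nat \<Rightarrow> ('k ^ 'n) set \<Rightarrow> bool" where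
  "eigenpoint i X \<longleftrightarrow> X \<in> ppoints (ext emb \<pi>) \<and> (\<forall>r\<in>X. \<forall>j. j mod 3 \<noteq> i mod 3 \<longrightarrow> \<xi> j r = 0)"

lemma \<pi>_subset_H: "\<pi> \<subseteq> H"
proof -
  have "x *s p = x *s p + 0 *s g" for x by simp
  then show ?thesis unfolding \<pi>_def H_def by blast
qed

lemma eigenpoint_map_vec:
  assumes "eigenpoint i X"
  shows "eigenpoint (Suc i) (map_vec \<theta> ` X)"
proof -
  obtain r where r: "r \<in> ext emb \<pi>" "r \<noteq> 0" "X = vec.span {r}"
    using assms by (auto simp: eigenpoint_def elim: ppoints_E)
  have "map_vec \<theta> ` X \<in> ppoints (ext emb \<pi>)"
    unfolding r(3) map_vec_span_singleton using r
    by (intro ppoints_singleton subspace_ext map_vec_ext) auto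
  moreover have "\<xi> j (map_vec \<theta> s) = 0" if "s \<in> X" "j mod 3 \<noteq> Suc i mod 3" for s j
  proof -
    \<comment> \<open>\<open>j + 2\<close> stands for \<open>j - 1\<close> modulo 3.\<close>
    have "(j + 2) mod 3 \<noteq> i mod 3" using that(2) by presburger
    then have "\<xi> (j + 2) s = 0" using assms that(1) by (simp add: eigenpoint_def)
    moreover have "\<xi> j = \<xi> (Suc (j + 2))"
    proof -
      have "Suc (j + 2) mod 3 = j mod 3" by presburger
      then show ?thesis by (metis \<xi>_mod_3)
    qed
    ultimately show ?thesis by (simp only: \<xi>_Suc_map_vec) simp
  qed
  ultimately show ?thesis by (auto simp: eigenpoint_def)
qed

lemma span_p: "vec.span {x *s p + 0 *s g} = {t *s p | t. True}" if "x \<noteq> 0"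
proof -
  have "\<exists>c. t *s p = c *s (x *s p)" for t
    using that by (intro exI[of _ "t / x"]) simp
  then show ?thesis by (auto simp: span_singleton_mem)
qed

lemma \<zeta>_ext_\<pi>: "r \<in> ext emb \<pi> \<Longrightarrow> \<zeta> i r = 0"
  unfolding ext_def
  by (rule vec.span_induct[of r "ext_vec emb ` \<pi>" "\<lambda>r. \<zeta> i r = 0"])
    (auto simp: \<pi>_def \<zeta>_add \<zeta>_scale intro!: vec.subspaceI)

definition l_infinity :: "('k ^ 'm) set" where "l_infinity = {x *s p + z *s g | x z. True}"

lemma subspace_l_infinity: "vec.subspace l_infinity"
proof -
  have "l_infinity = vec.span {p, g}"
    by (simp add: l_infinity_def set_eq_iff mem_span_two)
  then show ?thesis by simp
qed

lemma ext_singleton_p: "x \<noteq> 0 \<Longrightarrow> \<beta> ` vec.span {x *s p + 0 *s g} = \<pi>"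
  unfolding \<pi>_def by (rule arg_cong[OF span_p])

text \<open>
  On an indicator line the functionals \<open>\<xi>\<^sub>i\<close> and \<open>\<zeta>\<^sub>i\<close> give, up to a common factor, the \<open>i\<close>-th
  conjugates of the homogeneous coordinates of a spread element. Comparing the points over
  \<open>(1, 0)\<close>, \<open>(0, 1)\<close>, \<open>(1, 1)\<close> and \<open>(1, u)\<close> with \<open>u\<close> outside \<open>'f\<close> leaves only one \<open>i\<close> for which
  they do not vanish identically.
\<close>

lemma indicator_line_eigenpoints:
  assumes \<sigma>: "\<And>X. X \<in> ppoints (ext emb H) \<Longrightarrow> \<sigma> X = map_vec \<theta> ` X"
    and ind: "indicator_line emb H (spread \<beta> l_infinity) \<sigma> \<nu>"
    and R: "R = \<nu> \<inter> ext emb \<pi>"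
  shows "\<exists>i. eigenpoint i R \<and> eigenpoint (Suc i) (\<sigma> R) \<and> eigenpoint (Suc (Suc i)) (\<sigma> (\<sigma> R))"
proof -
  have D: "spread \<beta> l_infinity
      = (\<lambda>P. {v \<in> H. ext_vec emb v \<in> vec.span (P \<union> \<sigma> P \<union> \<sigma> (\<sigma> P))}) ` ppoints \<nu>"
    and \<nu>: "\<nu> \<in> psubspaces 1 (ext emb H)"
    using ind by (auto simp: indicator_line_def)
  have sub: "vec.subspace \<nu>" "vec.dim \<nu> = 2" "\<nu> \<subseteq> ext emb H"
    using \<nu> by (auto simp: psubspaces_def)
  have point: "\<exists>r\<in>\<nu>. r \<noteq> 0 \<and> r \<in> ext emb (\<beta> ` vec.span {x *s p + z *s g})"
    if xz: "x \<noteq> 0 \<or> z \<noteq> 0" for x z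
  proof -
    have y: "x *s p + z *s g \<in> l_infinity" "x *s p + z *s g \<noteq> 0"
      using frame_independent[of x 0 z] xz by (auto simp: l_infinity_def)
    have "\<beta> ` vec.span {x *s p + z *s g} \<in> spread \<beta> l_infinity"
      unfolding spread_def by (intro imageI ppoints_singleton subspace_l_infinity y)
    then obtain P where P: "P \<in> ppoints \<nu>"
      "{v \<in> H. ext_vec emb v \<in> vec.span (P \<union> \<sigma> P \<union> \<sigma> (\<sigma> P))} = \<beta> ` vec.span {x *s p + z *s g}"
      unfolding D by (metis (no_types, lifting) imageE)
    obtain r where r: "r \<in> \<nu>" "r \<noteq> 0" "P = vec.span {r}"
      using P(1) by (rule ppoints_E)
    have "r \<in> ext emb (\<beta> ` vec.span {x *s p + z *s g})"
      by (rule indicator_point_in_ext[OF \<sigma> _ r(2) xz]) (use r sub P(2) in auto)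
    with r show ?thesis by blast
  qed
  have coordinates: "\<exists>x z n. (\<forall>i. \<xi> i r = n i * gal i x) \<and> (\<forall>i. \<zeta> i r = n i * gal i z)"
    if r: "r \<in> \<nu>" "r \<noteq> 0" for r
  proof -
    have P: "vec.span {r} \<in> ppoints \<nu>"
      by (intro ppoints_singleton sub r)
    let ?S = "{v \<in> H. ext_vec emb v \<in> vec.span (vec.span {r} \<union> \<sigma> (vec.span {r}) \<union> \<sigma> (\<sigma> (vec.span {r})))}"
    have "?S \<in> spread \<beta> l_infinity"
      unfolding D using P by (rule rev_image_eqI) simp
    then obtain X where X: "X \<in> ppoints l_infinity" "?S = \<beta> ` X"
      unfolding spread_def by blast
    obtain y where y: "y \<in> l_infinity" "y \<noteq> 0" "X = vec.span {y}"
      using X(1) by (rule ppoints_E)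
    then obtain x z where xz: "y = x *s p + z *s g" by (auto simp: l_infinity_def)
    with y have nonzero: "x \<noteq> 0 \<or> z \<noteq> 0" by auto
    have "r \<in> ext emb (\<beta> ` vec.span {x *s p + z *s g})"
      by (rule indicator_point_in_ext[OF \<sigma> _ r(2) nonzero]) (use r sub X y xz in auto)
    then show ?thesis
      using r(2) by (rule spread_point_coordinates) blast
  qed
  obtain r1 where r1: "r1 \<in> \<nu>" "r1 \<noteq> 0" "r1 \<in> ext emb (\<beta> ` vec.span {1 *s p + 0 *s g})"
    using point[of 1 0] by auto
  obtain r2 where r2: "r2 \<in> \<nu>" "r2 \<noteq> 0" "r2 \<in> ext emb (\<beta> ` vec.span {0 *s p + 1 *s g})"
    using point[of 0 1] by auto
  obtain r3 where r3: "r3 \<in> \<nu>" "r3 \<noteq> 0" "r3 \<in> ext emb (\<beta> ` vec.span {1 *s p + 1 *s g})"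
    using point[of 1 1] by auto
  \<comment> \<open>The factors \<open>m1\<close>, \<open>m2\<close>, \<open>m3\<close> record at
    which indices the three points are nonzero; the goal is a single residue for
    \<open>m1\<close>.\<close>
  obtain m1 where m1: "\<And>i. \<xi> i r1 = m1 i" "\<And>i. \<zeta> i r1 = 0" "\<exists>i<3. m1 i \<noteq> 0"
    using spread_point_coordinates[OF r1(3,2)] by (metis gal_0 gal_1 mult.right_neutral mult_zero_right)
  obtain m2 where m2: "\<And>i. \<xi> i r2 = 0" "\<And>i. \<zeta> i r2 = m2 i" "\<exists>i<3. m2 i \<noteq> 0"
    using spread_point_coordinates[OF r2(3,2)] by (metis gal_0 gal_1 mult.right_neutral mult_zero_right)
  obtain m3 where m3: "\<And>i. \<xi> i r3 = m3 i" "\<And>i. \<zeta> i r3 = m3 i" "\<exists>i<3. m3 i \<noteq> 0"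
    using spread_point_coordinates[OF r3(3,2)] by (metis gal_1 mult.right_neutral)
  have \<nu>_eq: "\<nu> = {a *s r1 + b *s r2 | a b. True}"
  proof -
    let ?h = "\<lambda>(a, b). a *s r1 + b *s r2"
    have "inj ?h"
    proof (rule injI, clarify)
      fix a b a' b' assume eq: "a *s r1 + b *s r2 = a' *s r1 + b' *s r2"
      have "a * m1 i = a' * m1 i" "b * m2 i = b' * m2 i" for i
        using arg_cong[OF eq, of "\<xi> i"] arg_cong[OF eq, of "\<zeta> i"]
        by (simp_all add: \<xi>_add \<xi>_scale \<zeta>_add \<zeta>_scale m1 m2)
      with m1(3) m2(3) show "a = a' \<and> b = b'" by auto
    qed
    then have "card (range ?h) = CARD('k) ^ 2"
      by (simp add: card_image power2_eq_square)
    moreover have "card \<nu> = CARD('k) ^ 2"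
      using card_subspace[OF sub(1)] sub(2) by simp
    moreover have "range ?h \<subseteq> \<nu>"
      using r1 r2 sub(1) by (auto intro!: vec.subspace_add vec.subspace_scale)
    ultimately have "range ?h = \<nu>"
      by (intro card_subset_eq) auto
    then show ?thesis by (auto simp: image_iff set_eq_iff)
  qed
  \<comment> \<open>A point over \<open>(1, 1)\<close> has equal \<open>\<xi>\<close> and
    \<open>\<zeta>\<close> coordinates, which makes \<open>m1\<close> and \<open>m2\<close>
    proportional.\<close>
  then obtain \<alpha> \<gamma> where "r3 = \<alpha> *s r1 + \<gamma> *s r2" using r3(1) by blast
  then have m3_eq: "m3 i = \<alpha> * m1 i" "m3 i = \<gamma> * m2 i" for i
    using m3(1,2)[of i] by (simp_all add: \<xi>_add \<xi>_scale \<zeta>_add \<zeta>_scale m1 m2)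
  then have \<alpha>\<gamma>: "\<alpha> \<noteq> 0" "\<gamma> \<noteq> 0" using m3(3) by auto
  define d where "d = \<alpha> / \<gamma>"
  have d: "m2 i = d * m1 i" "d \<noteq> 0" for i
    using m3_eq[of i] \<alpha>\<gamma> by (auto simp: d_def field_simps)
  obtain u where u: "u \<notin> range emb" using not_surj_emb by blast
  have unique: False if ij: "i < j" "j < 3" "m1 i \<noteq> 0" "m1 j \<noteq> 0" for i j
  proof -
    \<comment> \<open>The division by \<open>d\<close> gives
      \<open>\<zeta> k ?r = u * \<xi> k ?r\<close> for every \<open>k\<close>. As \<open>?r\<close>
      lies over some \<open>(x, z)\<close>, this means \<open>u = gal k (z / x)\<close> wherever
      \<open>m1\<close> is nonzero; two such indices put \<open>z / x\<close>, and with it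
      \<open>u\<close>, into \<open>'f\<close>.\<close>
    let ?r = "r1 + (u / d) *s r2"
    have "?r \<in> \<nu>" using r1 r2 sub(1) by (auto intro!: vec.subspace_add vec.subspace_scale)
    moreover have co: "\<xi> k ?r = m1 k" "\<zeta> k ?r = u * m1 k" for k
      using d by (simp_all add: \<xi>_add \<xi>_scale \<zeta>_add \<zeta>_scale m1 m2)
    then have "?r \<noteq> 0" using ij(3) by (metis \<xi>_0)
    ultimately have "\<exists>x z n. (\<forall>i. m1 i = n i * gal i x) \<and> (\<forall>i. u * m1 i = n i * gal i z)"
      using coordinates[of ?r] unfolding co by blast
    then obtain x z n where xz: "\<And>i. m1 i = n i * gal i x" "\<And>i. u * m1 i = n i * gal i z"
      by blast
    have "u = gal k (z / x)" if "m1 k \<noteq> 0" for k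
    proof -
      have "n k \<noteq> 0" "gal k x \<noteq> 0" using that xz(1)[of k] by auto
      moreover have "n k * (u * gal k x) = n k * gal k z"
        using xz[of k] by (simp add: algebra_simps)
      ultimately show ?thesis by (simp add: gal_divide field_simps)
    qed
    with ij have eq: "u = gal i (z / x)" "u = gal j (z / x)" by blast+
    then have "z / x \<in> range emb" using gal_eq_gal_imp ij(1,2) by metis
    then have "u \<in> range emb" using eq by auto
    with u show False by blast
  qed
  obtain i0 where i0: "i0 < 3" "m1 i0 \<noteq> 0" using m1(3) by blast
  have zero: "\<xi> j r1 = 0" if "j mod 3 \<noteq> i0 mod 3" for j
  proof -
    have "m1 (j mod 3) = 0"
      using unique[of "j mod 3" i0] unique[of i0 "j mod 3"] i0 that
      by (cases "j mod 3" i0 rule: linorder_cases) auto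
    then show ?thesis using m1(1) \<xi>_mod_3 by metis
  qed
  have \<pi>_r1: "r1 \<in> ext emb \<pi>"
    using r1(3) ext_singleton_p[of 1] by simp
  have R_eq: "R = vec.span {r1}"
  proof
    show "vec.span {r1} \<subseteq> R"
      unfolding R using r1(1) \<pi>_r1 by (intro Int_greatest vec.span_minimal sub subspace_ext) auto
    show "R \<subseteq> vec.span {r1}"
    proof
      fix r assume r: "r \<in> R"
      then obtain a b where ab: "r = a *s r1 + b *s r2" unfolding R \<nu>_eq by blast
      have "\<zeta> i0 r = 0" using r \<zeta>_ext_\<pi> unfolding R by blast
      then have "b = 0"
        using ab i0 d by (simp add: \<zeta>_add \<zeta>_scale m1 m2)
      then show "r \<in> vec.span {r1}" using ab by (auto simp: span_singleton_mem)
    qed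
  qed
  have eigen: "eigenpoint i0 R"
    unfolding eigenpoint_def R_eq
    using zero \<pi>_r1 r1(2) by (auto simp: span_singleton_mem \<xi>_scale intro!: ppoints_singleton subspace_ext)
  have in_H: "X \<in> ppoints (ext emb H)" if "eigenpoint i X" for i X
    using that ppoints_mono[OF ext_mono[OF \<pi>_subset_H]] by (auto simp: eigenpoint_def)
  have "eigenpoint (Suc i0) (\<sigma> R)"
    using eigenpoint_map_vec[OF eigen] \<sigma>[OF in_H[OF eigen]] by simp
  moreover from this have "eigenpoint (Suc (Suc i0)) (\<sigma> (\<sigma> R))"
    using eigenpoint_map_vec \<sigma>[OF in_H] by simp
  ultimately show ?thesis using eigen by blast
qed

end

section \<open>Scattered linear sets\<close>

context reduction
begin

text \<open>If a spread element meets \<open>\<pi>\<close> in a nonzero vector, the preimage of that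
  vector spans it over \<open>'k\<close>. Linear sets thus become sets of points spanned by the
  vectors of an \<open>'f\<close>-subspace, the form in which they are computed.\<close>

lemma linear_set_rank3_iff:
  assumes l: "vec.subspace l"
  shows "linear_set_rank3 \<beta> l T \<longleftrightarrow>
    (\<exists>\<pi>\<in>psubspaces 2 (\<beta> ` l). T = (\<lambda>w. vec.span {w}) ` {w. \<beta> w \<in> \<pi> \<and> w \<noteq> 0})"
proof -
  have points: "(\<lambda>w. vec.span {w}) ` {w. \<beta> w \<in> \<pi> \<and> w \<noteq> 0} \<subseteq> ppoints l"
    and meet: "meeting (spread \<beta> l) \<pi> = (\<lambda>P. \<beta> ` P) ` (\<lambda>w. vec.span {w}) ` {w. \<beta> w \<in> \<pi> \<and> w \<noteq> 0}"
    if \<pi>: "\<pi> \<in> psubspaces 2 (\<beta> ` l)" for \<pi>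
  proof -
    have sub: "vec.subspace \<pi>" "\<pi> \<subseteq> \<beta> ` l" using \<pi> by (auto simp: psubspaces_def)
    have wl: "w \<in> l" if "\<beta> w \<in> \<pi>" for w
      using that sub(2) by auto
    show points: "(\<lambda>w. vec.span {w}) ` {w. \<beta> w \<in> \<pi> \<and> w \<noteq> 0} \<subseteq> ppoints l"
      using wl l by (auto intro: ppoints_singleton)
    show "meeting (spread \<beta> l) \<pi> = (\<lambda>P. \<beta> ` P) ` (\<lambda>w. vec.span {w}) ` {w. \<beta> w \<in> \<pi> \<and> w \<noteq> 0}"
    proof (intro subset_antisym subsetI)
      fix X assume "X \<in> meeting (spread \<beta> l) \<pi>"
      then obtain P where P: "P \<in> ppoints l" "X = \<beta> ` P" "\<beta> ` P \<inter> \<pi> \<noteq> {0}"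
        by (auto simp: meeting_def spread_def)
      obtain v where v: "v \<in> l" "v \<noteq> 0" "P = vec.span {v}"
        using P(1) by (rule ppoints_E)
      have "0 \<in> \<beta> ` P \<inter> \<pi>"
        using v(3) sub(1) vec.subspace_0 vec.span_zero by (force simp flip: \<beta>_0)
      then obtain w where w: "w \<in> P" "\<beta> w \<in> \<pi>" "w \<noteq> 0"
        using P(3) by (smt (verit, ccfv_threshold) IntE \<beta>_eq_0_iff empty_iff imageE insert_iff subsetI subset_antisym)
      then have "P = vec.span {w}"
        using v span_singleton_eq_iff[of w v] by (auto simp: span_singleton_mem)
      with w P(2) show "X \<in> (\<lambda>P. \<beta> ` P) ` (\<lambda>w. vec.span {w}) ` {w. \<beta> w \<in> \<pi> \<and> w \<noteq> 0}"
        by blast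
    next
      fix X assume "X \<in> (\<lambda>P. \<beta> ` P) ` (\<lambda>w. vec.span {w}) ` {w. \<beta> w \<in> \<pi> \<and> w \<noteq> 0}"
      then obtain w where w: "\<beta> w \<in> \<pi>" "w \<noteq> 0" "X = \<beta> ` vec.span {w}" by blast
      then have "\<beta> w \<in> X \<inter> \<pi>" by (auto intro: vec.span_base)
      moreover have "\<beta> w \<noteq> 0" using w(2) by simp
      moreover have "X \<in> spread \<beta> l"
        using points w unfolding spread_def by blast
      ultimately show "X \<in> meeting (spread \<beta> l) \<pi>"
        unfolding meeting_def by blast
    qed
  qed
  have "inj (\<lambda>P. \<beta> ` P)"
    using bij_\<beta> by (auto intro!: injI simp: bij_is_inj inj_image_eq_iff)
  then have "(\<lambda>P. \<beta> ` P) ` A = (\<lambda>P. \<beta> ` P) ` B \<longleftrightarrow> A = B" for A B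
    by (rule inj_image_eq_iff)
  then show ?thesis
    unfolding linear_set_rank3_def using points meet by (metis (no_types, lifting))
qed

end

context cubic_embedding
begin

text \<open>
  The points of \<open>T\<close> partition the \<open>q\<^sup>3 - 1 = (q\<^sup>2 + q + 1)(q - 1)\<close> nonzero vectors of \<open>U\<close> into
  classes with at least \<open>q - 1\<close> elements.
\<close>

lemma card_points_iff:
  fixes U :: "('k ^ 'm) set"
  assumes scale: "\<And>s w. w \<in> U \<Longrightarrow> emb s *s w \<in> U"
    and zero: "0 \<in> U" and card: "card U = CARD('f) ^ 3"
  shows "card ((\<lambda>w. vec.span {w}) ` (U - {0})) = CARD('f)\<^sup>2 + CARD('f) + 1 \<longleftrightarrow>
    (\<forall>w\<in>U - {0}. \<forall>w'\<in>U - {0}. vec.span {w'} = vec.span {w} \<longrightarrow> (\<exists>s. w' = emb s *s w))"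
proof -
  let ?A = "U - {0}" and ?q = "CARD('f)"
  define f where "f = (\<lambda>w :: 'k ^ 'm. vec.span {w})"
  define fibre where "fibre = (\<lambda>w. {w' \<in> ?A. f w' = f w})"
  define orbit where "orbit = (\<lambda>w :: 'k ^ 'm. (\<lambda>s. emb s *s w) ` (UNIV - {0}))"
  have card_orbit: "card (orbit w) = ?q - 1" if "w \<in> ?A" for w
  proof -
    have "inj_on (\<lambda>s. emb s *s w) (UNIV - {0})"
      using that by (auto intro!: inj_onI)
    then show ?thesis unfolding orbit_def by (simp add: card_image card_Diff_singleton)
  qed
  have orbit_sub: "orbit w \<subseteq> fibre w" if w: "w \<in> ?A" for w
  proof
    fix w' assume "w' \<in> orbit w"
    then obtain s where s: "w' = emb s *s w" "s \<noteq> 0" by (auto simp: orbit_def)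
    then have "w' \<noteq> 0" using w by simp
    with s w scale show "w' \<in> fibre w"
      by (auto simp: fibre_def f_def span_singleton_eq_iff)
  qed
  have orbit_eq: "orbit w = fibre w \<longleftrightarrow> (\<forall>w'\<in>?A. f w' = f w \<longrightarrow> (\<exists>s. w' = emb s *s w))"
    if "w \<in> ?A" for w
  proof
    assume "orbit w = fibre w"
    then show "\<forall>w'\<in>?A. f w' = f w \<longrightarrow> (\<exists>s. w' = emb s *s w)"
      unfolding orbit_def fibre_def by blast
  next
    assume *: "\<forall>w'\<in>?A. f w' = f w \<longrightarrow> (\<exists>s. w' = emb s *s w)"
    have "fibre w \<subseteq> orbit w"
    proof
      fix w' assume "w' \<in> fibre w"
      then obtain s where "w' = emb s *s w" "w' \<noteq> 0"
        using * by (auto simp: fibre_def)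
      then show "w' \<in> orbit w" unfolding orbit_def by auto
    qed
    with orbit_sub[OF that] show "orbit w = fibre w" by blast
  qed
  have "card ?A = ?q ^ 3 - 1" using zero card by simp
  also have "\<dots> = (?q\<^sup>2 + ?q + 1) * (?q - 1)"
    using two_le_card_F by (auto simp: algebra_simps power2_eq_square power3_eq_cube diff_mult_distrib2)
  finally have card_A: "card ?A = (?q\<^sup>2 + ?q + 1) * (?q - 1)" .
  have "card ?A = (\<Sum>P\<in>f ` ?A. card {w \<in> ?A. f w = P})"
    using sum.image_gen[of ?A "\<lambda>_. 1 :: nat" f] by simp
  with card_A have sum: "(\<Sum>P\<in>f ` ?A. card {w \<in> ?A. f w = P}) = (?q\<^sup>2 + ?q + 1) * (?q - 1)"
    by simp
  have le: "?q - 1 \<le> card {w \<in> ?A. f w = P}" if P: "P \<in> f ` ?A" for P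
  proof -
    obtain w where w: "w \<in> ?A" "P = f w" using P by blast
    have "card (orbit w) \<le> card (fibre w)"
      using orbit_sub[OF w(1)] by (intro card_mono) auto
    then show ?thesis using card_orbit[OF w(1)] w by (simp add: fibre_def)
  qed
  \<comment> \<open>With \<open>q^2 + q + 1\<close> classes the lower bounds \<open>q - 1\<close>
    already add up to the total, so each of them is attained.\<close>
  have "card (f ` ?A) = ?q\<^sup>2 + ?q + 1 \<longleftrightarrow> (\<forall>P\<in>f ` ?A. ?q - 1 = card {w \<in> ?A. f w = P})"
  proof
    assume "card (f ` ?A) = ?q\<^sup>2 + ?q + 1"
    then have eq: "(\<Sum>P\<in>f ` ?A. ?q - 1) = (\<Sum>P\<in>f ` ?A. card {w \<in> ?A. f w = P})"
      using sum by simp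
    show "\<forall>P\<in>f ` ?A. ?q - 1 = card {w \<in> ?A. f w = P}"
    proof
      fix P assume "P \<in> f ` ?A"
      with le show "?q - 1 = card {w \<in> ?A. f w = P}"
        by (intro sum_mono_inv[OF eq]) simp_all
    qed
  next
    assume *: "\<forall>P\<in>f ` ?A. ?q - 1 = card {w \<in> ?A. f w = P}"
    have "(\<Sum>P\<in>f ` ?A. card {w \<in> ?A. f w = P}) = (\<Sum>P\<in>f ` ?A. ?q - 1)"
      by (rule sum.cong[OF refl]) (rule *[rule_format, symmetric])
    then have "card (f ` ?A) * (?q - 1) = (?q\<^sup>2 + ?q + 1) * (?q - 1)"
      by (simp only: sum sum_constant of_nat_id)
    moreover have "?q - 1 \<noteq> 0" using two_le_card_F by simp
    ultimately show "card (f ` ?A) = ?q\<^sup>2 + ?q + 1"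
      by (simp only: mult_cancel2) simp
  qed
  also have "\<dots> \<longleftrightarrow> (\<forall>w\<in>?A. card (orbit w) = card (fibre w))"
    using card_orbit by (auto simp: fibre_def)
  also have "\<dots> \<longleftrightarrow> (\<forall>w\<in>?A. orbit w = fibre w)"
    using orbit_sub by (metis card_subset_eq finite)
  finally show ?thesis
    using orbit_eq unfolding f_def by blast
qed

end

section \<open>Linear sets through \<open>P_inf\<close> in affine coordinates\<close>

context abb_frame
begin

definition line :: "('k ^ 'm) set" where "line = {x *s p + y *s e | x y. True}"

lemma subspace_line: "vec.subspace line"
proof -
  have "line = vec.span {p, e}"
    by (simp add: line_def set_eq_iff mem_span_two)
  then show ?thesis by simp
qed

lemma line_expansion: "w \<in> line \<Longrightarrow> w = cX w *s p + cY w *s e"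
  by (auto simp: line_def)

lemma line_mem [simp]: "x *s p + y *s e \<in> line"
  by (auto simp: line_def)

text \<open>
  The affine points, written in the coordinate \<open>x\<close>, of the linear set of the \<open>'f\<close>-span of \<open>p\<close>,
  \<open>b\<^sub>1 p + c\<^sub>1 e\<close> and \<open>b\<^sub>2 p + c\<^sub>2 e\<close>. By \<open>nonsplit\<close> every point of the set has weight one.
\<close>

definition affine_part :: "'k \<Rightarrow> 'k \<Rightarrow> 'k \<Rightarrow> 'k \<Rightarrow> 'k set" where
  "affine_part b1 b2 c1 c2 = {x. \<exists>m n. (m \<noteq> 0 \<or> n \<noteq> 0) \<and>
     x * (emb m * c1 + emb n * c2) - (emb m * b1 + emb n * b2) \<in> range emb}"

definition nonsplit :: "'k \<Rightarrow> 'k \<Rightarrow> 'k \<Rightarrow> 'k \<Rightarrow> bool" where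
  "nonsplit b1 b2 c1 c2 \<longleftrightarrow> (\<forall>m n. emb m * c1 + emb n * c2 = 0 \<longrightarrow> m = 0 \<and> n = 0) \<and>
     (\<forall>x. x * c1 - b1 \<in> range emb \<longrightarrow> x * c2 - b2 \<notin> range emb)"

lemma span_affine_point_eq:
  assumes "w \<in> line" "w \<noteq> 0"
  shows "vec.span {w} = vec.span {x *s p + e} \<longleftrightarrow> cX w = cY w * x"
proof -
  have ne: "x *s p + e \<noteq> 0" using frame_independent[of x 1 0] by auto
  have "vec.span {w} = vec.span {x *s p + e} \<longleftrightarrow> (\<exists>c. w = (c * x) *s p + c *s e)"
    using span_singleton_eq_iff[OF assms(2) ne] by (simp add: vec.scale_right_distrib)
  also have "\<dots> \<longleftrightarrow> cX w = cY w * x"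
    using line_expansion[OF assms(1)] by (metis coord_simps(1,2))
  finally show ?thesis .
qed

lemma span_p_eq:
  assumes "w \<noteq> 0"
  shows "vec.span {w} = vec.span {p} \<longleftrightarrow> (\<exists>c. w = c *s p)"
  using span_singleton_eq_iff[OF assms p_nonzero] .

text \<open>After a rescaling that puts \<open>p\<close> itself into the \<open>'f\<close>-space of
  the linear set, the space has a basis \<open>p\<close>, \<open>b1 p + c1 e\<close>,
  \<open>b2 p + c2 e\<close>. Weight one at \<open>P_inf\<close> makes \<open>c1\<close> and
  \<open>c2\<close> independent; weight one at the affine points is the other half of
  \<open>nonsplit\<close>.\<close>

lemma scattered_imp_affine_part:
  assumes T: "scattered_linear_set_rank3 \<beta> line T" and pT: "vec.span {p} \<in> T"
  obtains b1 b2 c1 c2 where "nonsplit b1 b2 c1 c2"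
    "{x. vec.span {x *s p + e} \<in> T} = affine_part b1 b2 c1 c2"
proof -
  obtain \<pi>' where \<pi>': "\<pi>' \<in> psubspaces 2 (\<beta> ` line)"
    and T_eq: "T = (\<lambda>w. vec.span {w}) ` {w. \<beta> w \<in> \<pi>' \<and> w \<noteq> 0}"
    and card_T: "card T = CARD('f)\<^sup>2 + CARD('f) + 1"
    using T unfolding scattered_linear_set_rank3_def linear_set_rank3_iff[OF subspace_line] by blast
  have sub: "vec.subspace \<pi>'" "vec.dim \<pi>' = 3" "\<pi>' \<subseteq> \<beta> ` line"
    using \<pi>' by (auto simp: psubspaces_def)
  define U where "U = {w. \<beta> w \<in> \<pi>'}"
  have U_add: "v + w \<in> U" if "v \<in> U" "w \<in> U" for v w
    using that sub(1) by (auto simp: U_def \<beta>_add intro: vec.subspace_add)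
  have U_scale: "emb s *s w \<in> U" if "w \<in> U" for s w
    using that sub(1) by (auto simp: U_def \<beta>_scale intro: vec.subspace_scale)
  have U_0: "0 \<in> U" using sub(1) by (auto simp: U_def intro: vec.subspace_0)
  have U_line: "w \<in> line" if "w \<in> U" for w
    using that sub(3) by (auto simp: U_def)
  have "\<beta> ` U = \<pi>'" using bij_\<beta> unfolding U_def by (auto simp: image_iff) (metis \<beta>_inv)
  then have card_U: "card U = CARD('f) ^ 3"
    using card_subspace[OF sub(1)] sub(2) card_image[of \<beta> U] by (simp add: inj_on_def)
  have T_U: "T = (\<lambda>w. vec.span {w}) ` (U - {0})"
    unfolding T_eq U_def by (rule arg_cong[of _ _ "(`) _"]) auto
  have weight: "\<exists>s. w' = emb s *s w"
    if "w \<in> U" "w \<noteq> 0" "w' \<in> U" "w' \<noteq> 0" "vec.span {w'} = vec.span {w}" for w w'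
    using card_points_iff[OF U_scale U_0 card_U] card_T that unfolding T_U by blast
  obtain w where w: "w \<in> U" "w \<noteq> 0" "vec.span {w} = vec.span {p}"
    using pT unfolding T_U by blast
  then obtain a where a: "w = a *s p" "a \<noteq> 0"
    using span_p_eq by auto
  have "card (range (\<lambda>s. emb s *s w)) < card U"
  proof -
    have "card (range (\<lambda>s. emb s *s w)) \<le> CARD('f)" by (rule card_image_le) simp
    then show ?thesis using card_K_gt card_U card_K by simp
  qed
  then obtain u1 where u1: "u1 \<in> U" "u1 \<notin> range (\<lambda>s. emb s *s w)"
    by (metis card_mono finite leD subsetI)
  have "card (range (\<lambda>(s, t). emb s *s w + emb t *s u1)) < card U"
  proof -
    have "card (range (\<lambda>(s, t). emb s *s w + emb t *s u1)) \<le> card (UNIV :: ('f \<times> 'f) set)"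
      by (rule card_image_le) simp
    then show ?thesis using card_K_gt card_U card_K by (simp add: power2_eq_square)
  qed
  then obtain u2 where u2: "u2 \<in> U" "u2 \<notin> range (\<lambda>(s, t). emb s *s w + emb t *s u1)"
    by (metis card_mono finite leD subsetI)
  \<comment> \<open>Dividing by \<open>a\<close> turns the vector \<open>w\<close> into
    \<open>p\<close>; a common factor from \<open>'k\<close> does not change the points
    spanned.\<close>
  define b1 b2 c1 c2 where "b1 = cX u1 / a" and "b2 = cX u2 / a" and "c1 = cY u1 / a" and "c2 = cY u2 / a"
  have u1_eq: "u1 = (a * b1) *s p + (a * c1) *s e" and u2_eq: "u2 = (a * b2) *s p + (a * c2) *s e"
    using line_expansion[OF U_line[OF u1(1)]] line_expansion[OF U_line[OF u2(1)]] a(2)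
    by (simp_all add: b1_def b2_def c1_def c2_def)
  have indep: "m = 0 \<and> n = 0" if mn: "emb m * c1 + emb n * c2 = 0" for m n
  proof -
    \<comment> \<open>A relation between \<open>c1\<close> and \<open>c2\<close> puts this vector
      into the span of \<open>p\<close>, where all vectors of \<open>U\<close> are
      \<open>'f\<close>-multiples of \<open>w\<close>.\<close>
    define v where "v = emb m *s u1 + emb n *s u2"
    have v: "v = (a * (emb m * b1 + emb n * b2)) *s p + (a * (emb m * c1 + emb n * c2)) *s e"
      unfolding v_def u1_eq u2_eq by (simp add: algebra_simps)
    have "\<exists>s. v = emb s *s w"
    proof (cases "v = 0")
      case True
      then show ?thesis by (intro exI[of _ 0]) simp
    next
      case False
      have "v \<in> U" unfolding v_def using u1 u2 by (intro U_add U_scale)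
      moreover have "vec.span {v} = vec.span {w}"
        using w(3) span_p_eq[OF False] v mn by auto
      ultimately show ?thesis using weight w False by blast
    qed
    then obtain s where s: "emb m *s u1 + emb n *s u2 = emb s *s w"
      unfolding v_def by blast
    have n: "n = 0"
    proof (rule ccontr)
      assume "n \<noteq> 0"
      have "emb n *s u2 = emb s *s w - emb m *s u1" using s by (simp add: algebra_simps)
      then have "inverse (emb n) *s (emb n *s u2) = inverse (emb n) *s (emb s *s w - emb m *s u1)"
        by simp
      then have "u2 = emb (s / n) *s w + emb (- m / n) *s u1"
        using \<open>n \<noteq> 0\<close> by (simp add: emb_mult emb_inverse emb_minus algebra_simps divide_inverse)
      then have "u2 \<in> range (\<lambda>(s, t). emb s *s w + emb t *s u1)"
        by (intro range_eqI[of _ _ "(s / n, - m / n)"]) simp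
      with u2(2) show False by blast
    qed
    moreover have "m = 0"
    proof (rule ccontr)
      assume "m \<noteq> 0"
      have "inverse (emb m) *s (emb m *s u1) = inverse (emb m) *s (emb s *s w)"
        using s n by simp
      then have "u1 = emb (s / m) *s w"
        using \<open>m \<noteq> 0\<close> by (simp add: emb_mult emb_inverse divide_inverse mult.commute)
      with u1(2) show False by blast
    qed
    ultimately show ?thesis by simp
  qed
  let ?h = "\<lambda>(s, m, n). emb s *s w + emb m *s u1 + emb n *s u2"
  have h_eq: "?h (s, m, n) = (a * (emb s + (emb m * b1 + emb n * b2))) *s p
      + (a * (emb m * c1 + emb n * c2)) *s e" for s m n
    unfolding u1_eq u2_eq a(1) by (simp add: algebra_simps)
  have range_h: "range ?h = U"
  proof (rule card_subset_eq)
    show "range ?h \<subseteq> U" using w u1 u2 by (auto intro!: U_add U_scale)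
    have "inj ?h"
    proof (rule injI, unfold split_paired_all)
      fix s m n s' m' n'
      assume "?h (s, m, n) = ?h (s', m', n')"
      then have eqs: "a * (emb s + (emb m * b1 + emb n * b2)) = a * (emb s' + (emb m' * b1 + emb n' * b2))"
        "a * (emb m * c1 + emb n * c2) = a * (emb m' * c1 + emb n' * c2)"
        unfolding h_eq by (metis coord_simps(1,2))+
      then have "emb m * c1 + emb n * c2 = emb m' * c1 + emb n' * c2"
        using a(2) by simp
      then have "emb (m - m') * c1 + emb (n - n') * c2 = 0"
        by (simp add: emb_diff algebra_simps)
      from indep[OF this] eqs(1) a(2) show "(s, m, n) = (s', m', n')" by simp
    qed
    then show "card (range ?h) = card U"
      by (simp add: card_image card_U eval_nat_numeral)
  qed simp
  have U_iff: "v \<in> U \<longleftrightarrow> (\<exists>s m n. v = ?h (s, m, n))" for v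
    unfolding range_h[symmetric] by (simp add: image_iff split_paired_Ex)
  have "nonsplit b1 b2 c1 c2"
    unfolding nonsplit_def
  proof (intro conjI allI impI notI)
    fix x assume "x * c1 - b1 \<in> range emb" "x * c2 - b2 \<in> range emb"
    then obtain f1 f2 where f: "x * c1 - b1 = emb f1" "x * c2 - b2 = emb f2" by blast
    \<comment> \<open>Both vectors are multiples of \<open>x *s p + e\<close>, so this point would
      have weight at least two.\<close>
    let ?v1 = "?h (f1, 1, 0)" and ?v2 = "?h (f2, 0, 1)"
    have v: "?v1 = (a * c1 * x) *s p + (a * c1) *s e" "?v2 = (a * c2 * x) *s p + (a * c2) *s e"
      unfolding h_eq by (simp_all flip: f add: algebra_simps)
    have c: "c1 \<noteq> 0" "c2 \<noteq> 0" using indep[of 1 0] indep[of 0 1] by auto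
    have ne: "?v1 \<noteq> 0" "?v2 \<noteq> 0"
      unfolding v using c a(2) frame_independent[of _ _ 0] by (metis add.right_neutral mult_eq_0_iff vec.scale_zero_left)+
    have "vec.span {?v1} = vec.span {x *s p + e}" "vec.span {?v2} = vec.span {x *s p + e}"
      using span_affine_point_eq ne unfolding v by simp_all
    then have "vec.span {?v2} = vec.span {?v1}" by simp
    moreover have "?v1 \<in> U" "?v2 \<in> U" using U_iff by blast+
    ultimately obtain s where "?v2 = emb s *s ?v1" using weight ne by blast
    then have "cY ?v2 = emb s * cY ?v1" by (simp only: coord_scale)
    then have "a * c2 = emb s * (a * c1)" unfolding v by simp
    then have "emb s * c1 + emb (- 1) * c2 = 0"
      using a(2) by (simp add: emb_minus algebra_simps)
    from indep[OF this] show False by simp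
  qed (use indep in auto)
  moreover have "vec.span {x *s p + e} \<in> T \<longleftrightarrow> x \<in> affine_part b1 b2 c1 c2" for x
  proof
    assume "vec.span {x *s p + e} \<in> T"
    then obtain v where v: "v \<in> U" "v \<noteq> 0" "vec.span {v} = vec.span {x *s p + e}"
      unfolding T_U by (metis (no_types, lifting) DiffE imageE insertI1)
    then obtain s m n where smn: "v = ?h (s, m, n)" using U_iff by blast
    have co: "cX v = a * (emb s + (emb m * b1 + emb n * b2))" "cY v = a * (emb m * c1 + emb n * c2)"
      unfolding smn h_eq by simp_all
    have "cX v = cY v * x"
      using v U_line span_affine_point_eq by blast
    then have eq: "emb s + (emb m * b1 + emb n * b2) = (emb m * c1 + emb n * c2) * x"
      unfolding co using a(2) by simp
    have "m \<noteq> 0 \<or> n \<noteq> 0"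
    proof (rule ccontr)
      assume "\<not> ?thesis"
      then have "v = 0" using eq smn by auto
      with v show False by blast
    qed
    moreover have "x * (emb m * c1 + emb n * c2) - (emb m * b1 + emb n * b2) = emb s"
      using eq by (simp add: algebra_simps)
    ultimately show "x \<in> affine_part b1 b2 c1 c2"
      unfolding affine_part_def by blast
  next
    assume "x \<in> affine_part b1 b2 c1 c2"
    then obtain s m n where mn: "m \<noteq> 0 \<or> n \<noteq> 0"
      and eq: "x * (emb m * c1 + emb n * c2) - (emb m * b1 + emb n * b2) = emb s"
      unfolding affine_part_def by blast
    define v where "v = ?h (s, m, n)"
    have co: "cX v = a * (emb s + (emb m * b1 + emb n * b2))" "cY v = a * (emb m * c1 + emb n * c2)"
      unfolding v_def h_eq by simp_all
    have "v \<in> U" unfolding v_def using U_iff by blast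
    moreover have "cY v \<noteq> 0" using indep[of m n] mn a(2) co(2) by auto
    then have "v \<noteq> 0" using coord_simps(2)[of 0 0] by auto
    moreover have "cX v = cY v * x" unfolding co by (simp flip: eq add: algebra_simps)
    ultimately have "vec.span {x *s p + e} = vec.span {v}"
      using span_affine_point_eq U_line by blast
    with \<open>v \<in> U\<close> \<open>v \<noteq> 0\<close> show "vec.span {x *s p + e} \<in> T"
      unfolding T_U by blast
  qed
  ultimately show thesis using that by blast
qed

text \<open>\<open>nonsplit\<close> expresses weight one at every point: the independence of
  \<open>c1\<close> and \<open>c2\<close> covers \<open>P_inf\<close>, the second condition the
  affine points.\<close>

lemma nonsplit_imp_scattered:
  assumes ns: "nonsplit b1 b2 c1 c2"
  obtains T where "scattered_linear_set_rank3 \<beta> line T" "vec.span {p} \<in> T"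
    "{x. vec.span {x *s p + e} \<in> T} = affine_part b1 b2 c1 c2"
proof -
  have indep: "m = 0 \<and> n = 0" if "emb m * c1 + emb n * c2 = 0" for m n
    using ns that by (auto simp: nonsplit_def)
  define h where "h = (\<lambda>(s, m, n). (emb s + (emb m * b1 + emb n * b2)) *s p + (emb m * c1 + emb n * c2) *s e)"
  have h_eq: "h (s, m, n) = (emb s + (emb m * b1 + emb n * b2)) *s p + (emb m * c1 + emb n * c2) *s e" for s m n
    by (simp add: h_def)
  have h_X: "cX (h (s, m, n)) = emb s + (emb m * b1 + emb n * b2)"
    and h_Y: "cY (h (s, m, n)) = emb m * c1 + emb n * c2" for s m n
    unfolding h_eq by (rule coord_simps)+
  define U where "U = range h"
  have inj: "inj h"
  proof (rule injI, unfold split_paired_all)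
    fix s m n s' m' n'
    assume eq: "h (s, m, n) = h (s', m', n')"
    have "emb (m - m') * c1 + emb (n - n') * c2 = 0"
      using arg_cong[OF eq, of cY] unfolding h_Y by (simp add: emb_diff algebra_simps)
    from indep[OF this] arg_cong[OF eq, of cX] show "(s, m, n) = (s', m', n')"
      unfolding h_X by simp
  qed
  have card_U: "card U = CARD('f) ^ 3"
    unfolding U_def by (simp add: card_image[OF inj] eval_nat_numeral)
  have U_E: "\<exists>s m n. w = h (s, m, n)" if "w \<in> U" for w
    using that unfolding U_def by (simp add: image_iff split_paired_Ex)
  have U_0: "0 \<in> U"
    unfolding U_def by (rule range_eqI[of _ _ "(0, 0, 0)"]) (simp add: h_eq)
  have U_add: "v + w \<in> U" if vw: "v \<in> U" "w \<in> U" for v w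
  proof -
    obtain s m n where "v = h (s, m, n)" using U_E[OF vw(1)] by blast
    moreover obtain s' m' n' where "w = h (s', m', n')" using U_E[OF vw(2)] by blast
    ultimately have "v + w = h (s + s', m + m', n + n')"
      by (simp add: h_eq emb_add algebra_simps)
    then show ?thesis unfolding U_def by (rule range_eqI)
  qed
  have U_scale: "emb t *s w \<in> U" if w: "w \<in> U" for t w
  proof -
    obtain s m n where "w = h (s, m, n)" using U_E[OF w] by blast
    then have "emb t *s w = h (t * s, t * m, t * n)"
      by (simp add: h_eq emb_mult algebra_simps)
    then show ?thesis unfolding U_def by (rule range_eqI)
  qed
  have U_line: "w \<in> line" if "w \<in> U" for w
    using U_E[OF that] line_mem unfolding h_eq by blast
  define \<pi>' where "\<pi>' = \<beta> ` U"
  have \<pi>'_mem: "\<beta> w \<in> \<pi>' \<longleftrightarrow> w \<in> U" for w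
    unfolding \<pi>'_def by (auto simp: image_iff)
  have sub: "vec.subspace \<pi>'"
  proof (rule vec.subspaceI)
    show "0 \<in> \<pi>'" using \<pi>'_mem[of 0] U_0 by simp
    show "x + y \<in> \<pi>'" if "x \<in> \<pi>'" "y \<in> \<pi>'" for x y
      using that U_add \<pi>'_mem[of "inv \<beta> x"] \<pi>'_mem[of "inv \<beta> y"] \<pi>'_mem[of "inv \<beta> x + inv \<beta> y"]
      by (simp add: \<beta>_add)
    show "c *s x \<in> \<pi>'" if "x \<in> \<pi>'" for c x
      using that U_scale \<pi>'_mem[of "inv \<beta> x"] \<pi>'_mem[of "emb c *s inv \<beta> x"]
      by (simp add: \<beta>_scale)
  qed
  have "card \<pi>' = CARD('f) ^ 3"
    unfolding \<pi>'_def by (subst card_image) (simp_all add: inj_on_def card_U)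
  then have "CARD('f) ^ vec.dim \<pi>' = CARD('f) ^ 3"
    using card_subspace[OF sub] by simp
  then have "vec.dim \<pi>' = 3"
    using two_le_card_F by (subst (asm) power_inject_exp) auto
  then have \<pi>': "\<pi>' \<in> psubspaces 2 (\<beta> ` line)"
    using sub U_line by (auto simp: psubspaces_def \<pi>'_def)
  define T where "T = (\<lambda>w. vec.span {w}) ` (U - {0})"
  have "T = (\<lambda>w. vec.span {w}) ` {w. \<beta> w \<in> \<pi>' \<and> w \<noteq> 0}"
    unfolding T_def \<pi>'_mem by (rule arg_cong[of _ _ "(`) _"]) auto
  then have linear: "linear_set_rank3 \<beta> line T"
    unfolding linear_set_rank3_iff[OF subspace_line] using \<pi>' by blast
  have weight: "\<exists>t. w' = emb t *s w"
    if w: "w \<in> U - {0}" "w' \<in> U - {0}" "vec.span {w'} = vec.span {w}" for w w'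
  proof -
    obtain y where y: "w' = y *s w" using span_singleton_eq_iff w by blast
    obtain s m n where smn: "w = h (s, m, n)" using U_E w(1) by blast
    obtain s' m' n' where smn': "w' = h (s', m', n')" using U_E w(2) by blast
    have Y: "emb m' * c1 + emb n' * c2 = y * (emb m * c1 + emb n * c2)"
      using arg_cong[OF y, of cY] unfolding smn smn' coord_scale h_Y .
    have X: "emb s' + (emb m' * b1 + emb n' * b2) = y * (emb s + (emb m * b1 + emb n * b2))"
      using arg_cong[OF y, of cX] unfolding smn smn' coord_scale h_X .
    have "y \<in> range emb"
    proof (cases "m = 0 \<and> n = 0")
      case True
      then have "m' = 0 \<and> n' = 0" using Y indep by simp
      with True X have "emb s' = y * emb s" by simp
      moreover have "s \<noteq> 0" using True smn w(1) by (auto simp: h_eq)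
      ultimately have "y = emb (s' / s)" by (simp add: emb_divide)
      then show ?thesis by blast
    next
      case False
      define c where "c = emb m * c1 + emb n * c2"
      define x where "x = (emb s + (emb m * b1 + emb n * b2)) / c"
      have c: "c \<noteq> 0" using False indep unfolding c_def by blast
      have e1: "x * (emb m * c1 + emb n * c2) - (emb m * b1 + emb n * b2) = emb s"
        using c unfolding x_def c_def by simp
      have e2: "x * (emb m' * c1 + emb n' * c2) - (emb m' * b1 + emb n' * b2) = emb s'"
      proof -
        have "x * (emb m' * c1 + emb n' * c2) = y * (x * c)"
          unfolding Y c_def by (simp only: ac_simps)
        also have "\<dots> = emb s' + (emb m' * b1 + emb n' * b2)"
          using c unfolding X x_def by simp
        finally show ?thesis by simp
      qed
      \<comment> \<open>Cramer's rule for \<open>e1\<close> and \<open>e2\<close> in the unknowns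
        \<open>x * c1 - b1\<close> and \<open>x * c2 - b2\<close>: a nonzero determinant puts both
        into \<open>'f\<close>, a zero one makes \<open>(m, n)\<close> and \<open>(m', n')\<close>
        proportional.\<close>
      define d where "d = m * n' - m' * n"
      have d1: "emb d * (x * c1 - b1) = emb (n' * s - n * s')"
        and d2: "emb d * (x * c2 - b2) = emb (m * s' - m' * s)"
        unfolding d_def emb_diff emb_mult by (simp_all flip: e1 e2 add: algebra_simps)
      have "d = 0"
      proof (rule ccontr)
        assume "d \<noteq> 0"
        then have "x * c1 - b1 = emb ((n' * s - n * s') / d)" "x * c2 - b2 = emb ((m * s' - m' * s) / d)"
          using d1 d2 unfolding emb_divide by (simp_all add: field_simps)
        then have "x * c1 - b1 \<in> range emb" "x * c2 - b2 \<in> range emb" by simp_all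
        with ns show False by (simp add: nonsplit_def)
      qed
      then have "emb m * emb n' = emb m' * emb n"
        unfolding d_def by (simp flip: emb_mult)
      then have "emb m * (y * c) = emb m' * c" "emb n * (y * c) = emb n' * c"
        unfolding c_def Y[symmetric] by (simp_all add: algebra_simps)
      then have "emb m * y = emb m'" "emb n * y = emb n'"
        using c by simp_all
      with False have "y = emb (m' / m) \<or> y = emb (n' / n)"
        by (auto simp: emb_divide field_simps)
      then show ?thesis by blast
    qed
    with y show ?thesis by blast
  qed
  have "card T = CARD('f)\<^sup>2 + CARD('f) + 1"
    unfolding T_def using card_points_iff[OF U_scale U_0 card_U] weight by blast
  with linear have "scattered_linear_set_rank3 \<beta> line T"
    by (simp add: scattered_linear_set_rank3_def)
  moreover have "p \<in> U"
    unfolding U_def by (rule range_eqI[of _ _ "(1, 0, 0)"]) (simp add: h_eq)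
  then have "vec.span {p} \<in> T"
    unfolding T_def using p_nonzero by blast
  moreover have "vec.span {x *s p + e} \<in> T \<longleftrightarrow> x \<in> affine_part b1 b2 c1 c2" for x
  proof
    assume "vec.span {x *s p + e} \<in> T"
    then obtain v where v: "v \<in> U" "v \<noteq> 0" "vec.span {v} = vec.span {x *s p + e}"
      unfolding T_def by (metis (no_types, lifting) DiffE imageE insertI1)
    then obtain s m n where smn: "v = h (s, m, n)" using U_E by blast
    have "cX v = cY v * x"
      using v U_line span_affine_point_eq by blast
    then have eq: "emb s + (emb m * b1 + emb n * b2) = (emb m * c1 + emb n * c2) * x"
      unfolding smn h_X h_Y .
    have "m \<noteq> 0 \<or> n \<noteq> 0"
    proof (rule ccontr)
      assume "\<not> ?thesis"
      then have "v = 0" using eq smn by (auto simp: h_eq)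
      with v show False by blast
    qed
    moreover have "x * (emb m * c1 + emb n * c2) - (emb m * b1 + emb n * b2) = emb s"
      using eq by (simp add: algebra_simps)
    ultimately show "x \<in> affine_part b1 b2 c1 c2"
      unfolding affine_part_def by blast
  next
    assume "x \<in> affine_part b1 b2 c1 c2"
    then obtain s m n where mn: "m \<noteq> 0 \<or> n \<noteq> 0"
      and eq: "x * (emb m * c1 + emb n * c2) - (emb m * b1 + emb n * b2) = emb s"
      unfolding affine_part_def by blast
    define v where "v = h (s, m, n)"
    have v: "v \<in> U" unfolding v_def U_def by (rule rangeI)
    moreover have "cY v \<noteq> 0" using indep[of m n] mn unfolding v_def h_Y by auto
    then have "v \<noteq> 0" using coord_simps(2)[of 0 0] by auto
    moreover have "cX v = cY v * x" unfolding v_def h_X h_Y by (simp flip: eq add: algebra_simps)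
    ultimately have "vec.span {x *s p + e} = vec.span {v}"
      using span_affine_point_eq U_line by blast
    with \<open>v \<in> U\<close> \<open>v \<noteq> 0\<close> show "vec.span {x *s p + e} \<in> T"
      unfolding T_def by blast
  qed
  ultimately show thesis using that by blast
qed

end

section \<open>From linear sets to quadrics\<close>

context abb_frame
begin

definition solid :: "('f ^ 'n) set" where
  "solid = \<beta> ` {x *s p + emb t *s e | x t. True}"

lemma solid_mem [simp]: "\<beta> (x *s p + emb t *s e) \<in> solid"
  by (auto simp: solid_def)

lemma subspace_solid: "vec.subspace solid"
proof (rule vec.subspaceI)
  have "\<beta> (0 *s p + emb 0 *s e) \<in> solid" by (rule solid_mem)
  then show "0 \<in> solid" by simp
next
  fix v w assume "v \<in> solid" "w \<in> solid"
  then obtain x t x' t' where "v = \<beta> (x *s p + emb t *s e)" "w = \<beta> (x' *s p + emb t' *s e)"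
    unfolding solid_def by blast
  then have "v + w = \<beta> ((x + x') *s p + emb (t + t') *s e)"
    by (simp flip: \<beta>_add add: emb_add algebra_simps)
  then show "v + w \<in> solid" by (metis solid_mem)
next
  fix c v assume "v \<in> solid"
  then obtain x t where "v = \<beta> (x *s p + emb t *s e)"
    unfolding solid_def by blast
  then have "c *s v = \<beta> ((emb c * x) *s p + emb (c * t) *s e)"
    by (simp flip: \<beta>_scale add: emb_mult algebra_simps)
  then show "c *s v \<in> solid" by (metis solid_mem)
qed

lemma card_solid: "card solid = CARD('f) ^ 4"
proof -
  let ?h = "\<lambda>(x, t). \<beta> (x *s p + emb t *s e)"
  have "inj ?h"
  proof (rule injI, clarify)
    fix x t x' t' assume "\<beta> (x *s p + emb t *s e) = \<beta> (x' *s p + emb t' *s e)"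
    then have "x *s p + emb t *s e = x' *s p + emb t' *s e" by simp
    then have "x = x'" "emb t = emb t'" by (metis coord_simps(1,2))+
    then show "x = x' \<and> t = t'" by simp
  qed
  moreover have "solid = range ?h"
    by (auto simp: solid_def image_iff)
  ultimately have "card solid = CARD('k) * CARD('f)"
    by (simp add: card_image)
  then show ?thesis by (simp add: card_K eval_nat_numeral)
qed

text \<open>
  The form is the determinant of the map \<open>c\<^sub>j \<mapsto> x c\<^sub>j - t b\<^sub>j\<close> into the plane \<open>'k / 'f\<close>. Up to a
  constant it is also the determinant with the rows \<open>(1, 1, 1)\<close> and \<open>(v\<^sub>j, \<theta> v\<^sub>j, \<theta>\<^sup>2 v\<^sub>j)\<close> for
  \<open>v\<^sub>j = x c\<^sub>j - t b\<^sub>j\<close>, which extends to \<open>'k\<close> and visibly vanishes at the conjugate points.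
\<close>

lemma nonsplit_imp_hyperbolic:
  assumes ns: "nonsplit b1 b2 c1 c2"
  obtains Q where "hyperbolic_on solid Q" "nondegenerate_on \<pi> Q"
    "\<And>i X. eigenpoint i X \<Longrightarrow> X \<in> extended_quadric emb \<pi> Q"
    "{x. Q (\<beta> (x *s p + e)) = 0} = affine_part b1 b2 c1 c2"
proof -
  have indep: "m = 0 \<and> n = 0" if "emb m * c1 + emb n * c2 = 0" for m n
    using ns that by (auto simp: nonsplit_def)
  obtain u where u: "u \<notin> range emb" using not_surj_emb by blast
  have "\<forall>x. \<exists>a b c. x = emb a + emb b * u + emb c * u\<^sup>2"
    using quadratic_representation[OF u] by metis
  \<comment> \<open>\<open>g1\<close> and \<open>g2\<close> serve as coordinates on the plane
    \<open>'k / 'f\<close>.\<close>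
  then obtain g0 g1 g2 where rep: "\<And>x. x = emb (g0 x) + emb (g1 x) * u + emb (g2 x) * u\<^sup>2"
    by metis
  have g_eq: "g1 (emb a + emb b * u + emb c * u\<^sup>2) = b" "g2 (emb a + emb b * u + emb c * u\<^sup>2) = c"
    for a b c
    using quadratic_unique(2,3)[OF u rep[symmetric]] .
  have g_add: "g1 (x + y) = g1 x + g1 y" "g2 (x + y) = g2 x + g2 y" for x y
  proof -
    have "x + y = emb (g0 x + g0 y) + emb (g1 x + g1 y) * u + emb (g2 x + g2 y) * u\<^sup>2"
      by (subst rep[of x], subst rep[of y]) (simp add: emb_add algebra_simps)
    then show "g1 (x + y) = g1 x + g1 y" "g2 (x + y) = g2 x + g2 y" using g_eq by metis+
  qed
  have g_scale: "g1 (emb c * x) = c * g1 x" "g2 (emb c * x) = c * g2 x" for c x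
  proof -
    have "emb c * x = emb (c * g0 x) + emb (c * g1 x) * u + emb (c * g2 x) * u\<^sup>2"
      by (subst rep[of x]) (simp add: emb_mult algebra_simps)
    then show "g1 (emb c * x) = c * g1 x" "g2 (emb c * x) = c * g2 x" using g_eq by metis+
  qed
  have g_0: "g1 x = 0 \<and> g2 x = 0 \<longleftrightarrow> x \<in> range emb" for x
  proof
    assume "g1 x = 0 \<and> g2 x = 0"
    then have "x = emb (g0 x)" using rep[of x] by simp
    then show "x \<in> range emb" by blast
  next
    assume "x \<in> range emb"
    then obtain a where "x = emb a + emb 0 * u + emb 0 * u\<^sup>2" by auto
    then show "g1 x = 0 \<and> g2 x = 0" using g_eq by metis
  qed
  have g_u: "g1 u = 1" "g2 u = 0" "g1 (u\<^sup>2) = 0" "g2 (u\<^sup>2) = 1"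
    using g_eq[of 0 1 0] g_eq[of 0 0 1] by simp_all
  define V where "V = (\<lambda>b c v. cX (inv \<beta> v) * c - cY (inv \<beta> v) * b)"
  have V_add: "V b c (v + w) = V b c v + V b c w" for b c v w
    by (simp add: V_def inv_\<beta>_add coord_add algebra_simps)
  have V_scale: "V b c (s *s v) = emb s * V b c v" for b c s v
    by (simp add: V_def inv_\<beta>_scale coord_scale algebra_simps)
  have V_affine: "V b c (\<beta> (x *s p + e)) = x * c - b" for b c x
    using coord_simps(1,2)[of x 1] by (simp add: V_def)
  have V_\<pi>: "V b c (\<beta> (x *s p)) = x * c" for b c x
    by (simp add: V_def)
  \<comment> \<open>The sign of the determinant sits inside the third factor to fit the shape of
    \<open>hyperbolic_onI\<close>.\<close>
  define Q where "Q = (\<lambda>v. g1 (V b1 c1 v) * g2 (V b2 c2 v) + (- g2 (V b1 c1 v)) * g1 (V b2 c2 v))"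
  have not_F: "x = 0" if F: "x * c1 \<in> range emb" "x * c2 \<in> range emb" for x
  proof (rule ccontr)
    assume x: "x \<noteq> 0"
    obtain f1 f2 where f: "x * c1 = emb f1" "x * c2 = emb f2" using F by blast
    have "x * (emb f2 * c1 + emb (- f1) * c2) = 0"
      by (simp flip: f add: emb_minus algebra_simps)
    then have "f1 = 0" using indep[of f2 "- f1"] x by simp
    with f x have "emb 1 * c1 + emb 0 * c2 = 0" by simp
    from indep[OF this] show False by simp
  qed
  have "hyperbolic_on solid Q"
    unfolding Q_def
  proof (rule hyperbolic_onI)
    fix v assume "v \<in> solid" and zero: "g1 (V b1 c1 v) = 0" "g2 (V b2 c2 v) = 0"
      "- g2 (V b1 c1 v) = 0" "g1 (V b2 c2 v) = 0"
    then obtain x t where v: "v = \<beta> (x *s p + emb t *s e)" unfolding solid_def by blast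
    have F: "x * c1 - emb t * b1 \<in> range emb" "x * c2 - emb t * b2 \<in> range emb"
      using zero g_0[of "V b1 c1 v"] g_0[of "V b2 c2 v"] unfolding v V_def inv_\<beta> coord_simps by auto
    \<comment> \<open>Weight one at the affine points excludes a common zero with \<open>t\<close>
      nonzero, weight one at \<open>P_inf\<close> one with \<open>t = 0\<close> and \<open>x\<close>
      nonzero.\<close>
    have "t = 0"
    proof (rule ccontr)
      assume t: "t \<noteq> 0"
      have "(x * c1 - emb t * b1) / emb t = x / emb t * c1 - b1"
        "(x * c2 - emb t * b2) / emb t = x / emb t * c2 - b2"
        using t by (simp_all add: field_simps)
      then have "x / emb t * c1 - b1 \<in> range emb" "x / emb t * c2 - b2 \<in> range emb"
        using F range_emb_divide[of _ t] by metis+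
      with ns show False unfolding nonsplit_def by blast
    qed
    moreover from this F have "x = 0" using not_F by simp
    ultimately show "v = 0" using v by simp
  qed (simp_all add: subspace_solid card_solid V_add V_scale g_add g_scale)
  moreover have "nondegenerate_on \<pi> Q"
    unfolding nondegenerate_on_def
  proof (intro ballI impI)
    fix v assume "v \<in> \<pi>" and *: "Q v = 0 \<and> (\<forall>w\<in>\<pi>. polar Q w v = 0)"
    then obtain x where v: "v = \<beta> (x *s p)" unfolding \<pi>_def by blast
    have det: "g1 (x * c1) * g2 (x * c2) - g2 (x * c1) * g1 (x * c2) = 0"
      using * unfolding v Q_def V_\<pi> by simp
    have pol: "g1 (y * c1) * g2 (x * c2) + g1 (x * c1) * g2 (y * c2)
        - g2 (y * c1) * g1 (x * c2) - g2 (x * c1) * g1 (y * c2) = 0" for y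
    proof -
      have "\<beta> (y *s p) \<in> \<pi>" unfolding \<pi>_def by blast
      then have "polar Q (\<beta> (y *s p)) v = 0" using * by blast
      then show ?thesis
        unfolding v polar_def Q_def V_add V_\<pi> g_add by (simp add: algebra_simps)
    qed
    \<comment> \<open>Lying on the conic means that \<open>x * c\<close> is in \<open>'f\<close> for
      a nontrivial combination \<open>c\<close> of \<open>c1\<close> and \<open>c2\<close>.\<close>
    obtain m n where mn: "m \<noteq> 0 \<or> n \<noteq> 0"
      "m * g1 (x * c1) + n * g1 (x * c2) = 0" "m * g2 (x * c1) + n * g2 (x * c2) = 0"
      using det unfolding det2_eq_0_iff by blast
    define c where "c = emb m * c1 + emb n * c2"
    have c: "c \<noteq> 0" using indep[of m n] mn(1) unfolding c_def by auto
    have g_c: "m * g1 (y * c1) + n * g1 (y * c2) = g1 (y * c)"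
      "m * g2 (y * c1) + n * g2 (y * c2) = g2 (y * c)" for y
    proof -
      have "y * c = emb m * (y * c1) + emb n * (y * c2)" by (simp add: c_def algebra_simps)
      then show "m * g1 (y * c1) + n * g1 (y * c2) = g1 (y * c)"
        "m * g2 (y * c1) + n * g2 (y * c2) = g2 (y * c)"
        by (simp_all add: g_add g_scale)
    qed
    have "g1 (x * c1) * g2 z - g2 (x * c1) * g1 z = 0" "g1 (x * c2) * g2 z - g2 (x * c2) * g1 z = 0" for z
    proof -
      \<comment> \<open>Testing the polar form at \<open>z / c\<close> makes the combination of
        \<open>?y * c1\<close> and \<open>?y * c2\<close> an arbitrary \<open>z\<close>. Then
        \<open>x * c1\<close> and \<open>x * c2\<close> are proportional modulo \<open>'f\<close> to
        every \<open>z\<close>, so both vanish modulo \<open>'f\<close>.\<close>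
      let ?y = "z / c"
      have z: "g1 z = m * g1 (?y * c1) + n * g1 (?y * c2)" "g2 z = m * g2 (?y * c1) + n * g2 (?y * c2)"
        unfolding g_c using c by simp_all
      let ?A = "g1 (?y * c1)" and ?B = "g1 (?y * c2)" and ?C = "g2 (?y * c1)" and ?D = "g2 (?y * c2)"
      have "g1 (x * c1) * g2 z - g2 (x * c1) * g1 z
        = n * (?A * g2 (x * c2) + g1 (x * c1) * ?D - ?C * g1 (x * c2) - g2 (x * c1) * ?B)
        + ?C * (m * g1 (x * c1) + n * g1 (x * c2)) - ?A * (m * g2 (x * c1) + n * g2 (x * c2))"
        unfolding z by (simp add: algebra_simps)
      then show "g1 (x * c1) * g2 z - g2 (x * c1) * g1 z = 0"
        unfolding mn pol by simp
      have "g1 (x * c2) * g2 z - g2 (x * c2) * g1 z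
        = - m * (?A * g2 (x * c2) + g1 (x * c1) * ?D - ?C * g1 (x * c2) - g2 (x * c1) * ?B)
        + ?D * (m * g1 (x * c1) + n * g1 (x * c2)) - ?B * (m * g2 (x * c1) + n * g2 (x * c2))"
        unfolding z by (simp add: algebra_simps)
      then show "g1 (x * c2) * g2 z - g2 (x * c2) * g1 z = 0"
        unfolding mn pol by simp
    qed
    from this[of u] this[of "u\<^sup>2"] have "x * c1 \<in> range emb" "x * c2 \<in> range emb"
      by (simp_all add: g_u flip: g_0)
    with not_F v show "v = 0" by simp
  qed
  moreover have "X \<in> extended_quadric emb \<pi> Q" if X: "eigenpoint i X" for i X
  proof -
    \<comment> \<open>These are the minors of the conjugates of \<open>c1\<close> and
      \<open>c2\<close>. The constant \<open>\<Delta>\<close> below is the Vandermonde determinant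
      of the conjugates of \<open>u\<close>, the ratio between the two determinants.\<close>
    define k where "k = (\<lambda>i j. gal i c1 * gal j c2 - gal j c1 * gal i c2)"
    define \<Delta> where "\<Delta> = (\<theta> u - u) * (\<theta> (\<theta> u) - u) * (\<theta> (\<theta> u) - \<theta> u)"
    have \<Delta>: "\<Delta> \<noteq> 0"
      using u fixed_iff[of u] fixed_iff[of "\<theta> u"] \<theta>_\<theta>_neq[OF u]
      unfolding \<Delta>_def by (metis \<theta>_eq_iff mult_eq_0_iff right_minus_eq)
    define Q' where "Q' = (\<lambda>w. (k 1 2 * (\<xi> 1 w * \<xi> 2 w) - k 0 2 * (\<xi> 0 w * \<xi> 2 w)
      + k 0 1 * (\<xi> 0 w * \<xi> 1 w)) / \<Delta>)"
    have "quadratic_form_on (ext emb \<pi>) Q'"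
      unfolding quadratic_form_on_def polar_def Q'_def \<xi>_add \<xi>_scale
      using \<Delta> by (simp add: field_simps power2_eq_square)
    moreover have "Q' (ext_vec emb v) = emb (Q v)" if "v \<in> \<pi>" for v
    proof -
      obtain x where v: "v = \<beta> (x *s p)" using \<open>v \<in> \<pi>\<close> unfolding \<pi>_def by blast
      \<comment> \<open>The left side is the determinant with a row of ones and the rows of
        conjugates of \<open>y0\<close> and \<open>z0\<close>. Writing the rows through the
        conjugates of \<open>1, u, u^2\<close> splits off \<open>\<Delta>\<close>.\<close>
      have moore: "(y1 * z2 - y2 * z1) - (y0 * z2 - y2 * z0) + (y0 * z1 - y1 * z0)
          = emb (a1 * d2 - a2 * d1) * \<Delta>"
        if "y0 = emb a0 + emb a1 * u + emb a2 * u\<^sup>2" "z0 = emb d0 + emb d1 * u + emb d2 * u\<^sup>2"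
          "y1 = \<theta> y0" "z1 = \<theta> z0" "y2 = \<theta> y1" "z2 = \<theta> z1"
        for y0 y1 y2 z0 z1 z2 a0 a1 a2 d0 d1 d2
        unfolding that \<Delta>_def
        by (simp add: \<theta>_add \<theta>_mult \<theta>_power emb_diff emb_mult)
          (simp add: algebra_simps power2_eq_square)
      have "Q' (ext_vec emb v) * \<Delta>
        = (\<theta> (x * c1) * \<theta> (\<theta> (x * c2)) - \<theta> (\<theta> (x * c1)) * \<theta> (x * c2))
        - (x * c1 * \<theta> (\<theta> (x * c2)) - \<theta> (\<theta> (x * c1)) * (x * c2))
        + (x * c1 * \<theta> (x * c2) - \<theta> (x * c1) * (x * c2))"
      proof -
        have "Q' w * \<Delta> = k 1 2 * (\<xi> 1 w * \<xi> 2 w) - k 0 2 * (\<xi> 0 w * \<xi> 2 w)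
            + k 0 1 * (\<xi> 0 w * \<xi> 1 w)" for w
          using \<Delta> by (simp add: Q'_def)
        from this[of "ext_vec emb v"] show ?thesis
          unfolding v k_def \<xi>_ext_vec inv_\<beta> coord_simps
          by (simp add: eval_nat_numeral \<theta>_mult algebra_simps)
      qed
      also have "\<dots> = emb (g1 (x * c1) * g2 (x * c2) - g2 (x * c1) * g1 (x * c2)) * \<Delta>"
        by (rule moore[OF rep rep refl refl refl refl])
      also have "\<dots> = emb (Q v) * \<Delta>"
        unfolding v Q_def V_\<pi> by simp
      finally show ?thesis using \<Delta> by simp
    qed
    moreover have "X \<in> quadric (ext emb \<pi>) Q'"
    proof -
      have "Q' r = 0" if "r \<in> X" for r
      proof -
        have z: "\<xi> j r = 0" if "j mod 3 \<noteq> i mod 3" for j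
          using X \<open>r \<in> X\<close> that by (auto simp: eigenpoint_def)
        \<comment> \<open>Every term of \<open>Q'\<close> is a product of two different
          \<open>\<xi>\<close>, and at an eigenpoint at most one of the three is nonzero.\<close>
        have "\<xi> 1 r * \<xi> 2 r = 0" "\<xi> 0 r * \<xi> 2 r = 0" "\<xi> 0 r * \<xi> 1 r = 0"
          using z[of 0] z[of 1] z[of 2] by (cases "i mod 3 = 0"; cases "i mod 3 = 1"; simp)+
        then show ?thesis unfolding Q'_def by (simp only:) simp
      qed
      then show ?thesis using X by (auto simp: eigenpoint_def quadric_def)
    qed
    ultimately show ?thesis by (auto simp: extended_quadric_def)
  qed
  moreover have "Q (\<beta> (x *s p + e)) = 0 \<longleftrightarrow> x \<in> affine_part b1 b2 c1 c2" for x
  proof -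
    have combine: "emb m * (x * c1 - b1) + emb n * (x * c2 - b2)
        = x * (emb m * c1 + emb n * c2) - (emb m * b1 + emb n * b2)" for m n
      by (simp add: algebra_simps)
    have "Q (\<beta> (x *s p + e)) = 0 \<longleftrightarrow> (\<exists>m n. (m \<noteq> 0 \<or> n \<noteq> 0)
        \<and> m * g1 (x * c1 - b1) + n * g1 (x * c2 - b2) = 0
        \<and> m * g2 (x * c1 - b1) + n * g2 (x * c2 - b2) = 0)"
      unfolding Q_def V_affine det2_eq_0_iff[symmetric] by simp
    also have "\<dots> \<longleftrightarrow> (\<exists>m n. (m \<noteq> 0 \<or> n \<noteq> 0)
        \<and> emb m * (x * c1 - b1) + emb n * (x * c2 - b2) \<in> range emb)"
      by (simp flip: g_0 add: g_add g_scale)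
    finally show ?thesis unfolding affine_part_def combine by simp
  qed
  ultimately show thesis using that by blast
qed

end

section \<open>From quadrics to linear sets\<close>

context abb_frame
begin

text \<open>
  The plane \<open>\<pi>\<close> is the orthogonal complement of a vector \<open>n\<close>, and \<open>N = Q n \<noteq> 0\<close> because the
  conic is non-degenerate. The lines \<open>\<langle>a, c\<rangle>\<close> and \<open>\<langle>b, d\<rangle>\<close> of the quadric meet \<open>\<pi>\<close> in the points
  \<open>\<eta>\<^sub>1\<close> and \<open>\<eta>\<^sub>2\<close>, and these extend to a frame of the solid adapted to \<open>\<pi>\<close>.
\<close>

lemma hyperbolic_adapted_frame:
  assumes hyp: "hyperbolic_on solid Q" and nd: "nondegenerate_on \<pi> Q"
  obtains \<eta>1 \<eta>2 \<eta>3 \<phi> :: 'k and N :: 'f where "N \<noteq> 0"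
    "\<And>x. \<exists>a b c. x = emb a * \<eta>1 + emb b * \<eta>2 + emb c * \<eta>3"
    "\<And>a b c. emb a * \<eta>1 + emb b * \<eta>2 + emb c * \<eta>3 = 0 \<Longrightarrow> a = 0 \<and> b = 0 \<and> c = 0"
    "\<And>a b c. Q (\<beta> ((emb a * \<eta>1 + emb b * \<eta>2 + emb c * \<eta>3) *s p)) = a * b - c\<^sup>2 / N"
    "\<And>x. \<exists>a b c d. c + d * N = 1 \<and> x = emb a * \<eta>1 + emb b * \<eta>2 + \<phi> - emb (d * N) * \<eta>3 \<and>
      Q (\<beta> (x *s p + e)) = a * b + c * d"
proof -
  obtain a b c d where span: "vec.span {a, b, c, d} = solid"
    and Q: "\<And>x y z w. Q (x *s a + y *s b + z *s c + w *s d) = x * y + z * w"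
    using hyp unfolding hyperbolic_on_def by blast
  have "a \<in> solid" "b \<in> solid" "c \<in> solid" "d \<in> solid"
    unfolding span[symmetric] by (auto intro: vec.span_base)
  then obtain A B C D s1 s2 s3 s4 where coords:
    "a = \<beta> (A *s p + emb s1 *s e)" "b = \<beta> (B *s p + emb s2 *s e)"
    "c = \<beta> (C *s p + emb s3 *s e)" "d = \<beta> (D *s p + emb s4 *s e)"
    unfolding solid_def by auto
  have comb: "x *s a + y *s b + z *s c + w *s d = \<beta> ((emb x * A + emb y * B + emb z * C + emb w * D) *s p
      + emb (x * s1 + y * s2 + z * s3 + w * s4) *s e)" for x y z w
    unfolding coords by (simp flip: \<beta>_scale \<beta>_add add: emb_add emb_mult algebra_simps)
  have Q': "Q (\<beta> ((emb x * A + emb y * B + emb z * C + emb w * D) *s p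
      + emb (x * s1 + y * s2 + z * s3 + w * s4) *s e)) = x * y + z * w" for x y z w
    unfolding comb[symmetric] by (rule Q)
  have surj: "\<exists>x y z w. X = emb x * A + emb y * B + emb z * C + emb w * D
      \<and> t = x * s1 + y * s2 + z * s3 + w * s4" for X t
  proof -
    have "\<beta> (X *s p + emb t *s e) \<in> vec.span {a, b, c, d}" unfolding span by simp
    then obtain x where "\<beta> (X *s p + emb t *s e) - x *s a \<in> vec.span {b, c, d}"
      using vec.span_breakdown_eq[of _ a "{b, c, d}"] by blast
    then obtain y z w where "\<beta> (X *s p + emb t *s e) - x *s a = y *s b + z *s c + w *s d"
      by (auto simp: mem_span_three)
    then have "\<beta> (X *s p + emb t *s e) = x *s a + y *s b + z *s c + w *s d"
      by (simp add: algebra_simps)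
    then have "X *s p + emb t *s e = (emb x * A + emb y * B + emb z * C + emb w * D) *s p
      + emb (x * s1 + y * s2 + z * s3 + w * s4) *s e"
      unfolding comb by simp
    then have "X = emb x * A + emb y * B + emb z * C + emb w * D"
      "emb t = emb (x * s1 + y * s2 + z * s3 + w * s4)" by (metis coord_simps(1,2))+
    then show ?thesis by auto
  qed
  \<comment> \<open>A vanishing combination can be added to any argument without changing
    \<open>Q\<close>; comparing values at the unit vectors shows that its coefficients are
    zero.\<close>
  have unique: "x = 0 \<and> y = 0 \<and> z = 0 \<and> w = 0"
    if "x *s a + y *s b + z *s c + w *s d = 0" for x y z w
  proof -
    have add: "(x + x') *s a + (y + y') *s b + (z + z') *s c + (w + w') *s d
        = x' *s a + y' *s b + z' *s c + w' *s d" for x' y' z' w'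
    proof -
      have "(x + x') *s a + (y + y') *s b + (z + z') *s c + (w + w') *s d
        = (x *s a + y *s b + z *s c + w *s d) + (x' *s a + y' *s b + z' *s c + w' *s d)"
        by (simp add: algebra_simps)
      then show ?thesis using that by simp
    qed
    have "(x + x') * (y + y') + (z + z') * (w + w') = x' * y' + z' * w'" for x' y' z' w'
      using arg_cong[OF add[of x' y' z' w'], of Q] unfolding Q .
    from this[of 0 0 0 0] this[of 1 0 0 0] this[of 0 1 0 0] this[of 0 0 1 0] this[of 0 0 0 1]
    show ?thesis by (auto simp: algebra_simps)
  qed
  define N where "N = s1 * s2 + s3 * s4"
  have N: "N \<noteq> 0"
  proof
    assume N0: "N = 0"
    \<comment> \<open>Swapping the coefficients within each hyperbolic pair makes the polar form
      with \<open>n\<close> equal to the \<open>e\<close>-coordinate, which vanishes on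
      \<open>\<pi>\<close>. The \<open>e\<close>-coordinate of \<open>n\<close> itself is
      \<open>N + N\<close>, so \<open>N = 0\<close> would make \<open>n\<close> a singular vector of
      the plane.\<close>
    define n where "n = s2 *s a + s1 *s b + s4 *s c + s3 *s d"
    have sum: "s2 * s1 + s1 * s2 + s4 * s3 + s3 * s4 = N + N" by (simp add: N_def algebra_simps)
    have "n = \<beta> ((emb s2 * A + emb s1 * B + emb s4 * C + emb s3 * D) *s p)"
      unfolding n_def comb sum N0 by simp
    then have "n \<in> \<pi>" unfolding \<pi>_def by blast
    moreover have "Q n = 0" unfolding n_def Q using N0 by (simp add: N_def algebra_simps)
    moreover have "polar Q v n = 0" if v_mem: "v \<in> \<pi>" for v
    proof -
      obtain X where X: "v = \<beta> (X *s p)" using v_mem unfolding \<pi>_def by blast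
      obtain x y z w where xyzw: "X = emb x * A + emb y * B + emb z * C + emb w * D"
        "0 = x * s1 + y * s2 + z * s3 + w * s4"
        using surj[of X 0] by blast
      have v: "v = x *s a + y *s b + z *s c + w *s d"
        unfolding comb by (simp flip: xyzw add: X)
      have "v + n = (x + s2) *s a + (y + s1) *s b + (z + s4) *s c + (w + s3) *s d"
        unfolding v n_def by (simp add: algebra_simps)
      then have "polar Q v n = (x + s2) * (y + s1) + (z + s4) * (w + s3) - (x * y + z * w) - (s2 * s1 + s4 * s3)"
        unfolding polar_def v n_def by (simp only: Q)
      also have "\<dots> = x * s1 + y * s2 + z * s3 + w * s4" by (simp add: algebra_simps)
      finally show ?thesis using xyzw(2) by simp
    qed
    ultimately have "n = 0" using nd unfolding nondegenerate_on_def by blast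
    with unique[of s2 s1 s4 s3] have "s1 = 0" "s2 = 0" "s3 = 0" "s4 = 0" unfolding n_def by auto
    with surj[of 0 1] show False by auto
  qed
  \<comment> \<open>These are the \<open>p\<close>-coordinates of four vectors that again form a
    hyperbolic frame, with the dual pairs \<open>\<eta>1, \<eta>2\<close> and
    \<open>\<phi>, F2\<close>. Their \<open>e\<close>-coordinates are \<open>0, 0, 1, N\<close>, so
    \<open>\<eta>1\<close>, \<open>\<eta>2\<close> and \<open>\<phi> - F2 / N\<close> belong to
    \<open>\<pi>\<close>.\<close>
  define \<eta>1 \<eta>2 \<phi> F2 where "\<eta>1 = emb s3 * A - emb s1 * C" and "\<eta>2 = (emb s4 * B - emb s2 * D) / emb N"
    and "\<phi> = (emb s2 * A + emb s4 * C) / emb N" and "F2 = emb s1 * B + emb s3 * D"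
  define \<eta>3 where "\<eta>3 = \<phi> - F2 / emb N"
  have adapted: "emb \<alpha> * \<eta>1 + emb \<gamma> * \<eta>2 + emb \<mu> * \<phi> + emb \<nu> * F2
      = emb (\<alpha> * s3 + \<mu> * s2 / N) * A + emb (\<gamma> * s4 / N + \<nu> * s1) * B
      + emb (\<mu> * s4 / N - \<alpha> * s1) * C + emb (\<nu> * s3 - \<gamma> * s2 / N) * D" for \<alpha> \<gamma> \<mu> \<nu>
    unfolding \<eta>1_def \<eta>2_def \<phi>_def F2_def emb_add emb_diff emb_mult emb_divide
    by (simp add: diff_divide_distrib add_divide_distrib algebra_simps)
  have adapted_t: "(\<alpha> * s3 + \<mu> * s2 / N) * s1 + (\<gamma> * s4 / N + \<nu> * s1) * s2
      + (\<mu> * s4 / N - \<alpha> * s1) * s3 + (\<nu> * s3 - \<gamma> * s2 / N) * s4 = \<mu> + \<nu> * N" for \<alpha> \<gamma> \<mu> \<nu>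
  proof -
    have "(\<alpha> * s3 + \<mu> * s2 / N) * s1 + (\<gamma> * s4 / N + \<nu> * s1) * s2
      + (\<mu> * s4 / N - \<alpha> * s1) * s3 + (\<nu> * s3 - \<gamma> * s2 / N) * s4 
        = \<mu> * ((s1 * s2 + s3 * s4) / N) + \<nu> * (s1 * s2 + s3 * s4)"
      by (simp add: add_divide_distrib algebra_simps)
    with N show ?thesis by (simp flip: N_def)
  qed
  have Q_adapted: "Q (\<beta> ((emb \<alpha> * \<eta>1 + emb \<gamma> * \<eta>2 + emb \<mu> * \<phi> + emb \<nu> * F2) *s p
      + emb (\<mu> + \<nu> * N) *s e)) = \<alpha> * \<gamma> + \<mu> * \<nu>" for \<alpha> \<gamma> \<mu> \<nu>
  proof -
    have "Q (\<beta> ((emb \<alpha> * \<eta>1 + emb \<gamma> * \<eta>2 + emb \<mu> * \<phi> + emb \<nu> * F2) *s p + emb (\<mu> + \<nu> * N) *s e))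
      = (\<alpha> * s3 + \<mu> * s2 / N) * (\<gamma> * s4 / N + \<nu> * s1) + (\<mu> * s4 / N - \<alpha> * s1) * (\<nu> * s3 - \<gamma> * s2 / N)"
      unfolding adapted adapted_t[of \<alpha> \<mu> \<gamma> \<nu>, symmetric] by (rule Q')
    also have "\<dots> = (\<alpha> * \<gamma> + \<mu> * \<nu>) * ((s1 * s2 + s3 * s4) / N)"
      by (simp add: add_divide_distrib diff_divide_distrib algebra_simps)
    finally show ?thesis using N by (simp flip: N_def)
  qed
  have surj_adapted: "\<exists>\<alpha> \<gamma> \<mu> \<nu>. X = emb \<alpha> * \<eta>1 + emb \<gamma> * \<eta>2 + emb \<mu> * \<phi> + emb \<nu> * F2
      \<and> t = \<mu> + \<nu> * N" for X t
  proof -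
    obtain x y z w where X: "X = emb x * A + emb y * B + emb z * C + emb w * D"
      and t: "t = x * s1 + y * s2 + z * s3 + w * s4"
      using surj[of X t] by blast
    \<comment> \<open>Each new coordinate is the polar form with the dual vector of its
      pair.\<close>
    let ?\<alpha> = "(x * s4 - z * s2) / N" and ?\<gamma> = "y * s3 - w * s1" and ?\<mu> = "x * s1 + z * s3"
      and ?\<nu> = "(y * s2 + w * s4) / N"
    have "?\<alpha> * s3 + ?\<mu> * s2 / N = x * ((s1 * s2 + s3 * s4) / N)" "?\<gamma> * s4 / N + ?\<nu> * s1 = y * ((s1 * s2 + s3 * s4) / N)"
      "?\<mu> * s4 / N - ?\<alpha> * s1 = z * ((s1 * s2 + s3 * s4) / N)" "?\<nu> * s3 - ?\<gamma> * s2 / N = w * ((s1 * s2 + s3 * s4) / N)"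
      by (simp_all add: add_divide_distrib diff_divide_distrib algebra_simps)
    then have "X = emb ?\<alpha> * \<eta>1 + emb ?\<gamma> * \<eta>2 + emb ?\<mu> * \<phi> + emb ?\<nu> * F2"
      unfolding adapted X using N by (simp flip: N_def)
    moreover have "t = ?\<mu> + ?\<nu> * N" using N t by simp
    ultimately show ?thesis by blast
  qed
  have F2: "F2 = emb N * (\<phi> - \<eta>3)" using N by (simp add: \<eta>3_def)
  have in_\<pi>: "emb \<alpha> * \<eta>1 + emb \<gamma> * \<eta>2 + emb \<mu> * \<eta>3
      = emb \<alpha> * \<eta>1 + emb \<gamma> * \<eta>2 + emb \<mu> * \<phi> + emb (- \<mu> / N) * F2" for \<alpha> \<gamma> \<mu>
    using N by (simp add: \<eta>3_def emb_divide emb_minus algebra_simps)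
  have Q_\<pi>: "Q (\<beta> ((emb \<alpha> * \<eta>1 + emb \<gamma> * \<eta>2 + emb \<mu> * \<eta>3) *s p)) = \<alpha> * \<gamma> - \<mu>\<^sup>2 / N" for \<alpha> \<gamma> \<mu>
  proof -
    have "\<mu> + - \<mu> / N * N = 0" using N by simp
    from Q_adapted[of \<alpha> \<gamma> \<mu> "- \<mu> / N", unfolded this] show ?thesis
      unfolding in_\<pi> by (simp only: emb_0 vec.scale_zero_left add_0_right) (simp add: power2_eq_square)
  qed
  show thesis
  proof (rule that[of N \<eta>1 \<eta>2 \<eta>3 \<phi>])
    show "N \<noteq> 0" by (rule N)
    show "Q (\<beta> ((emb a * \<eta>1 + emb b * \<eta>2 + emb c * \<eta>3) *s p)) = a * b - c\<^sup>2 / N" for a b c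
      by (rule Q_\<pi>)
    show "\<exists>a b c. x = emb a * \<eta>1 + emb b * \<eta>2 + emb c * \<eta>3" for x
    proof -
      obtain \<alpha> \<gamma> \<mu> \<nu> where *: "x = emb \<alpha> * \<eta>1 + emb \<gamma> * \<eta>2 + emb \<mu> * \<phi> + emb \<nu> * F2"
        "0 = \<mu> + \<nu> * N" using surj_adapted[of x 0] by blast
      then have "\<nu> * N = - \<mu>" by (simp add: eq_neg_iff_add_eq_0 add.commute)
      then have "\<nu> = - \<mu> / N" using N by (metis nonzero_mult_div_cancel_right)
      with *(1) have "x = emb \<alpha> * \<eta>1 + emb \<gamma> * \<eta>2 + emb \<mu> * \<eta>3" by (simp only: in_\<pi>)
      then show ?thesis by blast
    qed
    show "a = 0 \<and> b = 0 \<and> c = 0" if zero: "emb a * \<eta>1 + emb b * \<eta>2 + emb c * \<eta>3 = 0" for a b c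
    proof -
      have "(a + a') * (b + b') - (c + c')\<^sup>2 / N = a' * b' - c'\<^sup>2 / N" for a' b' c'
      proof -
        have "emb (a + a') * \<eta>1 + emb (b + b') * \<eta>2 + emb (c + c') * \<eta>3
          = (emb a * \<eta>1 + emb b * \<eta>2 + emb c * \<eta>3) + (emb a' * \<eta>1 + emb b' * \<eta>2 + emb c' * \<eta>3)"
          by (simp add: emb_add algebra_simps)
        then show ?thesis unfolding Q_\<pi>[symmetric] zero by simp
      qed
      from this[of 0 0 0] this[of 1 0 0] this[of 0 1 0]
      show ?thesis using N by (simp add: algebra_simps)
    qed
    show "\<exists>a b c d. c + d * N = 1 \<and> x = emb a * \<eta>1 + emb b * \<eta>2 + \<phi> - emb (d * N) * \<eta>3 \<and>
      Q (\<beta> (x *s p + e)) = a * b + c * d" for x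
    proof -
      obtain \<alpha> \<gamma> \<mu> \<nu> where *: "x = emb \<alpha> * \<eta>1 + emb \<gamma> * \<eta>2 + emb \<mu> * \<phi> + emb \<nu> * F2"
        "1 = \<mu> + \<nu> * N" using surj_adapted[of x 1] by blast
      have "emb \<mu> * \<phi> + emb \<nu> * F2 = emb (\<mu> + \<nu> * N) * \<phi> - emb (\<nu> * N) * \<eta>3"
        unfolding F2 emb_add emb_mult by (simp add: algebra_simps)
      also have "\<dots> = \<phi> - emb (\<nu> * N) * \<eta>3" by (simp flip: *(2))
      finally have "x = emb \<alpha> * \<eta>1 + emb \<gamma> * \<eta>2 + \<phi> - emb (\<nu> * N) * \<eta>3"
        unfolding *(1) by (simp add: algebra_simps)
      moreover have "Q (\<beta> (x *s p + e)) = \<alpha> * \<gamma> + \<mu> * \<nu>"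
        using Q_adapted[of \<alpha> \<gamma> \<mu> \<nu>]
        by (simp only: *(1)[symmetric] *(2)[symmetric] emb_1 vec.scale_one)
      ultimately show ?thesis using *(2) by metis
    qed
  qed
qed

text \<open>
  The coordinates \<open>r\<^sub>j\<close> of \<open>R\<close> are orthogonal to two of the conjugates of \<open>(\<eta>\<^sub>1, \<eta>\<^sub>2, \<eta>\<^sub>3)\<close>; hence
  a suitable conjugate \<open>u\<close> of \<open>r\<^sub>1 / r\<^sub>3\<close> is such that \<open>\<theta> u\<close> and \<open>\<theta>\<^sup>2 u\<close> are the roots of
  \<open>\<eta>\<^sub>1 X\<^sup>2 + \<eta>\<^sub>3 X + \<eta>\<^sub>2 / N\<close>.
\<close>

lemma eigenpoint_on_quadric:
  assumes N: "N \<noteq> 0"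
    and surj: "\<And>x. \<exists>a b c. x = emb a * \<eta>1 + emb b * \<eta>2 + emb c * \<eta>3"
    and indep: "\<And>a b c. emb a * \<eta>1 + emb b * \<eta>2 + emb c * \<eta>3 = 0 \<Longrightarrow> a = 0 \<and> b = 0 \<and> c = 0"
    and Q: "\<And>a b c. Q (\<beta> ((emb a * \<eta>1 + emb b * \<eta>2 + emb c * \<eta>3) *s p)) = a * b - c\<^sup>2 / N"
    and R: "eigenpoint i R" "R \<in> extended_quadric emb \<pi> Q"
  obtains u where "u \<notin> range emb" "\<eta>3 = - \<eta>1 * (\<theta> u + \<theta> (\<theta> u))" "\<eta>2 = emb N * \<eta>1 * \<theta> u * \<theta> (\<theta> u)"
proof -
  define E where "E = (\<lambda>\<eta>. ext_vec emb (\<beta> (\<eta> *s p)))"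
  have E_mem: "E \<eta> \<in> ext emb \<pi>" for \<eta>
    unfolding E_def \<pi>_def by (intro ext_vec_mem) blast
  have \<xi>_E: "\<xi> j (E \<eta>) = gal j \<eta>" for j \<eta>
    by (simp add: E_def)
  have E_comb: "E (emb a * \<eta>1 + emb b * \<eta>2 + emb c * \<eta>3) = emb a *s E \<eta>1 + emb b *s E \<eta>2 + emb c *s E \<eta>3"
    for a b c
  proof -
    have "(emb a * \<eta>1 + emb b * \<eta>2 + emb c * \<eta>3) *s p
      = emb a *s (\<eta>1 *s p) + emb b *s (\<eta>2 *s p) + emb c *s (\<eta>3 *s p)"
      by (simp add: algebra_simps)
    then show ?thesis unfolding E_def by (simp only: \<beta>_add \<beta>_scale ext_vec_add ext_vec_scale)
  qed
  have \<eta>_nonzero: "\<eta>1 \<noteq> 0" "\<eta>2 \<noteq> 0"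
    using indep[of 1 0 0] indep[of 0 1 0] by auto
  obtain r where r: "r \<in> ext emb \<pi>" "r \<noteq> 0" "R = vec.span {r}"
    using R(1) by (auto simp: eigenpoint_def elim: ppoints_E)
  have rR: "r \<in> R" using r by (auto intro: vec.span_base)
  obtain Q' where Q': "quadratic_form_on (ext emb \<pi>) Q'"
    "\<And>v. v \<in> \<pi> \<Longrightarrow> Q' (ext_vec emb v) = emb (Q v)" "Q' r = 0"
    using R(2) rR by (auto simp: extended_quadric_def quadric_def)
  have "ext emb \<pi> \<subseteq> vec.span {E \<eta>1, E \<eta>2, E \<eta>3}"
    unfolding ext_def
  proof (rule vec.span_minimal)
    show "ext_vec emb ` \<pi> \<subseteq> vec.span {E \<eta>1, E \<eta>2, E \<eta>3}"
    proof
      fix v assume "v \<in> ext_vec emb ` \<pi>"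
      then obtain x where "v = E x" unfolding \<pi>_def E_def by blast
      moreover obtain a b c where "x = emb a * \<eta>1 + emb b * \<eta>2 + emb c * \<eta>3" using surj by blast
      ultimately have "v = emb a *s E \<eta>1 + emb b *s E \<eta>2 + emb c *s E \<eta>3"
        by (simp only: E_comb)
      then show "v \<in> vec.span {E \<eta>1, E \<eta>2, E \<eta>3}"
        unfolding mem_span_three by blast
    qed
  qed simp
  then obtain r1 r2 r3 where r_eq: "r = r1 *s E \<eta>1 + r2 *s E \<eta>2 + r3 *s E \<eta>3"
    using r(1) mem_span_three by blast
  have Q'_E: "Q' (emb a *s E \<eta>1 + emb b *s E \<eta>2 + emb c *s E \<eta>3) = emb (a * b - c\<^sup>2 / N)" for a b c
    unfolding E_comb[symmetric] unfolding E_def Q[symmetric]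
    unfolding \<pi>_def by (intro Q'(2)[unfolded \<pi>_def]) blast
  have "Q' (E \<eta>1) = 0" "Q' (E \<eta>2) = 0" "Q' (E \<eta>3) = emb (- 1 / N)"
    using Q'_E[of 1 0 0] Q'_E[of 0 1 0] Q'_E[of 0 0 1] by simp_all
  moreover have "polar Q' (E \<eta>1) (E \<eta>2) = 1" "polar Q' (E \<eta>1) (E \<eta>3) = 0" "polar Q' (E \<eta>2) (E \<eta>3) = 0"
    using Q'_E[of 1 1 0] Q'_E[of 1 0 1] Q'_E[of 0 1 1] calculation by (simp_all add: polar_def)
  ultimately have "r1 * r2 - r3\<^sup>2 * emb (1 / N) = 0"
    using Q'(3) unfolding r_eq quadratic_form_on_expand[OF Q'(1) subspace_ext E_mem E_mem E_mem]
    by (simp add: emb_minus emb_divide)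
  then have conic: "r1 * r2 = r3\<^sup>2 * emb (1 / N)" by simp
  have r_orth: "r1 * gal j \<eta>1 + r2 * gal j \<eta>2 + r3 * gal j \<eta>3 = 0" if "j mod 3 \<noteq> i mod 3" for j
  proof -
    have "\<xi> j r = 0" using R(1) rR that by (auto simp: eigenpoint_def)
    then show ?thesis unfolding r_eq by (simp only: \<xi>_add \<xi>_scale \<xi>_E)
  qed
  \<comment> \<open>Applying \<open>\<theta>\<close> another \<open>2 * i\<close> times moves the
    index \<open>i\<close> to \<open>3 * i\<close>, that is to 0; the new coordinates are orthogonal
    to the conjugates with indices 1 and 2.\<close>
  define t1 t2 t3 where "t1 = gal (2 * i) r1" and "t2 = gal (2 * i) r2" and "t3 = gal (2 * i) r3"
  have t_orth: "t1 * gal j \<eta>1 + t2 * gal j \<eta>2 + t3 * gal j \<eta>3 = 0" if j: "j mod 3 \<noteq> 0" for j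
  proof -
    have "(i + j) mod 3 \<noteq> i mod 3" using j by presburger
    from arg_cong[OF r_orth[OF this], of "gal (2 * i)"]
    have "t1 * gal (2 * i + (i + j)) \<eta>1 + t2 * gal (2 * i + (i + j)) \<eta>2 + t3 * gal (2 * i + (i + j)) \<eta>3 = 0"
      by (simp only: gal_add gal_mult gal_gal gal_0 t1_def t2_def t3_def)
    moreover have "gal (2 * i + (i + j)) = gal j"
    proof -
      have "(2 * i + (i + j)) mod 3 = j mod 3" by presburger
      then show ?thesis by (metis gal_mod_3)
    qed
    ultimately show ?thesis by simp
  qed
  have t_conic: "t1 * t2 = t3\<^sup>2 * emb (1 / N)"
    using arg_cong[OF conic, of "gal (2 * i)"]
    by (simp add: gal_mult t1_def t2_def t3_def power2_eq_square)
  have t_nonzero: "t1 \<noteq> 0 \<or> t2 \<noteq> 0 \<or> t3 \<noteq> 0"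
    using r(2) unfolding r_eq t1_def t2_def t3_def by auto
  have t3: "t3 \<noteq> 0"
  proof
    assume "t3 = 0"
    with t_conic have "t1 = 0 \<or> t2 = 0" by simp
    with t_orth[of 1] \<open>t3 = 0\<close> \<eta>_nonzero t_nonzero show False by auto
  qed
  have t1: "t1 \<noteq> 0" using t_conic t3 N by auto
  define u where "u = t1 / t3"
  have u: "u \<noteq> 0" using t1 t3 by (simp add: u_def)
  \<comment> \<open>The orthogonality relation times \<open>t1\<close>, with \<open>t1 * t2\<close>
    replaced through the conic equation, is a quadratic equation for \<open>u\<close>. Applying
    \<open>\<theta>\<close> afterwards moves the conjugation from the coefficients to the
    root.\<close>
  have root: "(gal j \<eta>1) * u\<^sup>2 + gal j \<eta>3 * u + gal j \<eta>2 * emb (1 / N) = 0" if "j mod 3 \<noteq> 0" for j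
  proof -
    have "t3\<^sup>2 * (gal j \<eta>1 * u\<^sup>2 + gal j \<eta>3 * u + gal j \<eta>2 * emb (1 / N))
      = t1 * (t1 * gal j \<eta>1 + t2 * gal j \<eta>2 + t3 * gal j \<eta>3)"
    proof -
      have "t1 = u * t3" using t3 by (simp add: u_def)
      moreover have "t1 * (t2 * gal j \<eta>2) = t3\<^sup>2 * emb (1 / N) * gal j \<eta>2"
        by (simp flip: t_conic)
      ultimately show ?thesis by (auto simp: algebra_simps power2_eq_square)
    qed
    with t_orth[OF that] t3 show ?thesis by simp
  qed
  have root1: "\<eta>1 * (\<theta> u)\<^sup>2 + \<eta>3 * \<theta> u + \<eta>2 * emb (1 / N) = 0"
    using arg_cong[OF root[of 2], of \<theta>] by (simp add: gal_2 \<theta>_add \<theta>_mult \<theta>_power)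
  have root2: "\<eta>1 * (\<theta> (\<theta> u))\<^sup>2 + \<eta>3 * \<theta> (\<theta> u) + \<eta>2 * emb (1 / N) = 0"
    using arg_cong[OF root[of 1], of "\<lambda>x. \<theta> (\<theta> x)"] by (simp add: \<theta>_add \<theta>_mult \<theta>_power)
  have u_range: "u \<notin> range emb"
  proof
    assume "u \<in> range emb"
    then obtain a where a: "u = emb a" by blast
    have "emb (a\<^sup>2) * \<eta>1 + emb (1 / N) * \<eta>2 + emb a * \<eta>3 = 0"
      using root1 by (simp add: a emb_power algebra_simps)
    from indep[OF this] N show False by simp
  qed
  have d: "\<theta> (\<theta> u) - \<theta> u \<noteq> 0" using u_range fixed_iff[of u] by simp
  have "(\<theta> (\<theta> u) - \<theta> u) * (\<eta>1 * (\<theta> u + \<theta> (\<theta> u)) + \<eta>3)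
      = (\<eta>1 * (\<theta> (\<theta> u))\<^sup>2 + \<eta>3 * \<theta> (\<theta> u) + \<eta>2 * emb (1 / N)) - (\<eta>1 * (\<theta> u)\<^sup>2 + \<eta>3 * \<theta> u + \<eta>2 * emb (1 / N))"
    by (simp add: algebra_simps power2_eq_square)
  with d root1 root2 have "\<eta>1 * (\<theta> u + \<theta> (\<theta> u)) + \<eta>3 = 0" by simp
  then have \<eta>3: "\<eta>3 = - \<eta>1 * (\<theta> u + \<theta> (\<theta> u))"
    by (metis add.commute eq_neg_iff_add_eq_0 mult_minus_left)
  have "\<eta>2 * emb (1 / N) = \<eta>1 * \<theta> u * \<theta> (\<theta> u)"
  proof -
    have "\<eta>2 * emb (1 / N) - \<eta>1 * \<theta> u * \<theta> (\<theta> u) = \<eta>1 * (\<theta> u)\<^sup>2 + \<eta>3 * \<theta> u + \<eta>2 * emb (1 / N)"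
      unfolding \<eta>3 by (simp add: algebra_simps power2_eq_square)
    with root1 show ?thesis by simp
  qed
  then have "\<eta>2 = emb N * \<eta>1 * \<theta> u * \<theta> (\<theta> u)"
    using N by (simp add: emb_divide field_simps)
  with u_range \<eta>3 show thesis by (rule that)
qed

text \<open>The choice \<open>c1 = 1 / \<eta>1\<close>, \<open>c2 = u / \<eta>1\<close> comes from
  the conic. With \<open>emb\<close> suppressed, the inverse of \<open>m c1 + n c2\<close> times the
  norm of \<open>m + n u\<close> is
  \<open>\<eta>1 * \<theta> (m + n u) * \<theta> (\<theta> (m + n u))\<close>, which expands to
  \<open>m^2 \<eta>1 + (n^2 / N) \<eta>2 - m n \<eta>3\<close>, a zero of \<open>Q\<close>.\<close>

lemma hyperbolic_imp_nonsplit: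
  assumes hyp: "hyperbolic_on solid Q" and nd: "nondegenerate_on \<pi> Q"
    and R: "eigenpoint i R" "R \<in> extended_quadric emb \<pi> Q"
  obtains b1 b2 c1 c2 where "nonsplit b1 b2 c1 c2"
    "{x. Q (\<beta> (x *s p + e)) = 0} = affine_part b1 b2 c1 c2"
proof -
  obtain \<eta>1 \<eta>2 \<eta>3 \<phi> N where N: "N \<noteq> 0"
    and surj: "\<And>x. \<exists>a b c. x = emb a * \<eta>1 + emb b * \<eta>2 + emb c * \<eta>3"
    and indep: "\<And>a b c. emb a * \<eta>1 + emb b * \<eta>2 + emb c * \<eta>3 = 0 \<Longrightarrow> a = 0 \<and> b = 0 \<and> c = 0"
    and Q_\<pi>: "\<And>a b c. Q (\<beta> ((emb a * \<eta>1 + emb b * \<eta>2 + emb c * \<eta>3) *s p)) = a * b - c\<^sup>2 / N"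
    and Q_affine: "\<And>x. \<exists>a b c d. c + d * N = 1 \<and> x = emb a * \<eta>1 + emb b * \<eta>2 + \<phi> - emb (d * N) * \<eta>3 \<and>
      Q (\<beta> (x *s p + e)) = a * b + c * d"
    by (rule hyperbolic_adapted_frame[OF hyp nd]) (rule that)
  obtain u where u: "u \<notin> range emb"
    and \<eta>3: "\<eta>3 = - \<eta>1 * (\<theta> u + \<theta> (\<theta> u))" and \<eta>2: "\<eta>2 = emb N * \<eta>1 * \<theta> u * \<theta> (\<theta> u)"
    by (rule eigenpoint_on_quadric[OF N surj indep Q_\<pi> R])
  have \<eta>1: "\<eta>1 \<noteq> 0" using indep[of 1 0 0] by auto
  let ?u1 = "\<theta> u" and ?u2 = "\<theta> (\<theta> u)"
  obtain e1 where e1: "u + ?u1 + ?u2 = emb e1"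
    using fixed_iff[of "u + ?u1 + ?u2"] by (auto simp: \<theta>_add algebra_simps)
  obtain e2 where e2: "u * ?u1 + u * ?u2 + ?u1 * ?u2 = emb e2"
    using fixed_iff[of "u * ?u1 + u * ?u2 + ?u1 * ?u2"] by (auto simp: \<theta>_add \<theta>_mult algebra_simps)
  obtain e3 where e3: "u * ?u1 * ?u2 = emb e3"
    using fixed_iff[of "u * ?u1 * ?u2"] by (auto simp: \<theta>_mult algebra_simps)
  have u12: "?u1 * ?u2 = emb e2 + emb (- e1) * u + emb 1 * u\<^sup>2"
    unfolding emb_minus e1[symmetric] e2[symmetric] by (simp add: algebra_simps power2_eq_square)
  \<comment> \<open>\<open>1\<close>, \<open>u\<close> and \<open>?u1 * ?u2\<close> form a basis of
    \<open>'k\<close> over \<open>'f\<close>, so membership in \<open>'f\<close> is read off from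
    the coefficients.\<close>
  have in_F: "emb a + emb b * u + emb c * (?u1 * ?u2) \<in> range emb \<longleftrightarrow> b = 0 \<and> c = 0" for a b c
  proof
    assume "emb a + emb b * u + emb c * (?u1 * ?u2) \<in> range emb"
    then obtain s where "emb a + emb b * u + emb c * (?u1 * ?u2) = emb s" by blast
    then have "emb (a + c * e2 - s) + emb (b - c * e1) * u + emb c * u\<^sup>2 = 0"
      unfolding u12 by (simp add: emb_add emb_diff emb_mult emb_minus algebra_simps)
    from quadratic_independent[OF u this] show "b = 0 \<and> c = 0" by simp
  qed auto
  \<comment> \<open>Two lines of the quadric determine \<open>b1\<close> and \<open>b2\<close>: in
    the coordinates of \<open>Q_affine\<close>, \<open>x * c1 - b1\<close> is in \<open>'f\<close>
    exactly for \<open>b = c = 0\<close>, and \<open>x * c2 - b2\<close> exactly for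
    \<open>a = d = 0\<close>.\<close>
  define b1 b2 c1 c2 where "b1 = (\<phi> - \<eta>3) / \<eta>1" and "b2 = u * \<phi> / \<eta>1"
    and "c1 = 1 / \<eta>1" and "c2 = u / \<eta>1"
  have key: "\<exists>a b c d. c + d * N = 1 \<and> Q (\<beta> (x *s p + e)) = a * b + c * d \<and>
      (\<forall>m n. x * (emb m * c1 + emb n * c2) - (emb m * b1 + emb n * b2) \<in> range emb
        \<longleftrightarrow> m * c + n * a = 0 \<and> m * b + n * (- d) = 0)" for x
  proof -
    obtain a b c d where cd: "c + d * N = 1"
      and x: "x = emb a * \<eta>1 + emb b * \<eta>2 + \<phi> - emb (d * N) * \<eta>3"
      and Qx: "Q (\<beta> (x *s p + e)) = a * b + c * d"
      using Q_affine by blast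
    have "x * (emb m * c1 + emb n * c2) - (emb m * b1 + emb n * b2)
        = emb (m * a + n * b * N * e3 - m * c * e1 + n * d * N * e2)
          + emb (m * c + n * a) * u + emb (N * (m * b - n * d)) * (?u1 * ?u2)" for m n
    proof -
      have 1: "emb c + emb d * emb N = 1"
        using arg_cong[OF cd, of emb] by (simp add: emb_add emb_mult)
      have "x * (emb m * c1 + emb n * c2) - (emb m * b1 + emb n * b2)
        = ((emb m + emb n * u) * (x - \<phi>) + emb m * \<eta>3) / \<eta>1"
        unfolding b1_def b2_def c1_def c2_def
        by (simp add: add_divide_distrib diff_divide_distrib algebra_simps)
      \<comment> \<open>Writing the factor 1 of the last term as \<open>c + d N\<close> cancels the
        term with \<open>m d\<close> and makes the result bilinear in \<open>(m, n)\<close> and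
        \<open>(a, b, c, d)\<close>.\<close>
      also have "(emb m + emb n * u) * (x - \<phi>) + emb m * \<eta>3
        = (emb m + emb n * u) * (emb a * \<eta>1 + emb b * \<eta>2 - emb d * emb N * \<eta>3)
          + emb m * (emb c + emb d * emb N) * \<eta>3"
        unfolding x 1 by (simp add: emb_mult algebra_simps)
      also have "\<dots> = \<eta>1 * (emb m * emb a + emb n * emb b * emb N * (u * ?u1 * ?u2)
          - emb m * emb c * (u + ?u1 + ?u2) + emb n * emb d * emb N * (u * ?u1 + u * ?u2 + ?u1 * ?u2)
          + (emb m * emb c + emb n * emb a) * u + emb N * (emb m * emb b - emb n * emb d) * (?u1 * ?u2))"
        unfolding \<eta>2 \<eta>3 by (simp add: algebra_simps)
      finally show ?thesis
        using \<eta>1 unfolding e1 e2 e3 by (simp add: emb_add emb_diff emb_mult)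
    qed
    then have "x * (emb m * c1 + emb n * c2) - (emb m * b1 + emb n * b2) \<in> range emb
        \<longleftrightarrow> m * c + n * a = 0 \<and> m * b + n * (- d) = 0" for m n
      using N by (simp add: in_F)
    with cd Qx show ?thesis by blast
  qed
  have "nonsplit b1 b2 c1 c2"
    unfolding nonsplit_def
  proof (intro conjI allI impI)
    fix m n assume "emb m * c1 + emb n * c2 = 0"
    then have "(emb m + emb n * u) / \<eta>1 = 0"
      unfolding c1_def c2_def by (simp add: add_divide_distrib)
    then have "emb m + emb n * u + emb 0 * u\<^sup>2 = 0" using \<eta>1 by simp
    from quadratic_independent[OF u this] show "m = 0" "n = 0" by simp_all
  next
    fix x assume *: "x * c1 - b1 \<in> range emb"
    obtain a b c d where cd: "c + d * N = 1" and
      **: "\<And>m n. x * (emb m * c1 + emb n * c2) - (emb m * b1 + emb n * b2) \<in> range emb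
        \<longleftrightarrow> m * c + n * a = 0 \<and> m * b + n * (- d) = 0"
      using key[of x] by blast
    \<comment> \<open>Both memberships together would give \<open>c = d = 0\<close>, against
      \<open>c + d * N = 1\<close>.\<close>
    show "x * c2 - b2 \<notin> range emb"
      using **[of 1 0] **[of 0 1] * cd by auto
  qed
  moreover have "Q (\<beta> (x *s p + e)) = 0 \<longleftrightarrow> x \<in> affine_part b1 b2 c1 c2" for x
  proof -
    obtain a b c d where Qx: "Q (\<beta> (x *s p + e)) = a * b + c * d" and
      *: "\<And>m n. x * (emb m * c1 + emb n * c2) - (emb m * b1 + emb n * b2) \<in> range emb
        \<longleftrightarrow> m * c + n * a = 0 \<and> m * b + n * (- d) = 0"
      using key[of x] by blast
    have "Q (\<beta> (x *s p + e)) = 0 \<longleftrightarrow> c * (- d) - b * a = 0"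
    proof -
      have "c * (- d) - b * a = - (a * b + c * d)" by (simp add: algebra_simps)
      then show ?thesis unfolding Qx by (simp only: neg_equal_0_iff_equal)
    qed
    then show ?thesis
      unfolding det2_eq_0_iff affine_part_def by (simp add: *)
  qed
  ultimately show thesis using that by blast
qed

end

section \<open>The correspondence\<close>

context abb_frame
begin

definition affine_point :: "'k \<Rightarrow> ('f ^ 'n) set" where
  "affine_point x = vec.span {\<beta> (x *s p + e)}"

lemma affine_eq_0_iff: "x *s p + y *s e = 0 \<longleftrightarrow> x = 0 \<and> y = 0"
  using frame_independent[of x y 0] by auto

lemma affine_vector_nonzero: "x *s p + e \<noteq> 0"
  using affine_eq_0_iff[of x 1] by simp

text \<open>A multiple \<open>c *s (x *s p + e)\<close> is mapped into \<open>solid\<close> iff its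
  \<open>e\<close>-coordinate \<open>c\<close> lies in \<open>'f\<close>, so only one point over
  \<open>'f\<close> remains.\<close>

lemma ABB_span:
  assumes "\<beta> ` line \<inter> \<mu> = solid"
  shows "ABB \<beta> \<mu> (vec.span {x *s p + e}) = affine_point x"
proof -
  have "x *s p + e \<in> line" using line_mem[of x 1] by simp
  then have "vec.span {x *s p + e} \<subseteq> line"
    by (intro vec.span_minimal subspace_line) simp
  then have "ABB \<beta> \<mu> (vec.span {x *s p + e}) = \<beta> ` vec.span {x *s p + e} \<inter> solid"
    unfolding ABB_def assms[symmetric] by blast
  also have "\<dots> = affine_point x"
  proof (intro subset_antisym subsetI)
    fix v assume "v \<in> \<beta> ` vec.span {x *s p + e} \<inter> solid"
    then obtain c X t where v: "v = \<beta> (c *s (x *s p + e))" "v = \<beta> (X *s p + emb t *s e)"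
      by (auto simp: span_singleton_mem solid_def)
    then have "(c * x) *s p + c *s e = X *s p + emb t *s e"
      by (simp add: vec.scale_right_distrib)
    then have "c = emb t" by (metis coord_simps(2))
    then have "v = t *s \<beta> (x *s p + e)" unfolding v(1) by (simp only: \<beta>_scale)
    then show "v \<in> affine_point x" by (auto simp: affine_point_def span_singleton_mem)
  next
    fix v assume "v \<in> affine_point x"
    then obtain t where v: "v = t *s \<beta> (x *s p + e)"
      by (auto simp: affine_point_def span_singleton_mem)
    then have v': "v = \<beta> (emb t *s (x *s p + e))" by (simp only: \<beta>_scale)
    then have "v \<in> \<beta> ` vec.span {x *s p + e}"
      using span_singleton_mem by blast
    moreover have "v = \<beta> ((emb t * x) *s p + emb t *s e)"
      unfolding v' by (simp add: vec.scale_right_distrib)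
    then have "v \<in> solid" by (metis solid_mem)
    ultimately show "v \<in> \<beta> ` vec.span {x *s p + e} \<inter> solid" by blast
  qed
  finally show ?thesis .
qed

lemma ABB_image:
  assumes \<mu>: "\<beta> ` line \<inter> \<mu> = solid" and T: "T \<subseteq> ppoints line"
  shows "ABB \<beta> \<mu> ` (T - {vec.span {p}}) = affine_point ` {x. vec.span {x *s p + e} \<in> T}"
proof -
  have "T - {vec.span {p}} = (\<lambda>x. vec.span {x *s p + e}) ` {x. vec.span {x *s p + e} \<in> T}"
  proof (intro subset_antisym subsetI)
    fix P assume P: "P \<in> T - {vec.span {p}}"
    then have "P \<in> ppoints line" using T by blast
    then obtain w where w: "w \<in> line" "w \<noteq> 0" "P = vec.span {w}" by (rule ppoints_E)
    have "cY w \<noteq> 0"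
    proof
      assume "cY w = 0"
      then have "w = cX w *s p" using line_expansion[OF w(1)] by simp
      then have "P = vec.span {p}" using span_p_eq[OF w(2)] w(3) by blast
      with P show False by blast
    qed
    then have "P = vec.span {(cX w / cY w) *s p + e}"
      unfolding w(3) span_affine_point_eq[OF w(1,2)] by simp
    with P show "P \<in> (\<lambda>x. vec.span {x *s p + e}) ` {x. vec.span {x *s p + e} \<in> T}" by blast
  next
    fix P assume "P \<in> (\<lambda>x. vec.span {x *s p + e}) ` {x. vec.span {x *s p + e} \<in> T}"
    then obtain x where x: "P = vec.span {x *s p + e}" "P \<in> T" by blast
    have "P \<noteq> vec.span {p}"
    proof
      assume "P = vec.span {p}"
      then obtain c where "x *s p + e = c *s p"
        using span_p_eq[OF affine_vector_nonzero] x(1) by blast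
      then have "x *s p + 1 *s e = c *s p + 0 *s e" by simp
      then have "(1 :: 'k) = 0" by (metis coord_simps(2))
      then show False by simp
    qed
    with x show "P \<in> T - {vec.span {p}}" by blast
  qed
  then show ?thesis by (simp add: image_image ABB_span[OF \<mu>])
qed

lemma affine_quadric_eq:
  assumes Q: "quadratic_form_on solid Q"
  shows "{X \<in> quadric solid Q. \<not> X \<subseteq> \<pi>} = affine_point ` {x. Q (\<beta> (x *s p + e)) = 0}"
proof -
  have mem: "\<beta> (x *s p + e) \<in> solid" for x
    using solid_mem[of x 1] by simp
  have scale: "Q (c *s v) = c\<^sup>2 * Q v" if "v \<in> solid" for c v
    using Q that by (auto simp: quadratic_form_on_def)
  show ?thesis
  proof (intro subset_antisym subsetI)
    fix X assume "X \<in> {X \<in> quadric solid Q. \<not> X \<subseteq> \<pi>}"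
    then have X: "X \<in> ppoints solid" "\<And>v. v \<in> X \<Longrightarrow> Q v = 0" "\<not> X \<subseteq> \<pi>"
      by (auto simp: quadric_def)
    obtain v where v: "v \<in> solid" "v \<noteq> 0" "X = vec.span {v}" using X(1) by (rule ppoints_E)
    obtain x t where xt: "v = \<beta> (x *s p + emb t *s e)" using v(1) unfolding solid_def by blast
    have "t \<noteq> 0"
    proof
      assume "t = 0"
      then have "c *s v = \<beta> ((emb c * x) *s p)" for c
        unfolding xt by (simp flip: \<beta>_scale)
      then have "X \<subseteq> \<pi>" unfolding v(3) \<pi>_def by (auto simp: span_singleton_mem)
      with X(3) show False by blast
    qed
    then have "v = \<beta> (emb t *s ((x / emb t) *s p + e))"
      unfolding xt by (simp add: vec.scale_right_distrib)
    then have eq: "v = t *s \<beta> ((x / emb t) *s p + e)" by (simp only: \<beta>_scale)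
    have "X = affine_point (x / emb t)"
      unfolding v(3) affine_point_def
      using eq span_singleton_eq_iff[OF v(2)] affine_vector_nonzero by (metis \<beta>_eq_0_iff)
    moreover from this have "\<beta> ((x / emb t) *s p + e) \<in> X"
      by (auto simp: affine_point_def intro: vec.span_base)
    ultimately show "X \<in> affine_point ` {x. Q (\<beta> (x *s p + e)) = 0}"
      using X(2) by blast
  next
    fix X assume "X \<in> affine_point ` {x. Q (\<beta> (x *s p + e)) = 0}"
    then obtain x where x: "X = affine_point x" "Q (\<beta> (x *s p + e)) = 0" by blast
    have "X \<in> ppoints solid"
      unfolding x(1) affine_point_def
      using affine_vector_nonzero by (intro ppoints_singleton subspace_solid mem) simp
    moreover have "Q v = 0" if "v \<in> X" for v
      using that x(2) scale[OF mem] unfolding x(1) affine_point_def by (auto simp: span_singleton_mem)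
    moreover have "\<not> X \<subseteq> \<pi>"
    proof
      assume "X \<subseteq> \<pi>"
      then have "\<beta> (x *s p + e) \<in> \<pi>"
        unfolding x(1) affine_point_def using vec.span_base by blast
      then obtain y where "\<beta> (x *s p + e) = \<beta> (y *s p)" unfolding \<pi>_def by blast
      then have "x *s p + 1 *s e = y *s p + 0 *s e" by simp
      then have "(1 :: 'k) = 0" by (metis coord_simps(2))
      then show False by simp
    qed
    ultimately show "X \<in> {X \<in> quadric solid Q. \<not> X \<subseteq> \<pi>}" by (auto simp: quadric_def)
  qed
qed

text \<open>Both conditions describe \<open>S\<close> as the affine points with \<open>x\<close> in
  \<open>affine_part b1 b2 c1 c2\<close> for \<open>nonsplit\<close> parameters, which mediate
  between linear set and quadric.\<close>

theorem scattered_linear_set_iff_hyperbolic: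
  assumes \<mu>: "\<beta> ` line \<inter> \<mu> = solid"
    and eigen: "eigenpoint i R" "eigenpoint j R'" "eigenpoint k R''"
  shows "(\<exists>T. scattered_linear_set_rank3 \<beta> line T \<and> vec.span {p} \<in> T \<and>
      S = ABB \<beta> \<mu> ` (T - {vec.span {p}})) \<longleftrightarrow>
    (\<exists>Q. hyperbolic_on solid Q \<and> nondegenerate_on \<pi> Q \<and> {R, R', R''} \<subseteq> extended_quadric emb \<pi> Q \<and>
      S = {X \<in> quadric solid Q. \<not> X \<subseteq> \<pi>})"
proof
  assume "\<exists>T. scattered_linear_set_rank3 \<beta> line T \<and> vec.span {p} \<in> T \<and>
      S = ABB \<beta> \<mu> ` (T - {vec.span {p}})"
  then obtain T where T: "scattered_linear_set_rank3 \<beta> line T" "vec.span {p} \<in> T"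
    and S: "S = ABB \<beta> \<mu> ` (T - {vec.span {p}})" by blast
  obtain b1 b2 c1 c2 where ns: "nonsplit b1 b2 c1 c2"
    and T_eq: "{x. vec.span {x *s p + e} \<in> T} = affine_part b1 b2 c1 c2"
    using T by (rule scattered_imp_affine_part)
  obtain Q where Q: "hyperbolic_on solid Q" "nondegenerate_on \<pi> Q"
    "\<And>i X. eigenpoint i X \<Longrightarrow> X \<in> extended_quadric emb \<pi> Q"
    and Q_eq: "{x. Q (\<beta> (x *s p + e)) = 0} = affine_part b1 b2 c1 c2"
    using nonsplit_imp_hyperbolic[OF ns] by metis
  have "T \<subseteq> ppoints line"
    using T by (simp add: scattered_linear_set_rank3_def linear_set_rank3_def)
  from ABB_image[OF \<mu> this] have "S = affine_point ` affine_part b1 b2 c1 c2"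
    unfolding S T_eq .
  also have "\<dots> = {X \<in> quadric solid Q. \<not> X \<subseteq> \<pi>}"
    using affine_quadric_eq[of Q] Q(1) unfolding Q_eq by (simp add: hyperbolic_on_def)
  finally show "\<exists>Q. hyperbolic_on solid Q \<and> nondegenerate_on \<pi> Q \<and>
      {R, R', R''} \<subseteq> extended_quadric emb \<pi> Q \<and> S = {X \<in> quadric solid Q. \<not> X \<subseteq> \<pi>}"
    using Q(1,2) Q(3)[OF eigen(1)] Q(3)[OF eigen(2)] Q(3)[OF eigen(3)] by blast
next
  assume "\<exists>Q. hyperbolic_on solid Q \<and> nondegenerate_on \<pi> Q \<and>
      {R, R', R''} \<subseteq> extended_quadric emb \<pi> Q \<and> S = {X \<in> quadric solid Q. \<not> X \<subseteq> \<pi>}"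
  then obtain Q where Q: "hyperbolic_on solid Q" "nondegenerate_on \<pi> Q" "R \<in> extended_quadric emb \<pi> Q"
    and S: "S = {X \<in> quadric solid Q. \<not> X \<subseteq> \<pi>}" by blast
  obtain b1 b2 c1 c2 where ns: "nonsplit b1 b2 c1 c2"
    and Q_eq: "{x. Q (\<beta> (x *s p + e)) = 0} = affine_part b1 b2 c1 c2"
    using Q(1,2) eigen(1) Q(3) by (rule hyperbolic_imp_nonsplit)
  obtain T where T: "scattered_linear_set_rank3 \<beta> line T" "vec.span {p} \<in> T"
    and T_eq: "{x. vec.span {x *s p + e} \<in> T} = affine_part b1 b2 c1 c2"
    using ns by (rule nonsplit_imp_scattered)
  have "T \<subseteq> ppoints line"
    using T by (simp add: scattered_linear_set_rank3_def linear_set_rank3_def)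
  from ABB_image[OF \<mu> this] have "ABB \<beta> \<mu> ` (T - {vec.span {p}}) = affine_point ` affine_part b1 b2 c1 c2"
    unfolding T_eq .
  also have "\<dots> = S"
    using affine_quadric_eq[of Q] Q(1) unfolding S Q_eq by (simp add: hyperbolic_on_def)
  finally show "\<exists>T. scattered_linear_set_rank3 \<beta> line T \<and> vec.span {p} \<in> T \<and>
      S = ABB \<beta> \<mu> ` (T - {vec.span {p}})"
    using T by blast
qed

end

section \<open>Choosing the frame in the given configuration\<close>

theorem theorem4p7:
  fixes emb :: "'f::{field,finite} \<Rightarrow> 'k::{field,finite}"
    and \<beta> :: "'k ^ 3 \<Rightarrow> 'f ^ 9"
    and l_inf l P_inf :: "('k ^ 3) set"
    and H_inf \<mu> \<pi>_inf \<Pi>\<^sub>l :: "('f ^ 9) set"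
    and \<sigma> :: "('k ^ 9) set \<Rightarrow> ('k ^ 9) set"
    and \<nu> R :: "('k ^ 9) set"
    and S :: "('f ^ 9) set set"
  assumes "CARD('k) = CARD('f) ^ 3"
    and "field_reduction emb \<beta>"
    and "l_inf \<in> psubspaces 1 UNIV"
    and "H_inf = \<beta> ` l_inf"
    and "\<mu> \<in> psubspaces 6 UNIV" and "H_inf \<subseteq> \<mu>"
    and "l \<in> psubspaces 1 UNIV" and "l \<noteq> l_inf"
    and "P_inf = l \<inter> l_inf"
    and "\<pi>_inf = \<beta> ` P_inf"
    and "\<Pi>\<^sub>l = \<beta> ` l \<inter> \<mu>"
    and "generates_stabiliser emb H_inf \<sigma>"
    and "indicator_line emb H_inf (spread \<beta> l_inf) \<sigma> \<nu>"
    and "R = \<nu> \<inter> ext emb \<pi>_inf"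
    and "S \<subseteq> ppoints \<Pi>\<^sub>l"
  shows "(\<exists>T. scattered_linear_set_rank3 \<beta> l T \<and> P_inf \<in> T \<and>
              S = ABB \<beta> \<mu> ` (T - {P_inf}))
     \<longleftrightarrow>
         (\<exists>Q. hyperbolic_on \<Pi>\<^sub>l Q \<and> nondegenerate_on \<pi>_inf Q \<and>
              {R, \<sigma> R, \<sigma> (\<sigma> R)} \<subseteq> extended_quadric emb \<pi>_inf Q \<and>
              S = {X \<in> quadric \<Pi>\<^sub>l Q. \<not> X \<subseteq> \<pi>_inf})"
proof -
  interpret reduction emb \<beta>
    by standard (use assms(1,2) in \<open>auto simp: field_reduction_def\<close>)
  have l_inf: "vec.subspace l_inf" "vec.dim l_inf = 2" and l: "vec.subspace l" "vec.dim l = 2"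
    and \<mu>: "vec.subspace \<mu>" "vec.dim \<mu> = 7"
    using assms(3,5,7) by (auto simp: psubspaces_def)
  have P: "P_inf \<in> ppoints UNIV" and sum: "\<And>w. \<exists>s\<in>l. \<exists>h\<in>l_inf. w = s + h"
    using distinct_planes_meet[OF assms(7,3,8)] assms(9) by blast+
  obtain p where p: "p \<noteq> 0" "P_inf = vec.span {p}" using P by (rule ppoints_E)
  have p_mem: "p \<in> l" "p \<in> l_inf" using p(2) assms(9) vec.span_base[of p "{p}"] by auto
  have H: "vec.subspace H_inf" unfolding assms(4) by (rule subspace_image_\<beta>[OF l_inf(1)])
  have card_H: "card H_inf = CARD('f) ^ 6"
  proof -
    have "card H_inf = card l_inf" unfolding assms(4) by (intro card_image) (simp add: inj_on_def)
    then show ?thesis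
      using card_subspace[OF l_inf(1)] l_inf(2) card_K by (simp flip: power_mult)
  qed
  have card_\<mu>: "card \<mu> = CARD('f) ^ 7" using card_subspace[OF \<mu>(1)] \<mu>(2) by simp
  have "card H_inf < card \<mu>"
    unfolding card_H card_\<mu> using two_le_card_F by (intro power_strict_increasing) auto
  \<comment> \<open>This vector is split along \<open>l\<close> and \<open>l_inf\<close>. Its second
    part is mapped into \<open>H_inf\<close>, so the first is a vector \<open>e\<close> of
    \<open>l\<close> with \<open>\<beta> e\<close> in \<open>\<mu>\<close> but outside
    \<open>H_inf\<close>.\<close>
  then obtain m where m: "m \<in> \<mu>" "m \<notin> H_inf"
    by (metis card_mono finite leD subsetI)
  obtain e h where e: "e \<in> l" and h: "h \<in> l_inf" "inv \<beta> m = e + h" using sum by blast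
  have m_eq: "m = \<beta> e + \<beta> h" by (metis \<beta>_add \<beta>_inv h(2))
  have e_\<mu>: "\<beta> e \<in> \<mu>"
  proof -
    have "\<beta> h \<in> \<mu>" using h(1) assms(4,6) by blast
    then have "m - \<beta> h \<in> \<mu>" using m(1) \<mu>(1) vec.subspace_diff by blast
    then show ?thesis by (simp add: m_eq)
  qed
  have e_H: "\<beta> e \<notin> H_inf"
    using m(2) m_eq h(1) H vec.subspace_add assms(4) by blast
  then have e_l_inf: "e \<notin> l_inf" using assms(4) by blast
  have "\<not> l_inf \<subseteq> P_inf"
    using l_inf(2) P vec.dim_subset[of l_inf P_inf] by (auto simp: psubspaces_def)
  then obtain g where g: "g \<in> l_inf" "g \<notin> P_inf" by blast
  have indep: "x = 0 \<and> y = 0 \<and> z = 0" if zero: "x *s p + y *s e + z *s g = 0" for x y z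
  proof -
    have y: "y = 0"
    proof (rule ccontr)
      assume "y \<noteq> 0"
      have "(- inverse y) *s (x *s p + z *s g) \<in> l_inf"
        using p_mem g l_inf(1) by (intro vec.subspace_scale vec.subspace_add)
      moreover have "x *s p + z *s g = - (y *s e)"
        using zero by (simp add: eq_neg_iff_add_eq_0 algebra_simps)
      then have "(- inverse y) *s (x *s p + z *s g) = e" using \<open>y \<noteq> 0\<close> by simp
      ultimately show False using e_l_inf by simp
    qed
    have z: "z = 0"
    proof (rule ccontr)
      assume "z \<noteq> 0"
      have "z *s g = (- x) *s p"
        using zero y by (simp add: eq_neg_iff_add_eq_0 algebra_simps)
      then have "g = inverse z *s ((- x) *s p)" using \<open>z \<noteq> 0\<close> by (metis vec.scale_scale vec.scale_one left_inverse)
      then have "g \<in> P_inf" unfolding p(2) vec.scale_scale span_singleton_mem by blast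
      with g(2) show False by blast
    qed
    with zero y p(1) show ?thesis by simp
  qed
  have frame: "\<exists>x y z. w = x *s p + y *s e + z *s g" for w
  proof -
    let ?h = "\<lambda>(x, y, z). x *s p + y *s e + z *s g"
    have "inj ?h"
    proof (rule injI, unfold split_paired_all split_conv prod.inject)
      fix x y z x' y' z'
      assume "x *s p + y *s e + z *s g = x' *s p + y' *s e + z' *s g"
      then have "(x - x') *s p + (y - y') *s e + (z - z') *s g = 0"
        by (simp add: vec.scale_left_diff_distrib algebra_simps)
      from indep[OF this] show "x = x' \<and> y = y' \<and> z = z'" by simp
    qed
    then have "card (range ?h) = CARD('k ^ 3)"
      by (simp add: card_image CARD_vec eval_nat_numeral)
    then have "range ?h = UNIV" by (intro card_subset_eq) auto
    then have "w \<in> range ?h" by simp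
    then show ?thesis by auto
  qed
  obtain u where u: "u \<notin> range emb" using not_surj_emb by blast
  have "\<beta> p \<in> H_inf" "\<beta> (u *s p) \<in> H_inf" "\<beta> p \<noteq> 0"
    using p_mem p(1) assms(4) l_inf(1) by (auto intro: vec.subspace_scale)
  moreover have "\<beta> (u *s p) \<noteq> c *s \<beta> p" for c
    using p(1) u by (auto simp flip: \<beta>_scale)
  moreover have "fixes_subgeometry emb H_inf \<sigma>"
    using assms(12) by (simp add: generates_stabiliser_def)
  ultimately obtain \<theta> where \<theta>: "field_embedding \<theta>" "\<And>c. \<theta> (emb c) = emb c"
    "\<And>X. X \<in> ppoints (ext emb H_inf) \<Longrightarrow> \<sigma> X = map_vec \<theta> ` X"
    using fixes_subgeometry_semilinear[OF H] by metis
  have "\<exists>x. \<theta> x \<noteq> x"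
    using \<theta>(3) assms(13) by (rule indicator_line_nontrivial)
  with \<theta>(1,2) indep frame interpret abb_frame emb \<beta> \<theta> p e g
    by unfold_locales
  have l_inf_eq: "l_inf = l_infinity"
  proof
    show "l_infinity \<subseteq> l_inf"
      unfolding l_infinity_def using p_mem g l_inf(1)
      by (auto intro!: vec.subspace_add vec.subspace_scale)
    show "l_inf \<subseteq> l_infinity"
    proof
      fix w assume w: "w \<in> l_inf"
      obtain x y z where xyz: "w = x *s p + y *s e + z *s g" using frame by blast
      have "y = 0"
      proof (rule ccontr)
        assume "y \<noteq> 0"
        have "inverse y *s (w - (x *s p + z *s g)) \<in> l_inf"
          using w p_mem g l_inf(1) by (intro vec.subspace_scale vec.subspace_diff vec.subspace_add)
        moreover have "inverse y *s (w - (x *s p + z *s g)) = e"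
          unfolding xyz using \<open>y \<noteq> 0\<close> by simp
        ultimately show False using e_l_inf by simp
      qed
      with xyz show "w \<in> l_infinity" unfolding l_infinity_def by auto
    qed
  qed
  have l_eq: "l = line"
  proof
    show "line \<subseteq> l"
      unfolding line_def using p_mem e l(1)
      by (auto intro!: vec.subspace_add vec.subspace_scale)
    show "l \<subseteq> line"
    proof
      fix w assume w: "w \<in> l"
      obtain x y z where xyz: "w = x *s p + y *s e + z *s g" using frame by blast
      have "z = 0"
      proof (rule ccontr)
        assume "z \<noteq> 0"
        have "inverse z *s (w - (x *s p + y *s e)) \<in> l"
          using w p_mem e l(1) by (intro vec.subspace_scale vec.subspace_diff vec.subspace_add)
        moreover have "inverse z *s (w - (x *s p + y *s e)) = g"
          unfolding xyz using \<open>z \<noteq> 0\<close> by simp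
        ultimately show False using g assms(9) by simp
      qed
      with xyz show "w \<in> line" unfolding line_def by auto
    qed
  qed
  have H_eq: "H_inf = H"
    unfolding assms(4) H_def l_inf_eq l_infinity_def ..
  have \<pi>_eq: "\<pi>_inf = \<pi>"
    unfolding assms(10) \<pi>_def p(2) by (auto simp: vec.span_singleton)
  \<comment> \<open>\<open>H_inf\<close> has index \<open>q\<close> in \<open>\<mu>\<close>, so a
    single further vector fills the space.\<close>
  have \<mu>_eq: "\<mu> = {h + c *s \<beta> e | h c. h \<in> H_inf}"
  proof -
    let ?h = "\<lambda>(h, c). h + c *s \<beta> e"
    have "inj_on ?h (H_inf \<times> UNIV)"
    proof (rule inj_onI, clarify)
      fix h h' c c' assume hh: "h \<in> H_inf" "h' \<in> H_inf" and eq: "h + c *s \<beta> e = h' + c' *s \<beta> e"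
      have "c = c'"
      proof (rule ccontr)
        assume ne: "c \<noteq> c'"
        have "(c - c') *s \<beta> e = h' - h" using eq by (simp add: vec.scale_left_diff_distrib algebra_simps)
        then have "\<beta> e = inverse (c - c') *s (h' - h)"
          using ne by (metis left_inverse right_minus_eq vec.scale_one vec.scale_scale)
        then have "\<beta> e \<in> H_inf" using hh H by (simp add: vec.subspace_scale vec.subspace_diff)
        with e_H show False by blast
      qed
      with eq show "h = h' \<and> c = c'" by simp
    qed
    then have "card (?h ` (H_inf \<times> UNIV)) = card \<mu>"
      by (simp add: card_image card_cartesian_product card_H card_\<mu> eval_nat_numeral)
    moreover have "?h ` (H_inf \<times> UNIV) \<subseteq> \<mu>"
      using assms(6) e_\<mu> \<mu>(1) by (auto intro!: vec.subspace_add vec.subspace_scale)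
    ultimately have "?h ` (H_inf \<times> UNIV) = \<mu>" by (intro card_subset_eq) auto
    moreover have "?h ` (H_inf \<times> UNIV) = {h + c *s \<beta> e | h c. h \<in> H_inf}"
      by force
    ultimately show ?thesis by simp
  qed
  have \<Pi>_eq: "\<beta> ` line \<inter> \<mu> = solid"
  proof (intro subset_antisym subsetI)
    fix v assume v: "v \<in> \<beta> ` line \<inter> \<mu>"
    then obtain x y where xy: "v = \<beta> (x *s p + y *s e)" unfolding line_def by blast
    obtain h c where h: "h \<in> H_inf" "v = h + c *s \<beta> e" using v \<mu>_eq by blast
    obtain x' z' where h_eq: "h = \<beta> (x' *s p + z' *s g)" using h(1) unfolding H_eq H_def by blast
    have "v = \<beta> (x' *s p + z' *s g + emb c *s e)"
      unfolding h(2) h_eq by (simp only: \<beta>_add \<beta>_scale)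
    then have "x *s p + y *s e + 0 *s g = x' *s p + emb c *s e + z' *s g"
      unfolding xy by (simp add: algebra_simps)
    then have "y = emb c" by (rule frame_unique)
    then show "v \<in> solid" using xy by simp
  next
    fix v assume "v \<in> solid"
    then obtain x t where xt: "v = \<beta> (x *s p + emb t *s e)" unfolding solid_def by blast
    have "x *s p \<in> l_inf" using p_mem l_inf(1) by (intro vec.subspace_scale)
    then have "\<beta> (x *s p) \<in> \<mu>" using assms(4,6) by blast
    then have "\<beta> (x *s p) + t *s \<beta> e \<in> \<mu>" using e_\<mu> \<mu>(1) by (intro vec.subspace_add vec.subspace_scale)
    moreover have "v = \<beta> (x *s p) + t *s \<beta> e" unfolding xt by (simp only: \<beta>_add \<beta>_scale)
    ultimately show "v \<in> \<beta> ` line \<inter> \<mu>" using xt line_mem by blast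
  qed
  have "\<exists>i. eigenpoint i R \<and> eigenpoint (Suc i) (\<sigma> R) \<and> eigenpoint (Suc (Suc i)) (\<sigma> (\<sigma> R))"
    using \<theta>(3) assms(13,14) unfolding H_eq l_inf_eq \<pi>_eq by (rule indicator_line_eigenpoints)
  then obtain i where "eigenpoint i R" "eigenpoint (Suc i) (\<sigma> R)" "eigenpoint (Suc (Suc i)) (\<sigma> (\<sigma> R))"
    by blast
  from scattered_linear_set_iff_hyperbolic[OF \<Pi>_eq this] show ?thesis
    unfolding assms(11) l_eq \<Pi>_eq \<pi>_eq p(2) .
qed

end
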